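(* Let $p=p(n)\in(0,1)$, $d=np$, and suppose $$d\gg\sqrt{\frac{\log n}{\log\log n}}\qquad\text{and}\qquad \log d\ll\log(1/p).$$ Let $\mathbb{G}_n\stackrel{d}{=}\mathbb{G}(n,p)$. Then for any $\delta>0$ and $\chi\in(0,1)$, $$\mathbb{P}\left(\Delta(\mathbb{G}_n)\ge(1+\delta)^2(1-\chi)d^2\,\big|\,\lambda(\mathbb{G}_n)\ge(1+\delta)d\right)\to1\quad\text{as }n\to\infty.$$
   Context: $\mathbb{G}(n,p)$ is the Erdős–Rényi random graph on $[n]$ with edge probability $p$. For a graph $G$, $\lambda(G)$ is the largest eigenvalue of its adjacency matrix and $\Delta(G)$ is its maximum degree. For positive sequences, $a_n\gg b_n$ (equivalently $b_n\ll a_n$) means $b_n/a_n\to0$. *)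

theory Defs
  imports
    "HOL-Probability.Probability"
    "Jordan_Normal_Form.Char_Poly"
begin

text \<open>A simple graph on the vertex set \<open>{..<n}\<close> is represented by its set of edges,
  a subset of \<open>vertex_pairs n\<close>.\<close>

definition vertex_pairs :: "nat \<Rightarrow> nat set set" where
  "vertex_pairs n = {e. e \<subseteq> {..<n} \<and> card e = 2}"

text \<open>The law of the Erdos-Renyi graph: independent Bernoulli(\<open>p\<close>) indicators
  for the vertex pairs, mapped to the set of pairs whose indicator is true.\<close>

definition gnp :: "nat \<Rightarrow> real \<Rightarrow> nat set set pmf" where
  "gnp n p = map_pmf (\<lambda>X. {e \<in> vertex_pairs n. X e})
     (Pi_pmf (vertex_pairs n) False (\<lambda>_. bernoulli_pmf p))"

definition adjacency_mat :: "nat \<Rightarrow> nat set set \<Rightarrow> real mat" where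
  "adjacency_mat n E = mat n n (\<lambda>(u, v). if {u, v} \<in> E then 1 else 0)"

text \<open>For \<open>n \<ge> 1\<close> the set below is finite and, the matrix being real symmetric, nonempty;
  for \<open>n = 0\<close> both \<open>Max\<close> terms range over the empty set and the values are irrelevant.\<close>

definition max_eigenvalue :: "nat \<Rightarrow> nat set set \<Rightarrow> real" where
  "max_eigenvalue n E = Max {x. eigenvalue (adjacency_mat n E) x}"

definition max_degree :: "nat \<Rightarrow> nat set set \<Rightarrow> nat" where
  "max_degree n E = Max ((\<lambda>v. card {u \<in> {..<n}. {u, v} \<in> E}) ` {..<n})"

text \<open>Used for sequences that are positive for all large \<open>n\<close>; the finitely many other terms
  do not matter.\<close>

definition much_less :: "(nat \<Rightarrow> real) \<Rightarrow> (nat \<Rightarrow> real) \<Rightarrow> bool" (infix "\<lless>" 50) where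
  "b \<lless> a \<longleftrightarrow> (\<lambda>n. b n / a n) \<longlonglongrightarrow> 0"

end

theory Submission
  imports Defs "HOL-Real_Asymp.Real_Asymp"
begin

text \<open>Write \<open>L = d\<^sup>2 ln d\<close>. A single vertex of degree \<open>(1 + \<delta>)\<^sup>2 d\<^sup>2\<close> forces the eigenvalue above
  \<open>(1 + \<delta>) d\<close> and has probability at least \<open>exp (- C L)\<close>. Conversely, without a vertex of degree
  \<open>(1 + \<delta>)\<^sup>2 (1 - chi) d\<^sup>2\<close> the eigenvalue exceeds \<open>(1 + \<delta>) d\<close> with probability at most
  \<open>exp (- C L)\<close> for \<^emph>\<open>every\<close> \<open>C\<close>.
  To see this, let \<open>x\<close> be a nonnegative unit top eigenvector and split the edges. Edges at the boundedly
  many vertices of degree \<open>\<ge> \<eta> d\<^sup>2\<close> form disjoint stars up to few edges; they contribute at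
  most the square root of the maximum degree times the mass of \<open>x\<close> on these stars. Other edges touching
  a small vertex set (large degrees, neighbours of huge degrees, large entries of \<open>x\<close>) form a
  graph of low degeneracy up to \<open>\<beta> d\<^sup>2\<close> edges, because a dense core meeting a small set is
  too expensive; a degeneracy-\<open>K\<close> graph of maximum degree \<open>D\<close> has norm at most
  \<open>2 sqrt (K D)\<close>, which is a small multiple of \<open>d\<close>. On the remaining delocalized part of \<open>x\<close> the
  quadratic form is at most \<open>d\<close> times its mass, by a Chernoff bound over a net.\<close>

subsection \<open>The largest eigenvalue as a Rayleigh quotient\<close>

text \<open>What decides is the price of an edge: near a vertex of degree of order
  \<open>d^2\<close> an edge costs a power of \<open>d\<close>, a surplus edge among few vertices a
  power of \<open>n\<close>. As \<open>ln d\<close> is negligible against \<open>ln n\<close>, even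
  \<beta> d^2 surplus edges are too expensive for each fixed \<beta> > 0, and stars are the only
  affordable deviation. The obstacle is the exact constant 1 + \<delta>: stars and bulk must enter
  through the maximum of \<open>sqrt \<Delta>\<close> and \<open>d\<close>, not through their sum.
  Hence the bulk part of the eigenvector is cut to 0 on every neighbour of a star centre. Three
  constraints give the exponents. Entries are cut at \<open>d^(1/4) / sqrt n\<close>, so that a
  Chernoff exponent of order \<open>n d^(1/2)\<close> beats net entropy of order
  \<open>n ln d\<close>. The at most \<open>n d^(-1/2)\<close> vertices with larger entries lead to
  degeneracy of order \<open>d^(3/4)\<close>, so degrees must stay well below
  \<open>d^(5/4)\<close>, whence the second degree threshold \<open>d^(9/8)\<close>. Vertices above
  it, with the neighbours of star centres, number at most \<open>n / d^2\<close>; there degeneracy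
  16 suffices and degrees up to \<eta> d^2 are tolerable.\<close>

definition quad_form :: "nat \<Rightarrow> (nat \<Rightarrow> nat \<Rightarrow> real) \<Rightarrow> (nat \<Rightarrow> real) \<Rightarrow> real" where
  "quad_form n a x = (\<Sum>i<n. \<Sum>j<n. a i j * x i * x j)"

lemma quad_form_scale: "quad_form n a (\<lambda>i. c * x i) = c\<^sup>2 * quad_form n a x"
  by (simp add: quad_form_def sum_distrib_left power2_eq_square mult_ac)

lemma quad_form_add_scaled:
  assumes sym: "\<And>i j. a i j = a j i"
  shows "quad_form n a (\<lambda>i. x i + t * z i) =
    quad_form n a x + 2 * t * (\<Sum>i<n. z i * (\<Sum>j<n. a i j * x j)) + t\<^sup>2 * quad_form n a z"
proof -
  have cross: "(\<Sum>i<n. \<Sum>j<n. a i j * x i * z j) = (\<Sum>i<n. \<Sum>j<n. a i j * z i * x j)"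
    by (subst sum.swap) (simp add: sym mult_ac)
  have "quad_form n a (\<lambda>i. x i + t * z i) = (\<Sum>i<n. \<Sum>j<n. a i j * x i * x j
      + t * (a i j * z i * x j) + t * (a i j * x i * z j) + t\<^sup>2 * (a i j * z i * z j))"
    unfolding quad_form_def
    by (intro sum.cong refl) (simp add: algebra_simps power2_eq_square)
  also have "\<dots> = quad_form n a x + t * (\<Sum>i<n. \<Sum>j<n. a i j * z i * x j)
      + t * (\<Sum>i<n. \<Sum>j<n. a i j * x i * z j) + t\<^sup>2 * quad_form n a z"
    by (simp add: quad_form_def sum.distrib sum_distrib_left)
  finally have expand: "quad_form n a (\<lambda>i. x i + t * z i) = \<dots>" .
  have "(\<Sum>i<n. \<Sum>j<n. a i j * z i * x j) = (\<Sum>i<n. z i * (\<Sum>j<n. a i j * x j))"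
    by (simp add: sum_distrib_left mult_ac)
  thus ?thesis unfolding expand cross by simp
qed

lemma linear_coeff_zero_if_quadratic_nonneg:
  fixes b c :: real
  assumes "\<And>t. 0 \<le> 2 * t * b + t\<^sup>2 * c"
  shows "b = 0"
proof (rule ccontr)
  assume b: "b \<noteq> 0"
  \<comment> \<open>At \<open>t = - s b\<close> the linear term -2 s b^2 outweighs s^2 b^2 c,
    because s c < 1.\<close>
  define s where "s = 1 / (\<bar>c\<bar> + 1)"
  have s: "s > 0" "s * c < 1" "s * c \<le> 1"
    by (auto simp: s_def divide_simps)
  have "0 \<le> 2 * (- s * b) * b + (- s * b)\<^sup>2 * c" by (rule assms)
  also have "\<dots> = s * b\<^sup>2 * (s * c - 2)"
    by (simp add: power2_eq_square algebra_simps)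
  also have "\<dots> < 0"
    using s b by (intro mult_pos_neg) auto
  finally show False by simp
qed

text \<open>Compactness gives a maximizer \<open>x\<close>. Along each line \<open>x + t z\<close>
  the slack in the Rayleigh bound is a nonnegative quadratic in \<open>t\<close> that vanishes at 0,
  so its linear coefficient is 0; with \<open>z\<close> a coordinate vector this is one row of the
  eigenvalue equation.\<close>

lemma rayleigh_maximum:
  assumes n: "n \<ge> 1" and sym: "\<And>i j. a i j = a j i"
  obtains x \<mu> where "(\<Sum>i<n. (x i)\<^sup>2) = 1" "quad_form n a x = \<mu>"
    "\<And>i. i < n \<Longrightarrow> (\<Sum>j<n. a i j * x j) = \<mu> * x i"
    "\<And>y. quad_form n a y \<le> \<mu> * (\<Sum>i<n. (y i)\<^sup>2)"
proof -
  \<comment> \<open>Coordinates from \<open>n\<close> on are pinned to 0, so that the sphere is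
    closed inside a product of compact sets even though the functions live on all naturals.\<close>
  define box where "box = PiE UNIV (\<lambda>i. if i < n then {-1..1::real} else {0})"
  define sphere where "sphere = box \<inter> {x. (\<Sum>i<n. (x i)\<^sup>2) = 1}"
  have "compactin (product_topology (\<lambda>i. euclidean :: real topology) (UNIV :: nat set)) box"
    unfolding box_def by (subst compactin_PiE) auto
  hence "compact box"
    by (simp add: euclidean_product_topology)
  moreover have "closed {x :: nat \<Rightarrow> real. (\<Sum>i<n. (x i)\<^sup>2) = 1}"
    by (intro closed_Collect_eq continuous_intros continuous_on_product_coordinates)
  ultimately have comp: "compact sphere"
    unfolding sphere_def by (rule compact_Int_closed)
  have "(\<lambda>i. if i = 0 then 1 else 0) \<in> sphere"
    using n by (auto simp: sphere_def box_def if_distrib[of "\<lambda>x. x\<^sup>2"] cong: if_cong)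
  hence ne: "sphere \<noteq> {}" by blast
  have cont: "continuous_on sphere (quad_form n a)"
    unfolding quad_form_def
    by (intro continuous_intros continuous_on_subset[OF continuous_on_product_coordinates]) auto
  obtain x where x: "x \<in> sphere" and max: "\<And>y. y \<in> sphere \<Longrightarrow> quad_form n a y \<le> quad_form n a x"
    using continuous_attains_sup[OF comp ne cont] by blast
  define \<mu> where "\<mu> = quad_form n a x"
  have x1: "(\<Sum>i<n. (x i)\<^sup>2) = 1" using x by (simp add: sphere_def)
  have bound: "quad_form n a y \<le> \<mu> * (\<Sum>i<n. (y i)\<^sup>2)" for y
  proof (cases "(\<Sum>i<n. (y i)\<^sup>2) = 0")
    case True
    hence "y i = 0" if "i < n" for i
      using that by (subst (asm) sum_nonneg_eq_0_iff) auto
    thus ?thesis by (simp add: quad_form_def)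
  next
    case False
    define r where "r = sqrt (\<Sum>i<n. (y i)\<^sup>2)"
    have r: "r > 0" "r\<^sup>2 = (\<Sum>i<n. (y i)\<^sup>2)"
      using False by (auto simp: r_def sum_nonneg less_le)
    define y' where "y' = (\<lambda>i. (1 / r) * (if i < n then y i else 0))"
    have sq: "(\<Sum>i<n. (y' i)\<^sup>2) = 1"
      using r False by (simp add: y'_def power_divide flip: sum_divide_distrib)
    have "y' i \<in> {-1..1}" if "i < n" for i
    proof -
      have "(y' i)\<^sup>2 \<le> (\<Sum>i<n. (y' i)\<^sup>2)"
        using that by (intro member_le_sum) auto
      thus ?thesis using sq by (simp add: abs_square_le_1 abs_le_iff)
    qed
    moreover have "y' i = 0" if "\<not> i < n" for i using that by (simp add: y'_def)
    ultimately have "y' \<in> sphere"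
      using sq by (auto simp: sphere_def box_def)
    hence "quad_form n a y' \<le> \<mu>" using max by (simp add: \<mu>_def)
    moreover have "quad_form n a y' = quad_form n a (\<lambda>i. (1 / r) * y i)"
      unfolding quad_form_def y'_def by (intro sum.cong) auto
    hence "quad_form n a y' = (1 / r)\<^sup>2 * quad_form n a y"
      by (simp only: quad_form_scale)
    ultimately have "quad_form n a y \<le> \<mu> * r\<^sup>2"
      using r(1) by (simp add: field_simps)
    thus ?thesis by (simp add: r(2))
  qed
  have eig: "(\<Sum>j<n. a i j * x j) = \<mu> * x i" if i: "i < n" for i
  proof -
    define z where "z = (\<lambda>j. if j = i then 1 else 0 :: real)"
    have zs: "(\<Sum>j<n. z j * g j) = g i" for g :: "nat \<Rightarrow> real"
      using i by (simp add: z_def if_distrib[of "\<lambda>x. x * _"] cong: if_cong)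
    have z2: "(\<Sum>j<n. (z j)\<^sup>2) = 1"
      using zs[of z] by (simp add: power2_eq_square) (simp add: z_def)
    define b where "b = \<mu> * x i - (\<Sum>j<n. a i j * x j)"
    define c where "c = \<mu> - quad_form n a z"
    have "0 \<le> 2 * t * b + t\<^sup>2 * c" for t
    proof -
      have "quad_form n a (\<lambda>i. x i + t * z i) \<le> \<mu> * (\<Sum>i<n. (x i + t * z i)\<^sup>2)"
        by (rule bound)
      also have "(\<Sum>i<n. (x i + t * z i)\<^sup>2) =
          (\<Sum>i<n. (x i)\<^sup>2) + 2 * t * (\<Sum>i<n. z i * x i) + t\<^sup>2 * (\<Sum>i<n. (z i)\<^sup>2)"
        by (simp add: power2_eq_square algebra_simps sum.distrib sum_distrib_left)
      also have "\<dots> = 1 + 2 * t * x i + t\<^sup>2"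
        by (simp add: x1 z2 zs)
      finally show ?thesis
        unfolding quad_form_add_scaled[OF sym] zs
        by (simp add: b_def c_def \<mu>_def algebra_simps)
    qed
    hence "b = 0" by (rule linear_coeff_zero_if_quadratic_nonneg)
    thus ?thesis by (simp add: b_def)
  qed
  show ?thesis by (rule that[OF x1 \<mu>_def[symmetric] eig bound])
qed

section \<open>The adjacency matrix and its largest eigenvalue\<close>

definition adj :: "nat set set \<Rightarrow> nat \<Rightarrow> nat \<Rightarrow> real" where
  "adj E u v = (if {u, v} \<in> E then 1 else 0)"

lemma adj_sym: "adj E u v = adj E v u"
  by (simp add: adj_def insert_commute)

lemma adjacency_mat_carrier: "adjacency_mat n E \<in> carrier_mat n n"
  by (simp add: adjacency_mat_def)

lemma adjacency_mat_mult_vec: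
  assumes "v \<in> carrier_vec n" "i < n"
  shows "(adjacency_mat n E *\<^sub>v v) $ i = (\<Sum>j<n. adj E i j * v $ j)"
  using assms by (simp add: adjacency_mat_def adj_def scalar_prod_def lessThan_atLeast0)

text \<open>The Rayleigh maximizer is an eigenvector for \<mu>, and at any other eigenvector the
  Rayleigh quotient equals its eigenvalue, which is therefore at most \<mu>.\<close>

lemma max_eigenvalue_eq_rayleigh_maximum:
  assumes n: "n \<ge> 1"
  obtains x where "(\<Sum>i<n. (x i)\<^sup>2) = 1" "quad_form n (adj E) x = max_eigenvalue n E"
    "\<And>y. quad_form n (adj E) y \<le> max_eigenvalue n E * (\<Sum>i<n. (y i)\<^sup>2)"
proof -
  let ?A = "adjacency_mat n E"
  obtain x \<mu> where x: "(\<Sum>i<n. (x i)\<^sup>2) = 1" "quad_form n (adj E) x = \<mu>"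
    "\<And>i. i < n \<Longrightarrow> (\<Sum>j<n. adj E i j * x j) = \<mu> * x i"
    "\<And>y. quad_form n (adj E) y \<le> \<mu> * (\<Sum>i<n. (y i)\<^sup>2)"
    by (rule rayleigh_maximum[OF n, of "adj E", OF adj_sym]) (rule that)
  have "Max {k. eigenvalue ?A k} = \<mu>"
  proof (rule Max_eqI)
    \<comment> \<open>\<open>Max\<close> is meaningful only on a finite set; the eigenvalues are the
      roots of a monic polynomial.\<close>
    have "char_poly ?A \<noteq> 0"
      using degree_monic_char_poly[OF adjacency_mat_carrier[of n E]] by auto
    thus "finite {k. eigenvalue ?A k}"
      unfolding eigenvalue_root_char_poly[OF adjacency_mat_carrier] by (rule poly_roots_finite)
  next
    define v where "v = vec n x"
    have v: "v \<in> carrier_vec n" by (simp add: v_def)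
    have "?A *\<^sub>v v = \<mu> \<cdot>\<^sub>v v"
    proof (rule eq_vecI)
      fix i assume "i < dim_vec (\<mu> \<cdot>\<^sub>v v)"
      hence i: "i < n" by (simp add: v_def)
      show "(?A *\<^sub>v v) $ i = (\<mu> \<cdot>\<^sub>v v) $ i"
        unfolding adjacency_mat_mult_vec[OF v i] using i x(3)[OF i] by (simp add: v_def)
    qed (simp add: adjacency_mat_def v_def)
    moreover have "v \<noteq> 0\<^sub>v n"
    proof
      assume "v = 0\<^sub>v n"
      hence "x i = 0" if "i < n" for i
        using that by (metis index_vec index_zero_vec(1) v_def)
      with x(1) show False by simp
    qed
    ultimately have "eigenvector ?A v \<mu>"
      using v by (simp add: eigenvector_def adjacency_mat_def)
    thus "\<mu> \<in> {k. eigenvalue ?A k}" by (auto simp: eigenvalue_def)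
  next
    fix k assume "k \<in> {k. eigenvalue ?A k}"
    then obtain v where v: "v \<in> carrier_vec n" "v \<noteq> 0\<^sub>v n" and eq: "?A *\<^sub>v v = k \<cdot>\<^sub>v v"
      by (auto simp: eigenvalue_def eigenvector_def adjacency_mat_def)
    let ?y = "\<lambda>i. v $ i"
    have row: "(\<Sum>j<n. adj E i j * ?y j) = k * ?y i" if "i < n" for i
      using adjacency_mat_mult_vec[OF v(1) that, of E] that v(1) by (simp add: eq)
    have "quad_form n (adj E) ?y = (\<Sum>i<n. ?y i * (\<Sum>j<n. adj E i j * ?y j))"
      by (simp add: quad_form_def sum_distrib_left mult_ac)
    also have "\<dots> = (\<Sum>i<n. ?y i * (k * ?y i))"
      by (intro sum.cong refl) (simp add: row)
    also have "\<dots> = k * (\<Sum>i<n. (?y i)\<^sup>2)"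
      by (simp add: sum_distrib_left power2_eq_square mult_ac)
    finally have le: "k * (\<Sum>i<n. (?y i)\<^sup>2) \<le> \<mu> * (\<Sum>i<n. (?y i)\<^sup>2)"
      using x(4)[of ?y] by simp
    have "(\<Sum>i<n. (?y i)\<^sup>2) \<noteq> 0"
    proof
      assume "(\<Sum>i<n. (?y i)\<^sup>2) = 0"
      hence "?y i = 0" if "i < n" for i
        using that by (subst (asm) sum_nonneg_eq_0_iff) auto
      hence "v = 0\<^sub>v n" using v(1) by (intro eq_vecI) auto
      with v(2) show False by simp
    qed
    hence "(\<Sum>i<n. (?y i)\<^sup>2) > 0" by (simp add: less_le sum_nonneg)
    with le show "k \<le> \<mu>" by simp
  qed
  hence "max_eigenvalue n E = \<mu>" by (simp add: max_eigenvalue_def)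
  with x(1,2,4) that[of x] show ?thesis by simp
qed

subsection \<open>Edge sums of degenerate and star-like graphs\<close>

text \<open>Half of the quadratic form. The product over the two-element set \<open>e\<close> avoids
  choosing an order of its endpoints.\<close>

definition edge_sum :: "nat set set \<Rightarrow> (nat \<Rightarrow> real) \<Rightarrow> real" where
  "edge_sum F x = (\<Sum>e\<in>F. \<Prod>v\<in>e. x v)"

definition deg :: "nat set set \<Rightarrow> nat \<Rightarrow> nat" where
  "deg F v = card {e \<in> F. v \<in> e}"

lemma finite_vertex_pairs: "finite (vertex_pairs n)"
  by (rule finite_subset[of _ "Pow {..<n}"]) (auto simp: vertex_pairs_def)

lemma vertex_pairsE:
  assumes "e \<in> vertex_pairs n"
  obtains u v where "e = {u, v}" "u \<noteq> v" "u < n" "v < n"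
proof -
  from assms have "card e = 2" "e \<subseteq> {..<n}" by (auto simp: vertex_pairs_def)
  then obtain u v where "e = {u, v}" "u \<noteq> v" by (auto simp: card_2_iff)
  with \<open>e \<subseteq> {..<n}\<close> that show ?thesis by auto
qed

lemma pair_in_vertex_pairs_iff: "{u, v} \<in> vertex_pairs n \<longleftrightarrow> u < n \<and> v < n \<and> u \<noteq> v"
  by (auto simp: vertex_pairs_def card_insert_if)

lemma finite_edges: "E \<subseteq> vertex_pairs n \<Longrightarrow> finite E"
  using finite_subset finite_vertex_pairs by blast

lemma quad_form_adj:
  assumes E: "E \<subseteq> vertex_pairs n"
  shows "quad_form n (adj E) x = 2 * edge_sum E x"
proof -
  define P where "P = {q \<in> {..<n} \<times> {..<n}. {fst q, snd q} \<in> E}"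
  have "quad_form n (adj E) x = (\<Sum>q\<in>{..<n} \<times> {..<n}. adj E (fst q) (snd q) * x (fst q) * x (snd q))"
    by (simp add: quad_form_def sum.cartesian_product case_prod_unfold)
  also have "\<dots> = (\<Sum>q\<in>P. x (fst q) * x (snd q))"
    unfolding P_def by (subst sum.inter_filter) (auto intro!: sum.cong simp: adj_def)
  also have "\<dots> = (\<Sum>e\<in>E. \<Sum>q\<in>{q \<in> P. {fst q, snd q} = e}. x (fst q) * x (snd q))"
    by (rule sum.group[symmetric]) (use finite_edges[OF E] in \<open>auto simp: P_def\<close>)
  also have "\<dots> = (\<Sum>e\<in>E. 2 * (\<Prod>v\<in>e. x v))"
  proof (rule sum.cong[OF refl])
    fix e assume e: "e \<in> E"
    with E obtain u v where uv: "e = {u, v}" "u \<noteq> v" "u < n" "v < n"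
      using vertex_pairsE by blast
    hence "{q \<in> P. {fst q, snd q} = e} = {(u, v), (v, u)}"
      using e by (auto simp: P_def doubleton_eq_iff insert_commute)
    thus "(\<Sum>q\<in>{q \<in> P. {fst q, snd q} = e}. x (fst q) * x (snd q)) = 2 * (\<Prod>v\<in>e. x v)"
      using uv by simp
  qed
  finally show ?thesis by (simp add: edge_sum_def sum_distrib_left)
qed

lemma edge_sum_union:
  assumes "finite F" "finite F'" "F \<inter> F' = {}"
  shows "edge_sum (F \<union> F') x = edge_sum F x + edge_sum F' x"
  using assms by (simp add: edge_sum_def sum.union_disjoint)

lemma edge_sum_mono_weights:
  assumes "\<And>e v. e \<in> F \<Longrightarrow> v \<in> e \<Longrightarrow> 0 \<le> x v \<and> x v \<le> y v"
  shows "edge_sum F x \<le> edge_sum F y"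
  unfolding edge_sum_def using assms by (intro sum_mono prod_mono) auto

lemma edge_sum_le_abs: "edge_sum F x \<le> edge_sum F (\<lambda>v. \<bar>x v\<bar>)"
  unfolding edge_sum_def by (intro sum_mono) (simp flip: abs_prod)

lemma edge_sum_cong:
  assumes "\<And>e v. e \<in> F \<Longrightarrow> v \<in> e \<Longrightarrow> x v = y v"
  shows "edge_sum F x = edge_sum F y"
  unfolding edge_sum_def using assms by (intro sum.cong prod.cong) auto

lemma two_edge_sum_le_square:
  assumes F: "F \<subseteq> vertex_pairs n" and x: "\<And>v. v < n \<Longrightarrow> x v \<ge> 0"
  shows "2 * edge_sum F x \<le> (\<Sum>v<n. x v)\<^sup>2"
proof -
  have "2 * edge_sum F x = (\<Sum>i<n. \<Sum>j<n. adj F i j * x i * x j)"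
    using quad_form_adj[OF F, of x] by (simp add: quad_form_def)
  also have "\<dots> \<le> (\<Sum>i<n. \<Sum>j<n. x i * x j)"
    using x by (intro sum_mono) (auto simp: adj_def)
  also have "\<dots> = (\<Sum>v<n. x v)\<^sup>2"
    by (simp add: power2_eq_square sum_product)
  finally show ?thesis .
qed

text \<open>Hilbert-Schmidt bound, by Cauchy-Schwarz over the edges. It makes any \<beta> d^2
  leftover edges harmless: they contribute at most \<open>sqrt \<beta> * d\<close>.\<close>

lemma edge_sum_le_sqrt_card:
  assumes F: "F \<subseteq> vertex_pairs n"
  shows "edge_sum F x \<le> sqrt (card F) * (\<Sum>v<n. (x v)\<^sup>2)"
proof -
  have "(edge_sum F x)\<^sup>2 = (\<Sum>e\<in>F. 1 * (\<Prod>v\<in>e. x v))\<^sup>2"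
    by (simp add: edge_sum_def)
  also have "\<dots> \<le> (\<Sum>e\<in>F. 1\<^sup>2) * (\<Sum>e\<in>F. (\<Prod>v\<in>e. x v)\<^sup>2)"
    by (rule Cauchy_Schwarz_ineq_sum)
  also have "\<dots> = card F * edge_sum F (\<lambda>v. (x v)\<^sup>2)"
    by (simp add: edge_sum_def prod_power_distrib)
  also have "\<dots> \<le> card F * (\<Sum>v<n. (x v)\<^sup>2)\<^sup>2"
  proof (intro mult_left_mono)
    show "edge_sum F (\<lambda>v. (x v)\<^sup>2) \<le> (\<Sum>v<n. (x v)\<^sup>2)\<^sup>2"
      using two_edge_sum_le_square[OF F zero_le_power2, of x]
        zero_le_power2[of "\<Sum>v<n. (x v)\<^sup>2"] by linarith
  qed simp
  also have "\<dots> = (sqrt (card F) * (\<Sum>v<n. (x v)\<^sup>2))\<^sup>2"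
    by (simp add: power_mult_distrib)
  finally show ?thesis
    by (rule power2_le_imp_le) (simp add: sum_nonneg)
qed

lemma deg_eq_card_neighbours:
  assumes E: "E \<subseteq> vertex_pairs n"
  shows "deg E v = card {u \<in> {..<n}. {u, v} \<in> E}"
proof -
  have "bij_betw (\<lambda>u. {u, v}) {u \<in> {..<n}. {u, v} \<in> E} {e \<in> E. v \<in> e}"
  proof (rule bij_betwI')
    fix a b assume "a \<in> {u \<in> {..<n}. {u, v} \<in> E}" "b \<in> {u \<in> {..<n}. {u, v} \<in> E}"
    thus "({a, v} = {b, v}) = (a = b)" by (auto simp: doubleton_eq_iff)
  next
    fix e assume e: "e \<in> {e \<in> E. v \<in> e}"
    with E obtain a b where "e = {a, b}" "a < n" "b < n" using vertex_pairsE by blast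
    with e show "\<exists>u\<in>{u \<in> {..<n}. {u, v} \<in> E}. e = {u, v}" by (auto simp: insert_commute)
  qed auto
  thus ?thesis by (simp add: deg_def bij_betw_same_card)
qed

lemma deg_le_max_degree:
  assumes "E \<subseteq> vertex_pairs n" "v < n"
  shows "deg E v \<le> max_degree n E"
  unfolding deg_eq_card_neighbours[OF assms(1)] max_degree_def
  using assms(2) by (intro Max_ge) auto

lemma deg_mono: "finite E \<Longrightarrow> F \<subseteq> E \<Longrightarrow> deg F v \<le> deg E v"
  unfolding deg_def by (intro card_mono) auto

lemma sum_edges_eq_sum_deg:
  fixes g :: "nat \<Rightarrow> real"
  assumes F: "finite F" and A: "finite A" "\<Union>F \<subseteq> A"
  shows "(\<Sum>e\<in>F. \<Sum>v\<in>e. g v) = (\<Sum>v\<in>A. deg F v * g v)"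
proof -
  have "(\<Sum>e\<in>F. \<Sum>v\<in>e. g v) = (\<Sum>e\<in>F. \<Sum>v\<in>A. if v \<in> e then g v else 0)"
  proof (rule sum.cong[OF refl])
    fix e assume "e \<in> F"
    hence "A \<inter> e = e" using A by blast
    thus "(\<Sum>v\<in>e. g v) = (\<Sum>v\<in>A. if v \<in> e then g v else 0)"
      by (simp add: sum.inter_restrict[OF A(1), symmetric])
  qed
  also have "\<dots> = (\<Sum>v\<in>A. \<Sum>e\<in>F. if v \<in> e then g v else 0)"
    by (rule sum.swap)
  also have "\<dots> = (\<Sum>v\<in>A. deg F v * g v)"
    using F by (simp add: deg_def sum.If_cases Int_def)
  finally show ?thesis .
qed

lemma sum_deg_eq:
  assumes F: "F \<subseteq> vertex_pairs n" and A: "finite A" "\<Union>F \<subseteq> A"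
  shows "(\<Sum>v\<in>A. deg F v) = 2 * card F"
proof -
  have "(\<Sum>v\<in>A. real (deg F v)) = (\<Sum>e\<in>F. \<Sum>v\<in>e. 1)"
    using sum_edges_eq_sum_deg[OF finite_edges[OF F] A, of "\<lambda>_. 1"] by simp
  also have "\<dots> = (\<Sum>e\<in>F. 2)"
    using F by (intro sum.cong) (auto simp: vertex_pairs_def)
  also have "\<dots> = real (2 * card F)" by simp
  finally show ?thesis by (simp only: of_nat_sum[symmetric] of_nat_eq_iff)
qed

lemma Union_edges: "F \<subseteq> vertex_pairs n \<Longrightarrow> \<Union>F \<subseteq> {..<n}"
  by (auto simp: vertex_pairs_def)

text \<open>Repeatedly deleting a vertex of degree at most \<open>K\<close> orients the deleted edges with out-degree
  at most \<open>K\<close>; weighted AM-GM along the orientation gives the bound.\<close>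

lemma peeling:
  fixes a K :: real
  assumes F: "F \<subseteq> vertex_pairs n" and a: "a > 0" and K: "K \<ge> 0"
  obtains F0 where "F0 \<subseteq> F" "K * card (\<Union>F0) \<le> 2 * card F0"
    "\<And>x. edge_sum (F - F0) x \<le>
      a * K / 2 * (\<Sum>v\<in>\<Union>F. (x v)\<^sup>2) + 1 / (2 * a) * (\<Sum>e\<in>F. \<Sum>v\<in>e. (x v)\<^sup>2)"
proof -
  have "\<exists>F0. F0 \<subseteq> F \<and> K * card (\<Union>F0) \<le> 2 * card F0 \<and> (\<forall>x. edge_sum (F - F0) x \<le>
      a * K / 2 * (\<Sum>v\<in>\<Union>F. (x v)\<^sup>2) + 1 / (2 * a) * (\<Sum>e\<in>F. \<Sum>v\<in>e. (x v)\<^sup>2))"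
    using finite_edges[OF F] F
  proof (induction F rule: finite_psubset_induct)
    case (psubset F)
    have fin: "finite (\<Union>F)" using Union_edges[OF psubset.prems] finite_subset by blast
    show ?case
    proof (cases "\<forall>v\<in>\<Union>F. real (deg F v) > K")
      \<comment> \<open>No vertex can be deleted: all of \<open>F\<close> is the core, and the
        handshake identity gives its density.\<close>
      case True
      have "K * card (\<Union>F) = (\<Sum>v\<in>\<Union>F. K)" by simp
      also have "\<dots> \<le> (\<Sum>v\<in>\<Union>F. real (deg F v))"
        using True by (intro sum_mono less_imp_le) blast
      also have "\<dots> = real (2 * card F)"
        by (subst sum_deg_eq[OF psubset.prems fin order.refl, symmetric]) simp
      finally have "K * card (\<Union>F) \<le> 2 * card F" by simp
      moreover have "edge_sum (F - F) x \<le>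
        a * K / 2 * (\<Sum>v\<in>\<Union>F. (x v)\<^sup>2) + 1 / (2 * a) * (\<Sum>e\<in>F. \<Sum>v\<in>e. (x v)\<^sup>2)" for x
        using a K by (auto simp: edge_sum_def intro!: add_nonneg_nonneg mult_nonneg_nonneg divide_nonneg_nonneg sum_nonneg)
      ultimately show ?thesis by blast
    next
      case False
      then obtain v where v: "v \<in> \<Union>F" "real (deg F v) \<le> K" by force
      define D where "D = {e \<in> F. v \<in> e}"
      define F' where "F' = F - D"
      have FF': "F' \<subset> F" "F' \<subseteq> vertex_pairs n" and D: "finite D" "D \<subseteq> F" "card D \<le> K"
        using v psubset.prems psubset.hyps(1) by (auto simp: F'_def D_def deg_def)
      obtain F0 where F0: "F0 \<subseteq> F'" "K * card (\<Union>F0) \<le> 2 * card F0"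
        "\<And>x. edge_sum (F' - F0) x \<le> a * K / 2 * (\<Sum>v\<in>\<Union>F'. (x v)\<^sup>2)
           + 1 / (2 * a) * (\<Sum>e\<in>F'. \<Sum>v\<in>e. (x v)\<^sup>2)"
        using psubset.IH[OF FF'] by blast
      have "edge_sum (F - F0) x \<le>
        a * K / 2 * (\<Sum>v\<in>\<Union>F. (x v)\<^sup>2) + 1 / (2 * a) * (\<Sum>e\<in>F. \<Sum>v\<in>e. (x v)\<^sup>2)" for x
      proof -
        have single: "(\<Prod>u\<in>e. x u) \<le> a / 2 * (x v)\<^sup>2 + 1 / (2 * a) * (\<Sum>u\<in>e. (x u)\<^sup>2)"
          if "e \<in> D" for e
        proof -
          have "e \<in> vertex_pairs n" "v \<in> e"
            using that psubset.prems by (auto simp: D_def)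
          then obtain u where e: "e = {v, u}" "u \<noteq> v"
            by (elim vertex_pairsE) (auto simp: insert_commute)
          \<comment> \<open>AM-GM with weight \<open>a\<close> on the deleted vertex. The spare
            square of \<open>x v\<close> makes the last term symmetric in the edge, so that its
            total is a degree-weighted sum.\<close>
          have "0 \<le> 1 / (2 * a) * ((a * x v - x u)\<^sup>2 + (x v)\<^sup>2)" using a by simp
          thus ?thesis using e a by (simp add: power2_eq_square field_simps)
        qed
        have "edge_sum D x \<le> (\<Sum>e\<in>D. a / 2 * (x v)\<^sup>2 + 1 / (2 * a) * (\<Sum>u\<in>e. (x u)\<^sup>2))"
          unfolding edge_sum_def by (intro sum_mono single)
        also have "\<dots> = card D * (a / 2 * (x v)\<^sup>2) + 1 / (2 * a) * (\<Sum>e\<in>D. \<Sum>u\<in>e. (x u)\<^sup>2)"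
          by (simp add: sum.distrib sum_distrib_left)
        also have "card D * (a / 2 * (x v)\<^sup>2) \<le> K * (a / 2 * (x v)\<^sup>2)"
          using D a by (intro mult_right_mono) auto
        finally have D_sum: "edge_sum D x \<le> a * K / 2 * (x v)\<^sup>2
            + 1 / (2 * a) * (\<Sum>e\<in>D. \<Sum>u\<in>e. (x u)\<^sup>2)"
          by (simp add: mult_ac)
        have "F - F0 = D \<union> (F' - F0)" using F0(1) D(2) by (auto simp: F'_def)
        hence "edge_sum (F - F0) x = edge_sum D x + edge_sum (F' - F0) x"
          using D(1) psubset.hyps(1) by (auto simp: F'_def intro!: edge_sum_union)
        \<comment> \<open>\<open>v\<close> no longer occurs in \<open>F'\<close>, so during the
          whole recursion each vertex is charged the term with \<open>a * K / 2\<close> at most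
          once.\<close>
        moreover have "(x v)\<^sup>2 + (\<Sum>v\<in>\<Union>F'. (x v)\<^sup>2) \<le> (\<Sum>v\<in>\<Union>F. (x v)\<^sup>2)"
        proof -
          have "v \<notin> \<Union>F'" "finite (\<Union>F')"
            using fin by (auto simp: F'_def D_def intro: finite_subset[of _ "\<Union>F"])
          hence "(x v)\<^sup>2 + (\<Sum>v\<in>\<Union>F'. (x v)\<^sup>2) = (\<Sum>v\<in>insert v (\<Union>F'). (x v)\<^sup>2)"
            by simp
          also have "\<dots> \<le> (\<Sum>v\<in>\<Union>F. (x v)\<^sup>2)"
            using v(1) fin by (intro sum_mono2) (auto simp: F'_def)
          finally show ?thesis .
        qed
        hence "a * K / 2 * ((x v)\<^sup>2 + (\<Sum>v\<in>\<Union>F'. (x v)\<^sup>2)) \<le> a * K / 2 * (\<Sum>v\<in>\<Union>F. (x v)\<^sup>2)"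
          using a K by (intro mult_left_mono) auto
        moreover have "(\<Sum>e\<in>F. \<Sum>v\<in>e. (x v)\<^sup>2) =
            (\<Sum>e\<in>D. \<Sum>v\<in>e. (x v)\<^sup>2) + (\<Sum>e\<in>F'. \<Sum>v\<in>e. (x v)\<^sup>2)"
          unfolding F'_def using D(2) psubset.hyps(1) by (simp add: sum.subset_diff)
        ultimately show ?thesis
          using D_sum F0(3)[of x] by (simp add: distrib_left)
      qed
      thus ?thesis using F0 FF'(1) by blast
    qed
  qed
  thus ?thesis using that by blast
qed

text \<open>The choice \<open>a = sqrt (D / K)\<close> balances the two peeling terms, each becoming
  half of \<open>sqrt (K * D)\<close>. The core on which peeling gets stuck has at most
  \<open>m\<close> edges and is handled by the Hilbert-Schmidt bound.\<close>

lemma edge_sum_le_degenerate: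
  fixes K D m :: real
  assumes F: "F \<subseteq> vertex_pairs n" and K: "K > 0" and D: "D > 0"
    and deg: "\<And>v. v < n \<Longrightarrow> real (deg F v) \<le> D"
    and core: "\<And>F0. F0 \<subseteq> F \<Longrightarrow> K * card (\<Union>F0) \<le> 2 * card F0 \<Longrightarrow> real (card F0) \<le> m"
  shows "edge_sum F x \<le> (sqrt (K * D) + sqrt m) * (\<Sum>v<n. (x v)\<^sup>2)"
proof -
  define a where "a = sqrt (D / K)"
  have a: "a > 0" "a * K = sqrt (K * D)" "D / a = sqrt (K * D)"
    using K D by (auto simp: a_def real_sqrt_divide real_sqrt_mult real_div_sqrt field_simps)
  let ?X = "\<Sum>v<n. (x v)\<^sup>2"
  obtain F0 where F0: "F0 \<subseteq> F" "K * card (\<Union>F0) \<le> 2 * card F0"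
    "edge_sum (F - F0) x \<le>
      a * K / 2 * (\<Sum>v\<in>\<Union>F. (x v)\<^sup>2) + 1 / (2 * a) * (\<Sum>e\<in>F. \<Sum>v\<in>e. (x v)\<^sup>2)"
    using peeling[OF F a(1), of K] K by (metis less_imp_le)
  have "edge_sum F x = edge_sum F0 x + edge_sum (F - F0) x"
    using F0(1) finite_edges[OF F] edge_sum_union[of F0 "F - F0" x]
    by (simp add: finite_subset Un_absorb1)
  moreover have "edge_sum F0 x \<le> sqrt m * ?X"
  proof -
    have "edge_sum F0 x \<le> sqrt (card F0) * ?X"
      using F0(1) F by (intro edge_sum_le_sqrt_card) auto
    also have "\<dots> \<le> sqrt m * ?X"
      using core[OF F0(1,2)] by (intro mult_right_mono) (auto simp: sum_nonneg)
    finally show ?thesis .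
  qed
  moreover have "edge_sum (F - F0) x \<le> a * K / 2 * ?X + 1 / (2 * a) * (D * ?X)"
  proof -
    have "(\<Sum>v\<in>\<Union>F. (x v)\<^sup>2) \<le> ?X"
      using Union_edges[OF F] by (intro sum_mono2) auto
    moreover have "(\<Sum>e\<in>F. \<Sum>v\<in>e. (x v)\<^sup>2) = (\<Sum>v<n. deg F v * (x v)\<^sup>2)"
      by (rule sum_edges_eq_sum_deg) (use Union_edges[OF F] finite_edges[OF F] in auto)
    hence "(\<Sum>e\<in>F. \<Sum>v\<in>e. (x v)\<^sup>2) \<le> D * ?X"
      unfolding sum_distrib_left using deg by (auto intro!: sum_mono mult_right_mono)
    ultimately show ?thesis
      using F0(3) a(1) K by (elim order.trans) (intro add_mono mult_left_mono; simp)
  qed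
  moreover have "a * K / 2 * ?X + 1 / (2 * a) * (D * ?X) = sqrt (K * D) * ?X"
  proof -
    have "1 / (2 * a) * (D * ?X) = D / a / 2 * ?X" by simp
    thus ?thesis unfolding a by simp
  qed
  ultimately show ?thesis by (simp add: distrib_right)
qed

text \<open>A neighbour of \<open>H\<close> outside \<open>H\<close> and \<open>T\<close> sees
  exactly one vertex of \<open>H\<close>, so these edges form vertex-disjoint stars. A star with at
  most \<Delta> leaves has norm at most \<open>sqrt \<Delta>\<close>, and disjointness keeps the
  bound proportional to the mass on \<open>S\<close>. The other edges at \<open>H\<close> end in
  \<open>H\<close> or \<open>T\<close> and are few.\<close>

lemma edge_sum_le_stars:
  assumes G: "G \<subseteq> vertex_pairs n" and H: "H \<subseteq> {..<n}" and \<Delta>: "\<Delta> > 0"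
    and deg: "\<And>v. v \<in> H \<Longrightarrow> real (deg G v) \<le> \<Delta>"
    and S: "S \<subseteq> {..<n}" "H \<subseteq> S" "\<And>u v. v \<in> H \<Longrightarrow> {u, v} \<in> G \<Longrightarrow> u \<in> S"
    and T_def: "T = {u \<in> {..<n} - H. 2 \<le> card {v \<in> H. {u, v} \<in> G}}"
  shows "edge_sum {e \<in> G. e \<inter> H \<noteq> {}} x \<le> sqrt \<Delta> / 2 * (\<Sum>v\<in>S. (x v)\<^sup>2)
    + sqrt (card H * (card H + card T)) * (\<Sum>v<n. (x v)\<^sup>2)"
proof -
  \<comment> \<open>The private leaves of \<open>v\<close>, seen by no other vertex of
    \<open>H\<close>.\<close>
  define N where "N v = {u \<in> {..<n} - H - T. {u, v} \<in> G}" for v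
  define good where "good = (\<lambda>(v, u). {u, v}) ` Sigma H N"
  define F where "F = {e \<in> G. e \<inter> H \<noteq> {}}"
  have fin: "finite H" "finite S" "finite T" "finite G" "\<And>v. finite (N v)"
    using H S finite_edges[OF G] by (auto simp: T_def N_def intro: finite_subset)
  have good: "good \<subseteq> F" by (auto simp: good_def F_def N_def)
  have inj: "inj_on (\<lambda>(v, u). {u, v}) (Sigma H N)"
    by (auto simp: inj_on_def N_def doubleton_eq_iff)
  have disj: "N v \<inter> N w = {}" if "v \<in> H" "w \<in> H" "v \<noteq> w" for v w
  proof (rule ccontr)
    assume "N v \<inter> N w \<noteq> {}"
    then obtain u where u: "u \<in> N v" "u \<in> N w" by blast
    have "card {v, w} \<le> card {v \<in> H. {u, v} \<in> G}"
      using u that fin by (intro card_mono) (auto simp: N_def)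
    hence "u \<in> T" using u that by (auto simp: T_def N_def)
    thus False using u by (auto simp: N_def)
  qed
  have "edge_sum good x = (\<Sum>(v, u)\<in>Sigma H N. x v * x u)"
    unfolding good_def edge_sum_def
  proof (subst sum.reindex[OF inj], intro sum.cong refl)
    fix q assume "q \<in> Sigma H N"
    hence "fst q \<noteq> snd q" by (auto simp: N_def)
    thus "((\<lambda>e. \<Prod>v\<in>e. x v) \<circ> (\<lambda>(v, u). {u, v})) q = (case q of (v, u) \<Rightarrow> x v * x u)"
      by (cases q) (simp add: insert_commute[of "snd q"])
  qed
  also have "\<dots> = (\<Sum>v\<in>H. \<Sum>u\<in>N v. x v * x u)"
    using fin by (simp add: sum.Sigma)
  also have "\<dots> \<le> (\<Sum>v\<in>H. sqrt \<Delta> / 2 * ((x v)\<^sup>2 + (\<Sum>u\<in>N v. (x u)\<^sup>2)))"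
  proof (rule sum_mono)
    fix v assume v: "v \<in> H"
    have "card (N v) \<le> deg G v"
      unfolding deg_eq_card_neighbours[OF G] by (intro card_mono) (auto simp: N_def)
    hence card: "card (N v) \<le> \<Delta>" using deg[OF v] by linarith
    have s: "sqrt \<Delta> > 0" "sqrt \<Delta> * sqrt \<Delta> = \<Delta>" using \<Delta> by auto
    have "x v * x u \<le> (x v)\<^sup>2 / (2 * sqrt \<Delta>) + sqrt \<Delta> / 2 * (x u)\<^sup>2" for u
    proof -
      \<comment> \<open>The weights balance a star: the centre receives at most \<Delta> shares 1 /
        (2 sqrt \<Delta>), each leaf a single share sqrt \<Delta> / 2.\<close>
      have "0 \<le> (x v - sqrt \<Delta> * x u)\<^sup>2 / (2 * sqrt \<Delta>)" using s by simp
      also have "\<dots> = (x v)\<^sup>2 / (2 * sqrt \<Delta>) + sqrt \<Delta> / 2 * (x u)\<^sup>2 - x v * x u"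
        using s by (simp add: power2_eq_square field_simps)
      finally show ?thesis by simp
    qed
    hence "(\<Sum>u\<in>N v. x v * x u) \<le> (\<Sum>u\<in>N v. (x v)\<^sup>2 / (2 * sqrt \<Delta>) + sqrt \<Delta> / 2 * (x u)\<^sup>2)"
      by (intro sum_mono)
    also have "\<dots> = card (N v) * ((x v)\<^sup>2 / (2 * sqrt \<Delta>)) + sqrt \<Delta> / 2 * (\<Sum>u\<in>N v. (x u)\<^sup>2)"
      by (simp add: sum.distrib sum_distrib_left)
    also have "card (N v) * ((x v)\<^sup>2 / (2 * sqrt \<Delta>)) \<le> \<Delta> * ((x v)\<^sup>2 / (2 * sqrt \<Delta>))"
      using card s by (intro mult_right_mono) auto
    also have "\<Delta> * ((x v)\<^sup>2 / (2 * sqrt \<Delta>)) = sqrt \<Delta> / 2 * (x v)\<^sup>2"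
      using s by (simp add: field_simps)
    finally show "(\<Sum>u\<in>N v. x v * x u) \<le> sqrt \<Delta> / 2 * ((x v)\<^sup>2 + (\<Sum>u\<in>N v. (x u)\<^sup>2))"
      by (simp add: distrib_left)
  qed
  also have "\<dots> = sqrt \<Delta> / 2 * ((\<Sum>v\<in>H. (x v)\<^sup>2) + (\<Sum>v\<in>H. \<Sum>u\<in>N v. (x u)\<^sup>2))"
    by (simp add: sum_distrib_left sum.distrib distrib_left)
  also have "(\<Sum>v\<in>H. \<Sum>u\<in>N v. (x u)\<^sup>2) = (\<Sum>u\<in>(\<Union>v\<in>H. N v). (x u)\<^sup>2)"
    by (rule sum.UNION_disjoint[symmetric]) (use fin disj in auto)
  also have "(\<Sum>v\<in>H. (x v)\<^sup>2) + (\<Sum>u\<in>(\<Union>v\<in>H. N v). (x u)\<^sup>2) =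
      (\<Sum>u\<in>H \<union> (\<Union>v\<in>H. N v). (x u)\<^sup>2)"
    by (rule sum.union_disjoint[symmetric]) (use fin in \<open>auto simp: N_def\<close>)
  also have "\<dots> \<le> (\<Sum>v\<in>S. (x v)\<^sup>2)"
    using S fin by (intro sum_mono2) (auto simp: N_def)
  finally have "edge_sum good x \<le> sqrt \<Delta> / 2 * (\<Sum>v\<in>S. (x v)\<^sup>2)"
    using \<Delta> by (simp add: mult_left_mono)
  moreover have "edge_sum (F - good) x \<le> sqrt (card H * (card H + card T)) * (\<Sum>v<n. (x v)\<^sup>2)"
  proof -
    have "F - good \<subseteq> (\<lambda>(v, u). {u, v}) ` (H \<times> (H \<union> T))"
    proof
      fix e assume e: "e \<in> F - good"
      then obtain v where v: "v \<in> e" "v \<in> H" "e \<in> G" by (auto simp: F_def)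
      obtain u where u: "e = {u, v}" "u < n"
      proof -
        have "e \<in> vertex_pairs n" using G v by blast
        thus ?thesis using that v(1) by (elim vertex_pairsE) (auto simp: insert_commute)
      qed
      have "u \<in> H \<union> T"
      proof (rule ccontr)
        assume "u \<notin> H \<union> T"
        hence "u \<in> N v" using u v by (auto simp: N_def)
        hence "e \<in> good" using u v by (auto simp: good_def)
        with e show False by simp
      qed
      thus "e \<in> (\<lambda>(v, u). {u, v}) ` (H \<times> (H \<union> T))" using u v by auto
    qed
    hence "card (F - good) \<le> card ((\<lambda>(v, u). {u, v}) ` (H \<times> (H \<union> T)))"
      using fin by (intro card_mono) auto
    also have "\<dots> \<le> card (H \<times> (H \<union> T))" using fin by (intro card_image_le) auto
    also have "\<dots> \<le> card H * (card H + card T)"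
      by (simp add: card_cartesian_product card_Un_le)
    finally have card: "card (F - good) \<le> card H * (card H + card T)" .
    have "edge_sum (F - good) x \<le> sqrt (card (F - good)) * (\<Sum>v<n. (x v)\<^sup>2)"
      by (intro edge_sum_le_sqrt_card) (use G in \<open>auto simp: F_def\<close>)
    also have "\<dots> \<le> sqrt (card H * (card H + card T)) * (\<Sum>v<n. (x v)\<^sup>2)"
      using card by (intro mult_right_mono real_sqrt_le_mono of_nat_mono) (auto simp: sum_nonneg)
    finally show ?thesis .
  qed
  moreover have "edge_sum F x = edge_sum good x + edge_sum (F - good) x"
    using good fin edge_sum_union[of good "F - good" x]
    by (auto simp: Un_absorb1 F_def intro: finite_subset)
  ultimately show ?thesis by (simp add: F_def)
qed

subsection \<open>Union bounds in the random graph\<close>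

lemma power_div_fact_le_exp:
  fixes x :: real
  assumes "x \<ge> 0"
  shows "x ^ k / fact k \<le> exp x"
proof -
  have "x ^ k /\<^sub>R fact k = (\<Sum>i\<in>{k}. x ^ i /\<^sub>R fact i)" by simp
  also have "\<dots> \<le> (\<Sum>i. x ^ i /\<^sub>R fact i)"
    by (rule sum_le_suminf[OF summable_exp_generic]) (use assms in auto)
  also have "\<dots> = exp x" by (simp add: exp_def)
  finally show ?thesis by (simp add: divide_inverse mult.commute)
qed

lemma binomial_le_exp_pow:
  assumes "k \<ge> 1"
  shows "real (n choose k) \<le> (exp 1 * n / k) ^ k"
proof -
  have k: "real k > 0" using assms by simp
  have "real ((n choose k) * fact k) \<le> real (n ^ k)"
    by (rule of_nat_mono[OF binomial_fact_pow])
  hence 1: "real (n choose k) * fact k \<le> real n ^ k" by simp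
  have "real k ^ k / fact k \<le> exp 1 ^ k"
    using power_div_fact_le_exp[of k k] by (simp flip: exp_of_nat_mult)
  hence 2: "real k ^ k \<le> exp 1 ^ k * fact k" by (simp add: field_simps)
  have "real (n choose k) * real k ^ k \<le> real (n choose k) * (exp 1 ^ k * fact k)"
    using 2 by (intro mult_left_mono) auto
  also have "\<dots> \<le> exp 1 ^ k * real n ^ k"
    using mult_left_mono[OF 1, of "exp 1 ^ k"] by (simp add: mult_ac)
  finally show ?thesis using k by (simp add: power_mult_distrib power_divide field_simps)
qed

lemma set_gnp: "G \<in> set_pmf (gnp n p) \<Longrightarrow> G \<subseteq> vertex_pairs n"
  by (auto simp: gnp_def)

text \<open>Only graphs in the support count, so implications between events may assume that all
  edges are vertex pairs.\<close>

lemma gnp_prob_mono: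
  assumes "\<And>G. G \<subseteq> vertex_pairs n \<Longrightarrow> P G \<Longrightarrow> Q G"
  shows "measure_pmf.prob (gnp n p) {G. P G} \<le> measure_pmf.prob (gnp n p) {G. Q G}"
  by (rule measure_pmf.finite_measure_mono_AE)
    (use assms set_gnp in \<open>auto simp: AE_measure_pmf_iff\<close>)

lemma gnp_prob_superset_le:
  assumes p: "0 \<le> p" "p \<le> 1"
  shows "measure_pmf.prob (gnp n p) {G. F \<subseteq> G} \<le> p ^ card F"
proof (cases "F \<subseteq> vertex_pairs n")
  case True
  have "measure_pmf.prob (gnp n p) {G. F \<subseteq> G} =
      measure_pmf.prob (Pi_pmf (vertex_pairs n) False (\<lambda>_. bernoulli_pmf p))
        (Pi (vertex_pairs n) (\<lambda>e. if e \<in> F then {True} else UNIV))"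
    unfolding gnp_def using True by (auto intro!: arg_cong2[of _ _ _ _ measure_pmf.prob] split: if_splits)
  also have "\<dots> = (\<Prod>e\<in>vertex_pairs n. measure_pmf.prob (bernoulli_pmf p)
        (if e \<in> F then {True} else UNIV))"
    by (rule measure_Pi_pmf_Pi[OF finite_vertex_pairs])
  also have "\<dots> = (\<Prod>e\<in>vertex_pairs n. if e \<in> F then p else 1)"
    using p by (intro prod.cong) (auto simp: measure_pmf_single)
  also have "\<dots> = p ^ card F"
    using True by (simp add: prod.If_cases finite_vertex_pairs Int_absorb1)
  finally show ?thesis by simp
next
  case False
  have "measure_pmf.prob (gnp n p) {G. F \<subseteq> G} \<le> measure_pmf.prob (gnp n p) {G. False}"
    by (rule gnp_prob_mono) (use False in auto)
  also have "\<dots> \<le> p ^ card F" using p by simp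
  finally show ?thesis .
qed

text \<open>The common first-moment estimate: having \<open>m\<close> edges in \<open>P\<close>
  means containing one of the \<open>m\<close>-subsets of \<open>P\<close>, each with probability at
  most \<open>p ^ m\<close>; then a union bound over the family of possible sets
  \<open>P\<close>.\<close>

lemma gnp_union_bound:
  assumes p: "0 \<le> p" "p \<le> 1" and fin: "finite \<P>"
    and card: "\<And>P. P \<in> \<P> \<Longrightarrow> finite P \<and> real (card P) \<le> \<mu>" and m: "m \<ge> 1"
  shows "measure_pmf.prob (gnp n p) {G. \<exists>P\<in>\<P>. m \<le> card (G \<inter> P)}
    \<le> card \<P> * (exp 1 * \<mu> * p / m) ^ m"
proof -
  let ?prob = "measure_pmf.prob (gnp n p)"
  let ?sub = "\<lambda>P. {F. F \<subseteq> P \<and> card F = m}"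
  have one: "?prob (\<Union>F\<in>?sub P. {G. F \<subseteq> G}) \<le> (exp 1 * \<mu> * p / m) ^ m" if P: "P \<in> \<P>" for P
  proof -
    have "?prob (\<Union>F\<in>?sub P. {G. F \<subseteq> G}) \<le> (\<Sum>F\<in>?sub P. ?prob {G. F \<subseteq> G})"
      using card[OF P] by (intro measure_UNION_le) auto
    also have "\<dots> \<le> (\<Sum>F\<in>?sub P. p ^ m)"
      using gnp_prob_superset_le[OF p] by (intro sum_mono) auto
    also have "\<dots> = real (card P choose m) * p ^ m"
      using card[OF P] n_subsets[of P m] by simp
    also have "\<dots> \<le> (exp 1 * card P / m) ^ m * p ^ m"
      using p by (intro mult_right_mono binomial_le_exp_pow m) auto
    also have "\<dots> = (exp 1 * card P * p / m) ^ m"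
      by (simp add: power_mult_distrib power_divide)
    also have "\<dots> \<le> (exp 1 * \<mu> * p / m) ^ m"
      using card[OF P] p by (intro power_mono divide_right_mono mult_right_mono mult_left_mono) auto
    finally show ?thesis .
  qed
  have "?prob {G. \<exists>P\<in>\<P>. m \<le> card (G \<inter> P)} \<le> ?prob (\<Union>P\<in>\<P>. \<Union>F\<in>?sub P. {G. F \<subseteq> G})"
  proof (rule measure_pmf.finite_measure_mono)
    show "{G. \<exists>P\<in>\<P>. m \<le> card (G \<inter> P)} \<subseteq> (\<Union>P\<in>\<P>. \<Union>F\<in>?sub P. {G. F \<subseteq> G})"
    proof clarsimp
      fix G P assume P: "P \<in> \<P>" and m: "m \<le> card (G \<inter> P)"
      obtain F where "F \<subseteq> G \<inter> P" "card F = m"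
        using obtain_subset_with_card_n[OF m] by blast
      thus "\<exists>P\<in>\<P>. \<exists>F. F \<subseteq> P \<and> card F = m \<and> F \<subseteq> G" using P by blast
    qed
  qed simp
  also have "\<dots> \<le> (\<Sum>P\<in>\<P>. ?prob (\<Union>F\<in>?sub P. {G. F \<subseteq> G}))"
    using fin by (intro measure_UNION_le) auto
  also have "\<dots> \<le> (\<Sum>P\<in>\<P>. (exp 1 * \<mu> * p / m) ^ m)"
    by (intro sum_mono one)
  finally show ?thesis by simp
qed

text \<open>Potential edges between \<open>A\<close> and \<open>U\<close>. If the sets overlap,
  singletons occur as well; this is harmless, since only upper bounds on the size are used.\<close>

definition pairs :: "nat set \<Rightarrow> nat set \<Rightarrow> nat set set" where
  "pairs A U = (\<lambda>(u, v). {u, v}) ` (A \<times> U)"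

lemma finite_pairs: "finite A \<Longrightarrow> finite U \<Longrightarrow> finite (pairs A U)"
  by (simp add: pairs_def)

lemma card_pairs_le: "finite A \<Longrightarrow> finite U \<Longrightarrow> card (pairs A U) \<le> card A * card U"
  unfolding pairs_def by (metis card_cartesian_product card_image_le finite_cartesian_product)

definition high_degree :: "nat \<Rightarrow> real \<Rightarrow> nat set set \<Rightarrow> nat set" where
  "high_degree n a G = {v. v < n \<and> a \<le> real (deg G v)}"

text \<open>The vertices that prevent the stars centred in \<open>H\<close> from being
  disjoint.\<close>

definition shared_neighbours :: "nat \<Rightarrow> nat set \<Rightarrow> nat set set \<Rightarrow> nat set" where
  "shared_neighbours n H G = {u \<in> {..<n} - H. 2 \<le> card {v \<in> H. {u, v} \<in> G}}"

text \<open>Among \<open>r\<close> vertices of degree at least \<open>D\<close> the degree sum is at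
  least \<open>r D\<close>, and an edge is counted at most twice; hence at least
  \<open>r D / 2\<close> edges fall into the at most \<open>r n\<close> pairs touching these
  vertices.\<close>

lemma gnp_prob_many_high_degrees:
  fixes D p :: real
  assumes p: "0 \<le> p" "p \<le> 1" and r: "r \<ge> 1" and D: "D > 0" and D2: "2 * exp 1 * (n * p) \<le> D"
  shows "measure_pmf.prob (gnp n p) {G. r \<le> card (high_degree n D G)}
    \<le> (exp 1 * n / r) ^ r * (2 * exp 1 * (n * p) / D) powr (r * D / 2)"
proof -
  let ?prob = "measure_pmf.prob (gnp n p)"
  define m where "m = nat \<lceil>r * D / 2\<rceil>"
  have "r * D / 2 > 0" using r D by simp
  hence m: "m \<ge> 1" "m \<ge> r * D / 2" unfolding m_def by linarith+
  define \<P> where "\<P> = (\<lambda>A. pairs A {..<n}) ` {A. A \<subseteq> {..<n} \<and> card A = r}"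
  have fin: "finite \<P>" unfolding \<P>_def by (intro finite_imageI) auto
  have "card \<P> \<le> card {A. A \<subseteq> {..<n} \<and> card A = r}"
    unfolding \<P>_def by (intro card_image_le) auto
  also have "\<dots> = n choose r" using n_subsets[of "{..<n}" r] by simp
  finally have card_P: "real (card \<P>) \<le> (exp 1 * n / r) ^ r"
    using binomial_le_exp_pow[OF r, of n] by linarith
  have P: "finite P \<and> real (card P) \<le> real r * real n" if "P \<in> \<P>" for P
  proof -
    from that obtain A where A: "P = pairs A {..<n}" "A \<subseteq> {..<n}" "card A = r"
      by (auto simp: \<P>_def)
    have "finite A" using A(2) finite_subset by blast
    thus ?thesis using card_pairs_le[of A "{..<n}"] A finite_pairs
      by (auto simp flip: of_nat_mult)
  qed
  have "?prob {G. r \<le> card {v. v < n \<and> D \<le> deg G v}} \<le> ?prob {G. \<exists>P\<in>\<P>. m \<le> card (G \<inter> P)}"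
  proof (rule gnp_prob_mono)
    fix G assume G: "G \<subseteq> vertex_pairs n" and r: "r \<le> card {v. v < n \<and> D \<le> deg G v}"
    obtain A where A: "A \<subseteq> {v. v < n \<and> D \<le> deg G v}" "card A = r"
      by (rule obtain_subset_with_card_n[OF r])
    let ?F = "G \<inter> pairs A {..<n}"
    have F: "?F \<subseteq> vertex_pairs n" using G by blast
    have deg: "deg ?F v = deg G v" if "v \<in> A" for v
    proof -
      have "{e \<in> ?F. v \<in> e} = {e \<in> G. v \<in> e}"
      proof safe
        fix e assume e: "e \<in> G" "v \<in> e"
        then obtain a b where "e = {a, b}" "a < n" "b < n" using G vertex_pairsE by blast
        moreover have "v = a \<or> v = b" using calculation e by auto
        ultimately show "e \<in> pairs A {..<n}" using that
          by (auto simp: pairs_def insert_commute)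
      qed
      thus ?thesis by (simp add: deg_def)
    qed
    have "r * D = (\<Sum>v\<in>A. D)" using A by simp
    also have "\<dots> \<le> (\<Sum>v\<in>A. real (deg ?F v))"
      using A deg by (intro sum_mono) auto
    also have "\<dots> \<le> (\<Sum>v<n. real (deg ?F v))"
      using A by (intro sum_mono2) auto
    also have "\<dots> = real (\<Sum>v<n. deg ?F v)" by simp
    also have "\<dots> = 2 * real (card ?F)"
      using sum_deg_eq[OF F(1), of "{..<n}"] Union_edges[OF F(1)] by simp
    finally have "m \<le> card ?F" unfolding m_def by linarith
    thus "\<exists>P\<in>\<P>. m \<le> card (G \<inter> P)" using A by (auto simp: \<P>_def)
  qed
  also have "\<dots> \<le> card \<P> * (exp 1 * (real r * real n) * p / m) ^ m"
    by (rule gnp_union_bound[OF p fin P m(1)])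
  also have "\<dots> \<le> (exp 1 * n / r) ^ r * (2 * exp 1 * (n * p) / D) powr (r * D / 2)"
  proof (rule mult_mono[OF card_P])
    let ?q = "2 * exp 1 * (n * p) / D"
    have q: "0 \<le> ?q" "?q \<le> 1" using p D D2 by auto
    have "exp 1 * (real r * real n) * p / m \<le> exp 1 * (real r * real n) * p / (r * D / 2)"
      using m r D p by (intro divide_left_mono) auto
    also have "\<dots> = ?q" using r by (simp add: field_simps)
    finally have "(exp 1 * (real r * real n) * p / m) ^ m \<le> ?q ^ m"
      using p by (intro power_mono) auto
    \<comment> \<open>Rounding only increased the exponent, which helps since the base is at most 1.
      Base 0 is separate because \<open>powr_realpow\<close> wants a positive base.\<close>
    also have "?q ^ m \<le> ?q powr (r * D / 2)"
    proof (cases "?q = 0")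
      case True
      thus ?thesis using m(1) unfolding True by (simp add: power_0_left)
    next
      case False
      hence "?q > 0" using q(1) by (metis less_le)
      hence "?q ^ m = ?q powr m" by (rule powr_realpow[symmetric])
      also have "\<dots> \<le> ?q powr (r * D / 2)" using q m False by (intro powr_mono') auto
      finally show ?thesis .
    qed
    finally show "(exp 1 * (real r * real n) * p / m) ^ m \<le> ?q powr (r * D / 2)" .
  qed (use p in auto)
  finally show ?thesis unfolding high_degree_def .
qed

text \<open>Each shared neighbour brings two edges to \<open>H\<close> but only one vertex to be
  chosen, so its net factor is of order \<open>n p^2 = d^2 / n\<close>.\<close>

lemma gnp_prob_many_common_neighbours:
  fixes p :: real
  assumes p: "0 \<le> p" "p \<le> 1" and n: "n \<ge> 1" and t: "t \<ge> 1"
  shows "measure_pmf.prob (gnp n p) {G. \<exists>H\<subseteq>{..<n}. card H \<le> h \<and>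
      t \<le> card (shared_neighbours n H G)}
    \<le> (h + 1) * real n ^ (h + t) * (2 * h * p) ^ (2 * t)"
proof -
  let ?prob = "measure_pmf.prob (gnp n p)"
  define \<H> where "\<H> = {H. H \<subseteq> {..<n} \<and> card H \<le> h}"
  define \<T> where "\<T> = {T. T \<subseteq> {..<n} \<and> card T = t}"
  define \<P> where "\<P> = (\<lambda>(H, T). pairs H T) ` (\<H> \<times> \<T>)"
  have fin': "finite \<H>" "finite \<T>" by (auto simp: \<H>_def \<T>_def)
  hence fin: "finite \<P>" by (auto simp: \<P>_def)
  have "\<H> \<subseteq> (\<Union>j\<in>{..h}. {H. H \<subseteq> {..<n} \<and> card H = j})" by (auto simp: \<H>_def)
  hence "card \<H> \<le> card (\<Union>j\<in>{..h}. {H. H \<subseteq> {..<n} \<and> card H = j})"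
    by (intro card_mono) auto
  also have "\<dots> \<le> (\<Sum>j\<in>{..h}. card {H. H \<subseteq> {..<n} \<and> card H = j})"
    by (intro card_UN_le) auto
  also have "\<dots> \<le> (\<Sum>j\<in>{..h}. n ^ h)"
  proof (rule sum_mono)
    fix j assume "j \<in> {..h}"
    have "card {H. H \<subseteq> {..<n} \<and> card H = j} = n choose j"
      using n_subsets[of "{..<n}" j] by simp
    also have "\<dots> \<le> n ^ j" by (cases "j \<le> n") (auto simp: binomial_le_pow binomial_eq_0)
    also have "\<dots> \<le> n ^ h" using n \<open>j \<in> {..h}\<close> by (intro power_increasing) auto
    finally show "card {H. H \<subseteq> {..<n} \<and> card H = j} \<le> n ^ h" .
  qed
  finally have card_H: "card \<H> \<le> (h + 1) * n ^ h" by simp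
  have "card \<T> = n choose t" unfolding \<T>_def using n_subsets[of "{..<n}" t] by simp
  also have "\<dots> \<le> n ^ t" by (cases "t \<le> n") (auto simp: binomial_le_pow binomial_eq_0)
  finally have card_T: "card \<T> \<le> n ^ t" .
  have "card \<P> \<le> card (\<H> \<times> \<T>)" unfolding \<P>_def using fin' by (intro card_image_le) auto
  also have "\<dots> \<le> ((h + 1) * n ^ h) * n ^ t"
    unfolding card_cartesian_product by (intro mult_mono card_H card_T) auto
  finally have "real (card \<P>) \<le> real (((h + 1) * n ^ h) * n ^ t)" by (rule of_nat_mono)
  hence card_P: "real (card \<P>) \<le> (h + 1) * real n ^ (h + t)"
    by (simp add: power_add algebra_simps)
  have P: "finite P \<and> real (card P) \<le> real h * real t" if "P \<in> \<P>" for P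
  proof -
    from that obtain H T where *: "P = pairs H T" "H \<subseteq> {..<n}" "card H \<le> h" "T \<subseteq> {..<n}" "card T = t"
      by (auto simp: \<P>_def \<H>_def \<T>_def)
    have f: "finite H" "finite T" using * finite_subset by blast+
    have "card P \<le> card H * card T" using card_pairs_le[OF f] * by simp
    also have "\<dots> \<le> h * t" using * by (intro mult_mono) auto
    finally have "real (card P) \<le> real (h * t)" by (rule of_nat_mono)
    thus ?thesis using finite_pairs[OF f] * by simp
  qed
  have "?prob {G. \<exists>H\<subseteq>{..<n}. card H \<le> h \<and>
      t \<le> card {u \<in> {..<n} - H. 2 \<le> card {v \<in> H. {u, v} \<in> G}}} \<le>
      ?prob {G. \<exists>P\<in>\<P>. 2 * t \<le> card (G \<inter> P)}"
  proof (rule gnp_prob_mono)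
    fix G assume G: "G \<subseteq> vertex_pairs n"
    assume "\<exists>H\<subseteq>{..<n}. card H \<le> h \<and> t \<le> card {u \<in> {..<n} - H. 2 \<le> card {v \<in> H. {u, v} \<in> G}}"
    then obtain H where H: "H \<subseteq> {..<n}" "card H \<le> h"
      "t \<le> card {u \<in> {..<n} - H. 2 \<le> card {v \<in> H. {u, v} \<in> G}}" by blast
    obtain T where T: "T \<subseteq> {u \<in> {..<n} - H. 2 \<le> card {v \<in> H. {u, v} \<in> G}}" "card T = t"
      by (rule obtain_subset_with_card_n[OF H(3)])
    have f: "finite H" "finite T" using H T(1) by (auto intro: finite_subset)
    let ?N = "\<lambda>u. {v \<in> H. {u, v} \<in> G}"
    \<comment> \<open>\<open>T\<close> and \<open>H\<close> are disjoint, so an edge determines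
      which end lies in \<open>T\<close>; the 2 t incidences are therefore distinct edges.\<close>
    have inj: "inj_on (\<lambda>(u, v). {u, v}) (Sigma T ?N)"
      using T(1) by (auto simp: inj_on_def doubleton_eq_iff)
    have "2 * t = (\<Sum>u\<in>T. 2)" using T by simp
    also have "\<dots> \<le> (\<Sum>u\<in>T. card (?N u))" using T(1) by (intro sum_mono) auto
    also have "\<dots> = card (Sigma T ?N)" using f by (subst card_SigmaI) auto
    also have "\<dots> = card ((\<lambda>(u, v). {u, v}) ` Sigma T ?N)"
      by (rule card_image[OF inj, symmetric])
    also have "\<dots> \<le> card (G \<inter> pairs H T)"
      using finite_pairs[OF f] by (intro card_mono) (auto simp: pairs_def insert_commute)
    finally have "2 * t \<le> card (G \<inter> pairs H T)" .
    moreover have "pairs H T \<in> \<P>" using H T(1,2) by (auto simp: \<P>_def \<H>_def \<T>_def)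
    ultimately show "\<exists>P\<in>\<P>. 2 * t \<le> card (G \<inter> P)" by blast
  qed
  also have "\<dots> \<le> card \<P> * (exp 1 * (real h * real t) * p / real (2 * t)) ^ (2 * t)"
    by (rule gnp_union_bound[OF p fin P]) (use t in auto)
  also have "\<dots> \<le> (h + 1) * real n ^ (h + t) * (2 * h * p) ^ (2 * t)"
  proof (rule mult_mono[OF card_P])
    have "exp 1 * (real h * real t) * p / real (2 * t) = exp 1 / 2 * (h * p)"
      using t by (simp add: field_simps)
    also have "\<dots> \<le> 2 * (h * p)"
      using exp_le p by (intro mult_right_mono) auto
    finally show "(exp 1 * (real h * real t) * p / real (2 * t)) ^ (2 * t) \<le> (2 * h * p) ^ (2 * t)"
      using p by (intro power_mono) auto
  qed (use p in auto)
  finally show ?thesis unfolding shared_neighbours_def by (simp add: add.commute)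
qed

text \<open>With \<open>q = sqrt (s / n)\<close> and \<open>l = 1 - ln q\<close>, choosing a vertex
  costs at most a factor \<open>exp (2 l)\<close> and each edge gains \<open>exp (- l)\<close>. As
  \<open>K \<ge> 16\<close> forces \<open>m \<ge> 8 s\<close>, the entropy uses at most a quarter of
  the gain.\<close>

lemma small_dense_set_bound:
  fixes s m :: nat and n p \<sigma> K b :: real
  assumes n: "n \<ge> 1" and p: "p \<ge> 0" and \<sigma>: "\<sigma> \<ge> 0"
    and K: "K \<ge> 16" "15 * (n * p) * sqrt \<sigma> \<le> K"
    and s: "s \<ge> 1" "s \<le> n" and m: "K * s \<le> 2 * m" "b \<le> m"
  shows "(2 * exp 1 * n / s) ^ s * (exp 1 * (min s (\<sigma> * n) * s) * p / m) ^ m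
    \<le> n powr (- b / 8) + exp (- 4 * sqrt n)"
proof -
  define q where "q = sqrt (s / n)"
  have q: "0 < q" "q \<le> 1" "q\<^sup>2 = s / n" using n s by (auto simp: q_def)
  define l where "l = 1 - ln q"
  have l: "l \<ge> 1" using q by (simp add: l_def)
  have "real m \<ge> 8 * s" using K(1) m(1) s mult_right_mono[OF K(1), of "real s"] by linarith
  hence ms: "real m \<ge> 8 * s" "real m > 0" using s by auto
  have base: "exp 1 * (min s (\<sigma> * n) * s) * p / m \<le> exp (- l)"
  proof -
    \<comment> \<open>The geometric mean replaces the minimum: it produces the factor
      \<open>q\<close> in the density, and this factor is what the entropy is compared with.\<close>
    have "min s (\<sigma> * n) \<le> sqrt (s * (\<sigma> * n))"
    proof (rule real_le_rsqrt)
      have "(min s (\<sigma> * n))\<^sup>2 = min s (\<sigma> * n) * min s (\<sigma> * n)" by (simp add: power2_eq_square)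
      also have "\<dots> \<le> s * (\<sigma> * n)" using \<sigma> n by (intro mult_mono) auto
      finally show "(min s (\<sigma> * n))\<^sup>2 \<le> s * (\<sigma> * n)" .
    qed
    also have "\<dots> = n * q * sqrt \<sigma>"
      using n by (simp add: q_def real_sqrt_mult real_sqrt_divide field_simps)
    finally have min: "min s (\<sigma> * n) \<le> n * q * sqrt \<sigma>" .
    have "exp 1 * (min s (\<sigma> * n) * s) * p / m \<le> exp 1 * (min s (\<sigma> * n) * s) * p / (K * s / 2)"
      using m(1) ms K s p \<sigma> n by (intro divide_left_mono mult_nonneg_nonneg mult_pos_pos) auto
    also have "\<dots> = 2 * exp 1 * p / K * min s (\<sigma> * n)"
      using s K by (simp add: field_simps)
    also have "\<dots> \<le> 2 * exp 1 * p / K * (n * q * sqrt \<sigma>)"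
      using min p K by (intro mult_left_mono) auto
    also have "\<dots> = 2 * exp 1 * q / (15 * K) * (15 * (n * p) * sqrt \<sigma>)" by simp
    also have "\<dots> \<le> 2 * exp 1 * q / (15 * K) * K"
      using q K by (intro mult_left_mono) auto
    also have "\<dots> = (2 * (exp 1)\<^sup>2 / 15) * (q / exp 1)"
      using K by (simp add: power2_eq_square)
    \<comment> \<open>The constant 15 in the hypothesis on \<open>K\<close> is an upper bound for 2
      e^2.\<close>
    also have "\<dots> \<le> 1 * (q / exp 1)"
    proof (rule mult_right_mono)
      have "exp 1 \<le> (2.72 :: real)" using e_approx_32 by (simp add: abs_if split: if_splits)
      hence "(exp 1)\<^sup>2 \<le> (2.72 :: real)\<^sup>2" by (intro power_mono) auto
      thus "2 * (exp 1)\<^sup>2 / 15 \<le> (1::real)" by (simp add: power2_eq_square)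
    qed (use q in auto)
    also have "\<dots> = exp (- l)" using q by (simp add: l_def exp_diff)
    finally show ?thesis .
  qed
  have "2 * exp 1 * n / s = 2 * exp 1 / q\<^sup>2" using q n s by (simp add: field_simps)
  also have "\<dots> \<le> exp (2 * l)"
  proof -
    have "exp l = exp 1 / q" using q by (simp add: l_def exp_diff)
    hence "exp (2 * l) = (exp 1)\<^sup>2 / q\<^sup>2"
      unfolding exp_double by (simp add: power_divide)
    moreover have "2 * exp 1 \<le> (exp 1 :: real)\<^sup>2"
      using exp_ge_add_one_self[of 1] by (simp add: power2_eq_square)
    ultimately show ?thesis by (simp add: divide_right_mono)
  qed
  finally have "(2 * exp 1 * n / s) ^ s \<le> exp (2 * l) ^ s"
    using n by (intro power_mono) auto
  also have "\<dots> = exp (2 * l * s)" by (simp add: mult_ac flip: exp_of_nat_mult)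
  finally have "(2 * exp 1 * n / s) ^ s * (exp 1 * (min s (\<sigma> * n) * s) * p / m) ^ m
      \<le> exp (2 * l * s) * exp (- l) ^ m"
    using base p \<sigma> n by (intro mult_mono power_mono) auto
  also have "exp (- l) ^ m = exp (- l * m)" by (simp add: mult_ac flip: exp_of_nat_mult)
  also have "exp (2 * l * s) * exp (- l * m) = exp (2 * l * s - l * m)"
    by (simp add: exp_diff exp_minus field_simps)
  also have "\<dots> \<le> exp (- (m / 2) * l)"
  proof -
    have "l * (8 * s) \<le> l * m" using ms l by (intro mult_left_mono) auto
    moreover have "0 \<le> l * s" using l by simp
    ultimately show ?thesis by (simp add: algebra_simps)
  qed
  also have "\<dots> \<le> n powr (- b / 8) + exp (- 4 * sqrt n)"
  \<comment> \<open>For small \<open>s\<close> each edge gains at least \<open>n^(1/4)\<close> and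
    there are at least \<open>b\<close> edges. For large \<open>s\<close> the gain per edge is only
    a constant, but there are more than 8 sqrt n edges.\<close>
  proof (cases "s \<le> sqrt n")
    case True
    have "q \<le> sqrt (sqrt n / n)" unfolding q_def using True n by (intro real_sqrt_le_mono divide_right_mono) auto
    also have "\<dots> = n powr (- 1 / 4)"
      using n by (simp add: powr_half_sqrt[symmetric] powr_divide powr_powr powr_diff[symmetric] flip: powr_one)
    finally have "ln q \<le> ln (n powr (- 1 / 4))"
      using q n by (subst ln_le_cancel_iff) auto
    hence "l \<ge> ln n / 4" using l by (simp add: l_def ln_powr)
    hence "b / 2 * (ln n / 4) \<le> m / 2 * l"
      using m(2) l n ms by (intro mult_mono) auto
    hence "exp (- (m / 2) * l) \<le> exp (- b / 8 * ln n)" by simp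
    also have "\<dots> = n powr (- b / 8)" using n by (simp add: powr_def)
    finally show ?thesis by (simp add: add_increasing2)
  next
    case False
    have "4 * sqrt n * 1 \<le> m / 2 * l"
      using False ms l n by (intro mult_mono) auto
    hence "exp (- (m / 2) * l) \<le> exp (- 4 * sqrt n)" by simp
    thus ?thesis by (simp add: add_increasing)
  qed
  finally show ?thesis .
qed

text \<open>The obstruction that peeling meets: a subgraph of average degree at least
  \<open>K\<close> all of whose edges touch a small set. When it is absent, every such core has
  fewer than \<open>b\<close> edges.\<close>

definition has_dense_core :: "nat set set \<Rightarrow> real \<Rightarrow> real \<Rightarrow> real \<Rightarrow> bool" where
  "has_dense_core G s K b \<longleftrightarrow> (\<exists>S F. finite S \<and> real (card S) \<le> s \<and> F \<subseteq> G \<and>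
      (\<forall>e\<in>F. e \<inter> S \<noteq> {}) \<and> K * real (card (\<Union>F)) \<le> 2 * real (card F) \<and> b \<le> real (card F))"

text \<open>The first moment of dense subgraphs touching a small set \<open>S\<close>: the gain \<open>p\<close> per edge beats the
  entropy of the vertex set because there are at least \<open>K / 2\<close> edges per vertex.\<close>

lemma gnp_prob_dense_core:
  fixes p \<sigma> K b :: real
  assumes p: "0 \<le> p" "p \<le> 1" and n: "n \<ge> 1" and \<sigma>: "\<sigma> \<ge> 0"
    and K: "K \<ge> 16" "15 * (n * p) * sqrt \<sigma> \<le> K" and b: "b > 0"
  shows "measure_pmf.prob (gnp n p) {G. has_dense_core G (\<sigma> * n) K b}
    \<le> real n ^ 3 * (real n powr (- b / 8) + exp (- 4 * sqrt n))"
proof -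
  let ?prob = "measure_pmf.prob (gnp n p)"
  \<comment> \<open>\<open>U\<close> is the vertex set of the core and \<open>A\<close> its part in
    the small set. Recording \<open>A\<close> costs at most \<open>2 ^ s\<close> but lowers the
    number of available pairs from \<open>s * s\<close> to
    \<open>min s (\<sigma> * n) * s\<close>.\<close>
  define \<P> where "\<P> s = (\<lambda>(U, A). pairs A U) `
    (SIGMA U:{U. U \<subseteq> {..<n} \<and> card U = s}. {A. A \<subseteq> U \<and> card A \<le> \<sigma> * n})" for s
  \<comment> \<open>The possible numbers of vertices and edges of a core; at most
    \<open>n ^ 3\<close> combinations, which is the prefactor.\<close>
  define I where "I = {(s, m). s \<in> {1..n} \<and> m \<in> {1..n\<^sup>2} \<and> K * real s \<le> 2 * real m \<and> b \<le> real m}"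
  define \<epsilon> where "\<epsilon> = real n powr (- b / 8) + exp (- 4 * sqrt n)"
  have "I \<subseteq> {1..n} \<times> {1..n\<^sup>2}" by (auto simp: I_def)
  hence I: "finite I" "card I \<le> n * n\<^sup>2"
    using card_mono[of "{1..n} \<times> {1..n\<^sup>2}" I] by (auto intro: finite_subset simp: card_cartesian_product)
  have one: "?prob {G. \<exists>P\<in>\<P> s. m \<le> card (G \<inter> P)} \<le> \<epsilon>" if "(s, m) \<in> I" for s m
  proof -
    have sm: "s \<ge> 1" "s \<le> n" "m \<ge> 1" "K * real s \<le> 2 * real m" "b \<le> real m"
      using that by (auto simp: I_def)
    let ?\<U> = "{U. U \<subseteq> {..<n} \<and> card U = s}" and ?\<A> = "\<lambda>U. {A. A \<subseteq> U \<and> card A \<le> \<sigma> * n}"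
    have fU: "finite U" if "U \<in> ?\<U>" for U using that finite_subset by auto
    have fS: "finite (Sigma ?\<U> ?\<A>)" using fU by (intro finite_SigmaI) auto
    have "card (\<P> s) \<le> card (Sigma ?\<U> ?\<A>)"
      unfolding \<P>_def by (rule card_image_le[OF fS])
    also have "\<dots> = (\<Sum>U\<in>?\<U>. card (?\<A> U))"
      using fU by (intro card_SigmaI) auto
    also have "\<dots> \<le> (\<Sum>U\<in>?\<U>. 2 ^ s)"
    proof (rule sum_mono)
      fix U assume U: "U \<in> ?\<U>"
      have "card (?\<A> U) \<le> card (Pow U)" using fU[OF U] by (intro card_mono) auto
      thus "card (?\<A> U) \<le> 2 ^ s" using U fU[OF U] by (simp add: card_Pow)
    qed
    also have "\<dots> = (n choose s) * 2 ^ s" using n_subsets[of "{..<n}" s] by simp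
    finally have "real (card (\<P> s)) \<le> real ((n choose s) * 2 ^ s)" by (rule of_nat_mono)
    also have "\<dots> \<le> (exp 1 * n / s) ^ s * 2 ^ s"
      using binomial_le_exp_pow[OF sm(1), of n] by (simp add: mult_right_mono)
    also have "\<dots> = (2 * exp 1 * n / s) ^ s"
      by (simp add: power_mult_distrib power_divide)
    finally have card_P: "real (card (\<P> s)) \<le> (2 * exp 1 * n / s) ^ s" .
    have P: "finite P \<and> real (card P) \<le> min s (\<sigma> * n) * s" if "P \<in> \<P> s" for P
    proof -
      from that obtain U A where *: "P = pairs A U" "U \<subseteq> {..<n}" "card U = s" "A \<subseteq> U" "card A \<le> \<sigma> * n"
        by (auto simp: \<P>_def)
      have fin_U: "finite U" using *(2) by (rule finite_subset) simp
      have f: "finite U" "finite A" using fin_U finite_subset[OF *(4) fin_U] by simp_all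
      have "card A \<le> s" using card_mono[OF f(1) *(4)] * by simp
      have "real (card P) \<le> real (card A * card U)"
        using card_pairs_le[OF f(2,1)] * by (intro of_nat_mono) simp
      also have "\<dots> \<le> min s (\<sigma> * n) * s"
        using * \<open>card A \<le> s\<close> by (simp add: mult_right_mono)
      finally show ?thesis using finite_pairs f * by simp
    qed
    have "?prob {G. \<exists>P\<in>\<P> s. m \<le> card (G \<inter> P)} \<le>
        card (\<P> s) * (exp 1 * (min s (\<sigma> * n) * s) * p / m) ^ m"
      using fS by (intro gnp_union_bound p P sm) (auto simp: \<P>_def)
    also have "\<dots> \<le> (2 * exp 1 * n / s) ^ s * (exp 1 * (min s (\<sigma> * n) * s) * p / m) ^ m"
      using card_P p \<sigma> by (intro mult_right_mono) auto
    also have "\<dots> \<le> \<epsilon>"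
      unfolding \<epsilon>_def using n p \<sigma> K sm by (intro small_dense_set_bound) auto
    finally show ?thesis .
  qed
  have "?prob {G. has_dense_core G (\<sigma> * n) K b}
    \<le> ?prob {G. \<exists>(s, m)\<in>I. \<exists>P\<in>\<P> s. m \<le> card (G \<inter> P)}"
  proof (rule gnp_prob_mono)
    fix G assume G: "G \<subseteq> vertex_pairs n" and "has_dense_core G (\<sigma> * n) K b"
    then obtain S F where S: "card S \<le> \<sigma> * n" "finite S" and F: "F \<subseteq> G" "\<And>e. e \<in> F \<Longrightarrow> e \<inter> S \<noteq> {}"
      "K * real (card (\<Union>F)) \<le> 2 * real (card F)" "b \<le> real (card F)"
      unfolding has_dense_core_def by blast
    define U where "U = \<Union>F"
    have Fv: "F \<subseteq> vertex_pairs n" using F(1) G by blast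
    have U: "U \<subseteq> {..<n}" "finite F" using Union_edges[OF Fv] finite_edges[OF Fv] by (simp_all add: U_def)
    have fin_U: "finite U" using U(1) by (rule finite_subset) simp
    have "F \<noteq> {}" using F(4) b by auto
    then obtain e where e: "e \<in> F" by blast
    then obtain u w where "e = {u, w}" using Fv vertex_pairsE by blast
    hence "U \<noteq> {}" using e unfolding U_def by blast
    hence "card U \<ge> 1" "card U \<le> n" using fin_U card_mono[OF _ U(1)] by (auto simp: Suc_le_eq card_gt_0_iff)
    moreover have "card F \<ge> 1" using e U by (auto simp: Suc_le_eq card_gt_0_iff)
    moreover have "F \<subseteq> pairs {..<n} {..<n}"
      using Fv by (auto simp: pairs_def elim!: vertex_pairsE dest!: subsetD)
    hence "card F \<le> card (pairs {..<n} {..<n})" by (intro card_mono finite_pairs) auto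
    hence "card F \<le> n\<^sup>2" using card_pairs_le[of "{..<n}" "{..<n}"] by (simp add: power2_eq_square)
    ultimately have I': "(card U, card F) \<in> I" using F by (simp add: I_def U_def)
    have "F \<subseteq> G \<inter> pairs (U \<inter> S) U"
    proof
      fix e assume e: "e \<in> F"
      then obtain u w where uw: "e = {u, w}" using Fv vertex_pairsE by blast
      moreover have "u \<in> U" "w \<in> U" using uw e by (auto simp: U_def)
      moreover have "u \<in> S \<or> w \<in> S" using F(2)[OF e] uw by auto
      ultimately show "e \<in> G \<inter> pairs (U \<inter> S) U"
        using e F(1) by (auto simp: pairs_def insert_commute)
    qed
    hence "card F \<le> card (G \<inter> pairs (U \<inter> S) U)"
      using fin_U by (intro card_mono) (auto intro: finite_pairs)
    moreover have "real (card (U \<inter> S)) \<le> \<sigma> * n"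
      using card_mono[of S "U \<inter> S"] S by (simp add: of_nat_le_iff[where 'a=real, symmetric] del: of_nat_le_iff)
    hence "pairs (U \<inter> S) U \<in> \<P> (card U)"
      unfolding \<P>_def using U by (intro image_eqI[of _ _ "(U, U \<inter> S)"]) auto
    ultimately show "\<exists>(s, m)\<in>I. \<exists>P\<in>\<P> s. m \<le> card (G \<inter> P)" using I' by blast
  qed
  also have "\<dots> = ?prob (\<Union>(s, m)\<in>I. {G. \<exists>P\<in>\<P> s. m \<le> card (G \<inter> P)})"
    by (intro arg_cong[of _ _ ?prob]) auto
  also have "\<dots> \<le> (\<Sum>(s, m)\<in>I. ?prob {G. \<exists>P\<in>\<P> s. m \<le> card (G \<inter> P)})"
    using measure_UNION_le[OF I(1), of "\<lambda>(s, m). {G. \<exists>P\<in>\<P> s. m \<le> card (G \<inter> P)}" "gnp n p"]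
    by (simp add: case_prod_unfold)
  also have "\<dots> \<le> (\<Sum>(s, m)\<in>I. \<epsilon>)" using one by (intro sum_mono) auto
  also have "\<dots> = card I * \<epsilon>" by simp
  also have "\<dots> \<le> real (n * n\<^sup>2) * \<epsilon>"
    using I(2) by (intro mult_right_mono of_nat_mono) (auto simp: \<epsilon>_def)
  finally show ?thesis by (simp add: \<epsilon>_def power2_eq_square power3_eq_cube mult_ac)
qed

section \<open>Chernoff bounds and delocalized vectors\<close>

lemma exp_le_one_plus_eps:
  fixes z \<epsilon> :: real
  assumes "0 \<le> z" "z \<le> \<epsilon>" "\<epsilon> \<le> 1"
  shows "exp z \<le> 1 + (1 + \<epsilon>) * z"
proof -
  have "exp z \<le> 1 + z + z\<^sup>2" using assms by (intro exp_bound) auto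
  also have "z\<^sup>2 \<le> \<epsilon> * z" using assms by (simp add: power2_eq_square mult_right_mono)
  finally show ?thesis by (simp add: algebra_simps)
qed

text \<open>Exponential Markov with \<theta> = \<epsilon> / c: then every exponent \<theta> w e is
  at most \<epsilon>, where linearizing \<open>exp\<close> loses only a factor 1 + \<epsilon> in the
  mean. The deviation is an absolute excess \<open>t\<close>, so the bound is uniform over weights
  with small mean.\<close>

lemma gnp_chernoff:
  fixes w :: "nat set \<Rightarrow> real"
  assumes p: "0 \<le> p" "p \<le> 1" and \<epsilon>: "0 < \<epsilon>" "\<epsilon> \<le> 1" and c: "c > 0"
    and w: "\<And>e. e \<in> vertex_pairs n \<Longrightarrow> 0 \<le> w e \<and> w e \<le> c"
  shows "measure_pmf.prob (gnp n p)
      {G. (1 + \<epsilon>) * (p * (\<Sum>e\<in>vertex_pairs n. w e)) + t \<le> (\<Sum>e\<in>G. w e)} \<le> exp (- \<epsilon> * t / c)"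
proof -
  let ?V = "vertex_pairs n"
  define \<theta> where "\<theta> = \<epsilon> / c"
  have \<theta>: "\<theta> > 0" using \<epsilon> c by (simp add: \<theta>_def)
  define a where "a = (1 + \<epsilon>) * (p * (\<Sum>e\<in>?V. w e)) + t"
  let ?Pi = "Pi_pmf ?V False (\<lambda>_. bernoulli_pmf p)"
  let ?f = "\<lambda>X :: nat set \<Rightarrow> bool. \<Prod>e\<in>?V. exp (\<theta> * (if X e then w e else 0))"
  have f: "?f X = exp (\<theta> * (\<Sum>e\<in>{e \<in> ?V. X e}. w e))" for X
    by (simp add: exp_sum[symmetric] finite_vertex_pairs sum_distrib_left[symmetric] sum.inter_filter)
  have int: "integrable (measure_pmf ?Pi) ?f"
    by (intro integrable_measure_pmf_finite finite_subset[OF set_Pi_pmf_subset'] finite_vertex_pairs)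
      (auto simp: finite_vertex_pairs)
  have "measure_pmf.expectation ?Pi ?f =
      (\<Prod>e\<in>?V. measure_pmf.expectation (bernoulli_pmf p) (\<lambda>b. exp (\<theta> * (if b then w e else 0))))"
    by (intro expectation_prod_Pi_pmf finite_vertex_pairs integrable_measure_pmf_finite) auto
  also have "\<dots> = (\<Prod>e\<in>?V. p * exp (\<theta> * w e) + (1 - p))"
    using p by (simp add: mult.commute)
  also have "\<dots> \<le> (\<Prod>e\<in>?V. exp (\<theta> * (1 + \<epsilon>) * (p * w e)))"
  proof (rule prod_mono)
    fix e assume e: "e \<in> ?V"
    have "\<theta> * w e \<le> \<theta> * c" using w[OF e] \<theta> by (intro mult_left_mono) auto
    hence "\<theta> * w e \<le> \<epsilon>" using c by (simp add: \<theta>_def)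
    hence "exp (\<theta> * w e) \<le> 1 + (1 + \<epsilon>) * (\<theta> * w e)"
      using w[OF e] \<theta> \<epsilon> by (intro exp_le_one_plus_eps) auto
    hence "p * exp (\<theta> * w e) + (1 - p) \<le> p * (1 + (1 + \<epsilon>) * (\<theta> * w e)) + (1 - p)"
      using p by (intro add_right_mono mult_left_mono) auto
    also have "\<dots> = 1 + \<theta> * (1 + \<epsilon>) * (p * w e)" by (simp add: algebra_simps)
    also have "\<dots> \<le> exp (\<theta> * (1 + \<epsilon>) * (p * w e))" by (rule exp_ge_add_one_self)
    finally show "0 \<le> p * exp (\<theta> * w e) + (1 - p) \<and>
        p * exp (\<theta> * w e) + (1 - p) \<le> exp (\<theta> * (1 + \<epsilon>) * (p * w e))"
      using p by simp
  qed
  also have "\<dots> = exp (\<theta> * ((1 + \<epsilon>) * (p * (\<Sum>e\<in>?V. w e))))"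
    by (simp add: exp_sum[symmetric] finite_vertex_pairs sum_distrib_left mult_ac)
  finally have E: "measure_pmf.expectation ?Pi ?f \<le> exp (\<theta> * ((1 + \<epsilon>) * (p * (\<Sum>e\<in>?V. w e))))" .
  have "measure_pmf.prob (gnp n p) {G. a \<le> (\<Sum>e\<in>G. w e)} =
      measure_pmf.prob ?Pi {X. a \<le> (\<Sum>e\<in>{e \<in> ?V. X e}. w e)}"
    by (simp add: gnp_def vimage_def)
  also have "{X. a \<le> (\<Sum>e\<in>{e \<in> ?V. X e}. w e)} = {X \<in> space (measure_pmf ?Pi). exp (\<theta> * a) \<le> ?f X}"
    unfolding f using \<theta> by simp
  also have "measure_pmf.prob ?Pi \<dots> \<le> measure_pmf.expectation ?Pi ?f / exp (\<theta> * a)"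
    by (rule integral_Markov_inequality_measure[where A = "{}"]) (use int in \<open>auto intro!: prod_nonneg\<close>)
  also have "\<dots> \<le> exp (\<theta> * ((1 + \<epsilon>) * (p * (\<Sum>e\<in>?V. w e)))) / exp (\<theta> * a)"
    using E by (intro divide_right_mono) auto
  also have "\<dots> = exp (- \<epsilon> * t / c)"
    by (simp add: a_def \<theta>_def exp_diff[symmetric] algebra_simps)
  finally show ?thesis by (simp add: a_def)
qed

text \<open>Rounding \<open>y\<close> up to a grid of mesh \<epsilon> / sqrt n can only increase the
  edge sum, as everything is nonnegative, and changes the squared norm by at most 3 \<epsilon>. Each
  grid point is a weighting with mean controlled by Cauchy-Schwarz, to which Chernoff
  applies.\<close>

lemma gnp_prob_delocalized_quadratic_form:
  fixes B \<epsilon> p :: real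
  assumes p: "0 \<le> p" "p \<le> 1" and n: "n \<ge> 1" and \<epsilon>: "0 < \<epsilon>" "\<epsilon> \<le> 1" and B: "B \<ge> 1"
  shows "measure_pmf.prob (gnp n p) {G. \<exists>y. (\<forall>v. 0 \<le> y v \<and> y v \<le> B / sqrt n) \<and> (\<Sum>v<n. (y v)\<^sup>2) \<le> 1 \<and>
      n * p * (\<Sum>v<n. (y v)\<^sup>2) + 8 * \<epsilon> * (n * p) \<le> 2 * edge_sum G y}
    \<le> (B / \<epsilon> + 2) ^ n * exp (- \<epsilon>\<^sup>2 * (n * p) * n / (8 * B\<^sup>2))"
proof -
  let ?prob = "measure_pmf.prob (gnp n p)"
  define d where "d = n * p"
  define Q where "Q = nat \<lceil>B / \<epsilon>\<rceil>"
  define \<Phi> where "\<Phi> = PiE {..<n} (\<lambda>_. {0..Q})"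
  define g where "g f v = \<epsilon> * real (f v) / sqrt n" for f :: "nat \<Rightarrow> nat" and v
  \<comment> \<open>Rounded entries are at most 2 B / sqrt n; \<open>c\<close> is the resulting
    bound on the weight of one edge.\<close>
  define c where "c = 4 * B\<^sup>2 / n"
  have d: "d \<ge> 0" using p by (simp add: d_def)
  have sn: "sqrt n > 0" "sqrt n * sqrt n = n" using n by auto
  have Q: "Q \<le> B / \<epsilon> + 1" using B \<epsilon> by (simp add: Q_def)
  hence "\<epsilon> * Q \<le> \<epsilon> * (B / \<epsilon> + 1)" using \<epsilon> by (intro mult_left_mono) auto
  also have "\<dots> = B + \<epsilon>" using \<epsilon> by (simp add: field_simps)
  finally have \<epsilon>Q: "\<epsilon> * Q \<le> 2 * B" using \<epsilon> B by linarith
  have c: "c > 0" using B n by (simp add: c_def)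
  define bad where "bad f = {G. (1 + \<epsilon>) * (p * edge_sum (vertex_pairs n) (g f)) + \<epsilon> * d / 2
      \<le> edge_sum G (g f)}" for f
  have one: "?prob (bad f) \<le> exp (- \<epsilon>\<^sup>2 * d * n / (8 * B\<^sup>2))" if f: "f \<in> \<Phi>" for f
  proof -
    have "0 \<le> g f v \<and> g f v \<le> 2 * B / sqrt n" if "v < n" for v
    proof -
      have "f v \<le> Q" using f that by (auto simp: \<Phi>_def PiE_iff)
      hence "\<epsilon> * f v \<le> \<epsilon> * Q" using \<epsilon> by (intro mult_left_mono) auto
      hence "\<epsilon> * f v \<le> 2 * B" using \<epsilon>Q by linarith
      thus ?thesis using \<epsilon> by (auto simp: g_def intro!: divide_right_mono)
    qed note gb = this
    have "0 \<le> (\<Prod>v\<in>e. g f v) \<and> (\<Prod>v\<in>e. g f v) \<le> c" if e: "e \<in> vertex_pairs n" for e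
    proof -
      from e obtain u v where uv: "e = {u, v}" "u \<noteq> v" "u < n" "v < n" by (rule vertex_pairsE)
      have "g f u * g f v \<le> (2 * B / sqrt n) * (2 * B / sqrt n)"
        using gb uv B by (intro mult_mono) auto
      also have "\<dots> = c" using sn by (simp add: c_def power2_eq_square)
      finally show ?thesis using uv gb by simp
    qed
    from gnp_chernoff[OF p \<epsilon> c this, of n "\<lambda>x. x" "\<epsilon> * d / 2"]
    have "?prob (bad f) \<le> exp (- \<epsilon> * (\<epsilon> * d / 2) / c)"
      by (simp add: bad_def edge_sum_def)
    also have "- \<epsilon> * (\<epsilon> * d / 2) / c = - \<epsilon>\<^sup>2 * d * n / (8 * B\<^sup>2)"
      by (simp add: c_def power2_eq_square field_simps)
    finally show ?thesis .
  qed
  have "?prob {G. \<exists>y. (\<forall>v. 0 \<le> y v \<and> y v \<le> B / sqrt n) \<and> (\<Sum>v<n. (y v)\<^sup>2) \<le> 1 \<and>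
      n * p * (\<Sum>v<n. (y v)\<^sup>2) + 8 * \<epsilon> * (n * p) \<le> 2 * edge_sum G y} \<le> ?prob {G. \<exists>f\<in>\<Phi>. G \<in> bad f}"
  proof (rule gnp_prob_mono)
    fix G assume G: "G \<subseteq> vertex_pairs n"
    assume "\<exists>y. (\<forall>v. 0 \<le> y v \<and> y v \<le> B / sqrt n) \<and> (\<Sum>v<n. (y v)\<^sup>2) \<le> 1 \<and>
      n * p * (\<Sum>v<n. (y v)\<^sup>2) + 8 * \<epsilon> * (n * p) \<le> 2 * edge_sum G y"
    then obtain y where y: "\<And>v. 0 \<le> y v" "\<And>v. y v \<le> B / sqrt n" "(\<Sum>v<n. (y v)\<^sup>2) \<le> 1"
      "d * (\<Sum>v<n. (y v)\<^sup>2) + 8 * \<epsilon> * d \<le> 2 * edge_sum G y" by (auto simp: d_def)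
    define f where "f = restrict (\<lambda>v. nat \<lceil>y v * sqrt n / \<epsilon>\<rceil>) {..<n}"
    have fQ: "f \<in> \<Phi>"
    proof -
      have "nat \<lceil>y v * sqrt n / \<epsilon>\<rceil> \<le> Q" for v
      proof -
        have "y v * sqrt n \<le> B" using y(2)[of v] sn by (simp add: field_simps)
        hence "y v * sqrt n / \<epsilon> \<le> B / \<epsilon>" using \<epsilon> by (intro divide_right_mono) auto
        thus ?thesis unfolding Q_def by (intro nat_mono ceiling_mono)
      qed
      thus ?thesis by (auto simp: \<Phi>_def f_def)
    qed
    have g: "y v \<le> g f v \<and> g f v \<le> y v + \<epsilon> / sqrt n" if v: "v < n" for v
    proof -
      let ?z = "y v * sqrt n / \<epsilon>"
      have z: "?z \<ge> 0" using y(1) \<epsilon> by simp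
      have "?z \<le> real (f v)" "real (f v) \<le> ?z + 1" using v z by (auto simp: f_def) 
      hence "\<epsilon> * ?z \<le> \<epsilon> * real (f v)" "\<epsilon> * real (f v) \<le> \<epsilon> * (?z + 1)"
        using \<epsilon> by (intro mult_left_mono; simp)+
      moreover have "\<epsilon> * ?z = y v * sqrt n" using \<epsilon> by simp
      ultimately have "y v * sqrt n \<le> \<epsilon> * real (f v)" "\<epsilon> * real (f v) \<le> y v * sqrt n + \<epsilon>"
        by (simp_all only: distrib_left mult_1_right)
      thus ?thesis using sn by (simp add: g_def field_simps)
    qed
    let ?Y = "\<Sum>v<n. (y v)\<^sup>2"
    have "(\<Sum>v<n. y v)\<^sup>2 \<le> n * ?Y"
      using Cauchy_Schwarz_ineq_sum[of "\<lambda>_. 1" y "{..<n}"] by simp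
    also have "\<dots> \<le> (sqrt n)\<^sup>2" using y(3) n by simp
    finally have sum_y: "(\<Sum>v<n. y v) \<le> sqrt n" by (rule power2_le_imp_le) simp
    have "(\<Sum>v<n. (g f v)\<^sup>2) \<le> (\<Sum>v<n. (y v + \<epsilon> / sqrt n)\<^sup>2)"
      using g y(1) by (intro sum_mono power_mono) (auto intro: order.trans)
    also have "\<dots> = ?Y + 2 * \<epsilon> / sqrt n * (\<Sum>v<n. y v) + \<epsilon>\<^sup>2"
      using sn n by (simp add: power2_sum sum.distrib sum_distrib_left sum_divide_distrib power_divide mult_ac)
    also have "2 * \<epsilon> / sqrt n * (\<Sum>v<n. y v) \<le> 2 * \<epsilon> / sqrt n * sqrt n"
      using sum_y \<epsilon> sn by (intro mult_left_mono) auto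
    also have "2 * \<epsilon> / sqrt n * sqrt n = 2 * \<epsilon>" using sn by simp
    also have "\<epsilon>\<^sup>2 \<le> \<epsilon>" using \<epsilon> by (simp add: power2_eq_square mult_left_le)
    finally have gsq: "(\<Sum>v<n. (g f v)\<^sup>2) \<le> ?Y + 3 * \<epsilon>" by simp
    have g0: "g f v \<ge> 0" for v using \<epsilon> by (simp add: g_def)
    have "2 * (p * edge_sum (vertex_pairs n) (g f)) = p * (2 * edge_sum (vertex_pairs n) (g f))" by simp
    also have "\<dots> \<le> p * (\<Sum>v<n. g f v)\<^sup>2"
      using p g0 by (intro mult_left_mono two_edge_sum_le_square) auto
    also have "\<dots> \<le> p * (n * (\<Sum>v<n. (g f v)\<^sup>2))"
      using Cauchy_Schwarz_ineq_sum[of "\<lambda>_. 1" "g f" "{..<n}"] p by (intro mult_left_mono) auto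
    also have "\<dots> = d * (\<Sum>v<n. (g f v)\<^sup>2)" by (simp add: d_def)
    also have "\<dots> \<le> d * (?Y + 3 * \<epsilon>)" using gsq d by (intro mult_left_mono)
    finally have "(1 + \<epsilon>) * (2 * (p * edge_sum (vertex_pairs n) (g f))) \<le> (1 + \<epsilon>) * (d * (?Y + 3 * \<epsilon>))"
      using \<epsilon> by (intro mult_left_mono) auto
    \<comment> \<open>The error budget in units of \<epsilon> d: 3 from rounding, 1 and 3 from the
      Chernoff factor 1 + \<epsilon>, and 1 from twice the excess \<epsilon> d / 2; in total
      8.\<close>
    also have "\<dots> = d * ?Y + 3 * \<epsilon> * d + \<epsilon> * d * ?Y + 3 * (\<epsilon> * \<epsilon> * d)" by (simp add: algebra_simps)
    also have "\<epsilon> * d * ?Y \<le> \<epsilon> * d * 1" using y(3) \<epsilon> d by (intro mult_left_mono) auto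
    also have "\<epsilon> * \<epsilon> * d \<le> 1 * \<epsilon> * d" using \<epsilon> d by (intro mult_right_mono) auto
    finally have "(1 + \<epsilon>) * (2 * (p * edge_sum (vertex_pairs n) (g f))) + \<epsilon> * d \<le> d * ?Y + 8 * \<epsilon> * d"
      by simp
    also have "\<dots> \<le> 2 * edge_sum G y" by (rule y(4))
    also have "edge_sum G y \<le> edge_sum G (g f)"
      using G g y(1) by (intro edge_sum_mono_weights) (auto simp: vertex_pairs_def)
    finally have "G \<in> bad f" by (simp add: bad_def)
    with fQ show "\<exists>f\<in>\<Phi>. G \<in> bad f" by blast
  qed
  also have "{G. \<exists>f\<in>\<Phi>. G \<in> bad f} = (\<Union>f\<in>\<Phi>. bad f)" by auto
  also have "?prob \<dots> \<le> (\<Sum>f\<in>\<Phi>. ?prob (bad f))"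
    unfolding \<Phi>_def by (intro measure_UNION_le finite_PiE) auto
  also have "\<dots> \<le> (\<Sum>f\<in>\<Phi>. exp (- \<epsilon>\<^sup>2 * d * n / (8 * B\<^sup>2)))" by (intro sum_mono one)
  also have "\<dots> = (real Q + 1) ^ n * exp (- \<epsilon>\<^sup>2 * d * n / (8 * B\<^sup>2))"
    by (simp add: \<Phi>_def card_PiE add.commute)
  also have "\<dots> \<le> (B / \<epsilon> + 2) ^ n * exp (- \<epsilon>\<^sup>2 * d * n / (8 * B\<^sup>2))"
    using Q by (intro mult_right_mono power_mono) auto
  finally show ?thesis by (simp add: d_def)
qed

section \<open>A single vertex of large degree\<close>

lemma map_deg_gnp:
  assumes p: "0 \<le> p" "p \<le> 1" and v: "v < n"
  shows "map_pmf (\<lambda>G. deg G v) (gnp n p) = binomial_pmf (n - 1) p"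
proof -
  let ?V = "vertex_pairs n"
  define A where "A = {e \<in> ?V. v \<in> e}"
  have A: "A \<subseteq> ?V" "finite A" using finite_vertex_pairs by (auto simp: A_def)
  have "card A = deg ?V v" by (simp add: A_def deg_def)
  also have "\<dots> = card {u \<in> {..<n}. {u, v} \<in> ?V}" by (rule deg_eq_card_neighbours) simp
  also have "{u \<in> {..<n}. {u, v} \<in> ?V} = {..<n} - {v}"
    using v by (auto simp: pair_in_vertex_pairs_iff)
  finally have card_A: "card A = n - 1" using v by simp
  have "binomial_pmf (n - 1) p =
      map_pmf (\<lambda>X. card {e \<in> A. X e}) (Pi_pmf A False (\<lambda>_. bernoulli_pmf p))"
    using p by (intro binomial_pmf_altdef' A card_A) auto
  also have "Pi_pmf A False (\<lambda>_. bernoulli_pmf p) =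
      map_pmf (\<lambda>X e. if e \<in> A then X e else False) (Pi_pmf ?V False (\<lambda>_. bernoulli_pmf p))"
    by (intro Pi_pmf_subset finite_vertex_pairs A)
  finally show ?thesis
    unfolding gnp_def map_pmf_comp by (auto simp: deg_def A_def intro!: map_pmf_cong arg_cong[of _ _ card])
qed

text \<open>One term of the binomial law, degree exactly \<open>k\<close>, is large enough.\<close>

lemma gnp_prob_high_degree_ge:
  assumes p: "0 \<le> p" "p \<le> 1" and v: "v < n" and k: "1 \<le> k" "k \<le> n - 1"
  shows "((n - 1) / k * p) ^ k * (1 - p) ^ n \<le> measure_pmf.prob (gnp n p) {G. k \<le> deg G v}"
proof -
  have "((n - 1) / k * p) ^ k * (1 - p) ^ n \<le> real ((n - 1) choose k) * p ^ k * (1 - p) ^ (n - 1 - k)"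
    unfolding power_mult_distrib
    using binomial_ge_n_over_k_pow_k[OF k(2), where 'a = real] v p k
    by (intro mult_mono power_decreasing) (auto simp: of_nat_diff)
  also have "\<dots> = pmf (binomial_pmf (n - 1) p) k" using p by simp
  also have "\<dots> = measure_pmf.prob (gnp n p) {G. deg G v = k}"
    unfolding map_deg_gnp[OF p v, symmetric] pmf_map by (simp add: vimage_def)
  also have "\<dots> \<le> measure_pmf.prob (gnp n p) {G. k \<le> deg G v}"
    by (intro measure_pmf.finite_measure_mono) auto
  finally show ?thesis using v by (simp add: of_nat_diff)
qed

text \<open>Test vector: the top eigenvector of the star at \<open>v\<close>, with sqrt k at the
  centre and 1 at the leaves. All its entries are nonnegative, so further edges of the graph only
  increase the form.\<close>

lemma sqrt_max_degree_le_max_eigenvalue: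
  assumes G: "G \<subseteq> vertex_pairs n" and v: "v < n"
  shows "sqrt (deg G v) \<le> max_eigenvalue n G"
proof -
  have "n \<ge> 1" using v by simp
  then have x: "quad_form n (adj G) y \<le> max_eigenvalue n G * (\<Sum>i<n. (y i)\<^sup>2)" for y
    by (rule max_eigenvalue_eq_rayleigh_maximum)
  show ?thesis
  proof (cases "deg G v = 0")
    \<comment> \<open>The star vector would be 0 here; the all-ones vector shows that the eigenvalue
      is nonnegative.\<close>
    case True
    have "0 \<le> quad_form n (adj G) (\<lambda>_. 1)"
      by (auto simp: quad_form_def adj_def intro!: sum_nonneg)
    also have "\<dots> \<le> max_eigenvalue n G * n" using x[of "\<lambda>_. 1"] by simp
    finally show ?thesis using True v by (simp add: zero_le_mult_iff)
  next
    case False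
    define N where "N = {u \<in> {..<n}. {u, v} \<in> G}"
    define k where "k = real (deg G v)"
    have k: "k > 0" "real (card N) = k"
      using False by (simp_all add: k_def) (simp add: N_def deg_eq_card_neighbours[OF G])
    have N: "finite N" "v \<notin> N" "N \<subseteq> {..<n}"
      using G by (auto simp: N_def vertex_pairs_def)
    define y where "y u = (if u = v then sqrt k else if u \<in> N then 1 else 0)" for u
    have "(\<Sum>u<n. (y u)\<^sup>2) = (\<Sum>u\<in>insert v N. (y u)\<^sup>2)"
      using N v by (intro sum.mono_neutral_right) (auto simp: y_def)
    also have "\<dots> = k + (\<Sum>u\<in>N. (y u)\<^sup>2)" using N k by (simp add: y_def)
    also have "(\<Sum>u\<in>N. (y u)\<^sup>2) = (\<Sum>u\<in>N. 1)" using N by (intro sum.cong) (auto simp: y_def)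
    finally have sq: "(\<Sum>u<n. (y u)\<^sup>2) = 2 * k" using k by simp
    have y0: "y u \<ge> 0" for u using k by (simp add: y_def)
    have inj: "inj_on (\<lambda>u. {u, v}) N" by (auto simp: inj_on_def doubleton_eq_iff)
    have "k * sqrt k = (\<Sum>u\<in>N. sqrt k)" using k by simp
    also have "\<dots> = (\<Sum>u\<in>N. \<Prod>w\<in>{u, v}. y w)"
    proof (rule sum.cong[OF refl])
      fix u assume "u \<in> N"
      moreover from this have "u \<noteq> v" using N(2) by blast
      ultimately show "sqrt k = (\<Prod>w\<in>{u, v}. y w)" by (simp add: y_def)
    qed
    also have "\<dots> = edge_sum ((\<lambda>u. {u, v}) ` N) y"
      unfolding edge_sum_def by (subst sum.reindex[OF inj]) simp
    also have "\<dots> \<le> edge_sum G y"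
      unfolding edge_sum_def using finite_edges[OF G] y0
      by (intro sum_mono2 prod_nonneg) (auto simp: N_def)
    finally have "2 * (k * sqrt k) \<le> quad_form n (adj G) y" by (simp add: quad_form_adj[OF G])
    moreover have "quad_form n (adj G) y \<le> max_eigenvalue n G * (\<Sum>i<n. (y i)\<^sup>2)"
      by (rule x)
    ultimately have "sqrt k * (2 * k) \<le> max_eigenvalue n G * (2 * k)" by (simp add: sq mult_ac)
    thus ?thesis using k by (simp add: k_def)
  qed
qed

subsection \<open>Decomposition of the quadratic form\<close>

text \<open>The deterministic half. Each pair of core density and degree bound has to keep its
  product of order \<open>d^2\<close> or less: on the tiny set a constant \<open>K1\<close> admits
  the large degrees \<open>D1\<close>, whereas the bigger \<open>K2\<close> for the set of large
  entries requires the smaller \<open>D0\<close>.\<close>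

lemma max_eigenvalue_le_of_structure:
  fixes d D0 D1 \<Delta> \<sigma>1 \<sigma>2 K1 K2 b \<epsilon> B h t :: real
  assumes G: "G \<subseteq> vertex_pairs n" and n: "n \<ge> 1" and d: "d > 0"
    and \<Delta>: "\<Delta> > 0" "\<And>v. v < n \<Longrightarrow> deg G v \<le> \<Delta>"
    and D: "0 < D0" "D0 \<le> D1"
    and H: "card (high_degree n D1 G) \<le> h"
    and T: "card (shared_neighbours n (high_degree n D1 G) G) \<le> t"
    and M: "card (high_degree n D0 G) + h * \<Delta> \<le> \<sigma>1 * n"
    and core1: "\<not> has_dense_core G (\<sigma>1 * n) K1 b" and core2: "\<not> has_dense_core G (\<sigma>2 * n) K2 b"
    and K: "K1 > 0" "K2 > 0" and B: "B > 0" "1 \<le> \<sigma>2 * B\<^sup>2"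
    and light: "\<not> (\<exists>y. (\<forall>v. 0 \<le> y v \<and> y v \<le> B / sqrt n) \<and> (\<Sum>v<n. (y v)\<^sup>2) \<le> 1 \<and>
      d * (\<Sum>v<n. (y v)\<^sup>2) + 8 * \<epsilon> * d \<le> 2 * edge_sum G y)"
  shows "max_eigenvalue n G \<le> max (sqrt \<Delta>) d + 2 * sqrt (h * (h + t))
    + 2 * (sqrt (K1 * D1) + sqrt b) + 2 * (sqrt (K2 * D0) + sqrt b) + 8 * \<epsilon> * d"
proof -
  define H where "H = high_degree n D1 G"
  define M where "M = high_degree n D0 G"
  define N where "N = (\<Union>v\<in>H. {u \<in> {..<n}. {u, v} \<in> G})"
  obtain x where x: "(\<Sum>i<n. (x i)\<^sup>2) = 1" "quad_form n (adj G) x = max_eigenvalue n G"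
    by (rule max_eigenvalue_eq_rayleigh_maximum[OF n])
  define z where "z v = \<bar>x v\<bar>" for v
  have z: "(\<Sum>v<n. (z v)\<^sup>2) = 1" "\<And>v. z v \<ge> 0" using x(1) by (auto simp: z_def)
  have eig: "max_eigenvalue n G \<le> 2 * edge_sum G z"
    using edge_sum_le_abs[of G x] quad_form_adj[OF G, of x] x(2) by (simp add: z_def[abs_def])
  \<comment> \<open>Including the neighbours of \<open>H\<close> puts whole stars into
    \<open>S1\<close>, so that star mass and bulk mass live on disjoint vertex sets.\<close>
  define S1 where "S1 = M \<union> N"
  define S2 where "S2 = {v. v < n \<and> B / sqrt n < z v}"
  have HM: "H \<subseteq> M" using D by (auto simp: H_def M_def high_degree_def)
  have sub: "H \<subseteq> {..<n}" "M \<subseteq> {..<n}" "S1 \<subseteq> {..<n}" "S2 \<subseteq> {..<n}"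
    by (auto simp: H_def M_def high_degree_def S1_def N_def S2_def)
  have fin: "finite H" "finite S1" "finite S2" "finite G"
    using sub[THEN finite_subset] finite_edges[OF G] by simp_all
  have h: "card H \<le> h" using H by (simp add: H_def)
  have card_S1: "card S1 \<le> \<sigma>1 * n"
  proof -
    have "card N \<le> (\<Sum>v\<in>H. card {u \<in> {..<n}. {u, v} \<in> G})"
      unfolding N_def by (rule card_UN_le[OF fin(1)])
    also have "\<dots> = (\<Sum>v\<in>H. deg G v)" by (simp add: deg_eq_card_neighbours[OF G])
    finally have "real (card N) \<le> (\<Sum>v\<in>H. real (deg G v))" by (simp flip: of_nat_sum)
    also have "\<dots> \<le> (\<Sum>v\<in>H. \<Delta>)" using sub \<Delta> by (intro sum_mono) auto
    also have "\<dots> \<le> h * \<Delta>" using h \<Delta> by (simp add: mult_right_mono)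
    finally have "real (card N) \<le> h * \<Delta>" .
    moreover have "card S1 \<le> card M + card N" unfolding S1_def by (rule card_Un_le)
    ultimately show ?thesis using M by (simp add: M_def)
  qed
  have card_S2: "card S2 \<le> \<sigma>2 * n"
  proof -
    \<comment> \<open>Markov's inequality for the unit vector \<open>z\<close>: fewer than n / B^2
      of its entries can exceed B / sqrt n.\<close>
    have "card S2 * (B\<^sup>2 / n) = (\<Sum>v\<in>S2. (B / sqrt n)\<^sup>2)" by (simp add: power_divide)
    also have "\<dots> \<le> (\<Sum>v\<in>S2. (z v)\<^sup>2)"
      using B by (intro sum_mono power_mono) (auto simp: S2_def)
    also have "\<dots> \<le> 1" unfolding z(1)[symmetric] using sub by (intro sum_mono2) auto
    also have "\<dots> \<le> \<sigma>2 * B\<^sup>2" by (rule B(2))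
    finally have "card S2 * (B\<^sup>2 / n) \<le> (\<sigma>2 * n) * (B\<^sup>2 / n)" using n by simp
    thus ?thesis using B n by (subst (asm) mult_le_cancel_right_pos) auto
  qed
  \<comment> \<open>An edge is classified by the first of \<open>H\<close>, \<open>S1\<close>,
    \<open>S2\<close> that it meets. Thus vertices of \<open>H\<close> are isolated in
    \<open>F2\<close> and vertices of \<open>M\<close> in \<open>F3\<close>, which yields the degree
    bounds \<open>D1\<close> and \<open>D0\<close>.\<close>
  define F1 where "F1 = {e \<in> G. e \<inter> H \<noteq> {}}"
  define F2 where "F2 = {e \<in> G. e \<inter> H = {} \<and> e \<inter> S1 \<noteq> {}}"
  define F3 where "F3 = {e \<in> G. e \<inter> S1 = {} \<and> e \<inter> S2 \<noteq> {}}"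
  define F4 where "F4 = {e \<in> G. e \<inter> S1 = {} \<and> e \<inter> S2 = {}}"
  note F_defs = F1_def F2_def F3_def F4_def
  have "H \<subseteq> S1" using HM by (auto simp: S1_def)
  hence G_eq: "G = F1 \<union> F2 \<union> F3 \<union> F4" by (auto simp: F_defs)
  have fin_F: "finite F1" "finite F2" "finite F3" "finite F4"
    using fin(4) by (simp_all add: F_defs)
  have disj: "F1 \<inter> F2 = {}" "(F1 \<union> F2) \<inter> F3 = {}" "(F1 \<union> F2 \<union> F3) \<inter> F4 = {}"
    using \<open>H \<subseteq> S1\<close> by (auto simp: F_defs)
  have "edge_sum G z = edge_sum (F1 \<union> F2 \<union> F3 \<union> F4) z"
    by (rule arg_cong[OF G_eq])
  also have "\<dots> = edge_sum F1 z + edge_sum F2 z + edge_sum F3 z + edge_sum F4 z"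
    using fin_F disj by (simp only: edge_sum_union finite_Un simp_thms)
  finally have "edge_sum G z = edge_sum F1 z + edge_sum F2 z + edge_sum F3 z + edge_sum F4 z" .
  moreover have "2 * edge_sum F1 z \<le> sqrt \<Delta> * (\<Sum>v\<in>S1. (z v)\<^sup>2) + 2 * sqrt (h * (h + t))"
  proof -
    let ?T = "{u \<in> {..<n} - H. 2 \<le> card {v \<in> H. {u, v} \<in> G}}"
    have "edge_sum F1 z \<le> sqrt \<Delta> / 2 * (\<Sum>v\<in>S1. (z v)\<^sup>2)
        + sqrt (card H * (card H + card ?T)) * (\<Sum>v<n. (z v)\<^sup>2)"
      unfolding F1_def
    proof (rule edge_sum_le_stars[OF G sub(1) \<Delta>(1) _ sub(3) \<open>H \<subseteq> S1\<close> _ refl])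
      show "real (deg G v) \<le> \<Delta>" if "v \<in> H" for v using that sub \<Delta> by auto
      show "u \<in> S1" if "v \<in> H" "{u, v} \<in> G" for u v
        using that G by (auto simp: S1_def N_def vertex_pairs_def)
    qed
    moreover have "card ?T \<le> t" using T by (simp add: H_def shared_neighbours_def)
    hence "real (card H) * (real (card H) + real (card ?T)) \<le> h * (h + t)"
      using h by (intro mult_mono add_mono) auto
    hence "sqrt (card H * (card H + card ?T)) \<le> sqrt (h * (h + t))" by simp
    ultimately show ?thesis unfolding z(1) mult_1_right by linarith
  qed
  moreover have "edge_sum F2 z \<le> (sqrt (K1 * D1) + sqrt b) * (\<Sum>v<n. (z v)\<^sup>2)"
  proof (rule edge_sum_le_degenerate)
    show "F2 \<subseteq> vertex_pairs n" using G by (auto simp: F2_def)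
    show "real (deg F2 v) \<le> D1" if v: "v < n" for v
    proof (cases "v \<in> H")
      case True
      hence no_edge: "{e \<in> F2. v \<in> e} = {}" by (auto simp: F2_def)
      show ?thesis using D unfolding deg_def no_edge by simp
    next
      case False
      have "deg F2 v \<le> deg G v" using fin by (intro deg_mono) (auto simp: F2_def)
      thus ?thesis using False v by (auto simp: H_def high_degree_def)
    qed
    show "real (card F0) \<le> b" if "F0 \<subseteq> F2" "K1 * card (\<Union>F0) \<le> 2 * card F0" for F0
    proof (rule ccontr)
      assume "\<not> real (card F0) \<le> b"
      hence "has_dense_core G (\<sigma>1 * n) K1 b"
        unfolding has_dense_core_def using fin card_S1 that
        by (intro exI[of _ S1] exI[of _ F0]) (auto simp: F2_def)
      with core1 show False by blast
    qed
  qed (use K D in auto)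
  moreover have "edge_sum F3 z \<le> (sqrt (K2 * D0) + sqrt b) * (\<Sum>v<n. (z v)\<^sup>2)"
  proof (rule edge_sum_le_degenerate)
    show "F3 \<subseteq> vertex_pairs n" using G by (auto simp: F3_def)
    show "real (deg F3 v) \<le> D0" if v: "v < n" for v
    proof (cases "v \<in> M")
      case True
      hence no_edge: "{e \<in> F3. v \<in> e} = {}" by (auto simp: F3_def S1_def)
      show ?thesis using D unfolding deg_def no_edge by simp
    next
      case False
      have "deg F3 v \<le> deg G v" using fin by (intro deg_mono) (auto simp: F3_def)
      thus ?thesis using False v by (auto simp: M_def high_degree_def)
    qed
    show "real (card F0) \<le> b" if "F0 \<subseteq> F3" "K2 * card (\<Union>F0) \<le> 2 * card F0" for F0
    proof (rule ccontr)
      assume "\<not> real (card F0) \<le> b"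
      hence "has_dense_core G (\<sigma>2 * n) K2 b"
        unfolding has_dense_core_def using fin card_S2 that
        by (intro exI[of _ S2] exI[of _ F0]) (auto simp: F3_def)
      with core2 show False by blast
    qed
  qed (use K D in auto)
  moreover define y where "y v = (if v < n \<and> v \<notin> S1 \<and> v \<notin> S2 then z v else 0)" for v
  have y: "0 \<le> y v" "y v \<le> B / sqrt n" for v
    using z(2) B by (auto simp: y_def S2_def)
  have "(\<Sum>v\<in>S1. (z v)\<^sup>2) + (\<Sum>v<n. (y v)\<^sup>2) \<le> (\<Sum>v<n. (z v)\<^sup>2)"
  proof -
    have "(\<Sum>v<n. (y v)\<^sup>2) \<le> (\<Sum>v<n. if v \<in> {..<n} - S1 then (z v)\<^sup>2 else 0)"
      by (intro sum_mono) (auto simp: y_def)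
    also have "\<dots> = (\<Sum>v\<in>{..<n} - S1. (z v)\<^sup>2)"
      by (subst sum.inter_restrict[symmetric]) (auto intro: sum.cong)
    finally show ?thesis
      using sum.subset_diff[OF sub(3), of "\<lambda>v. (z v)\<^sup>2"] by simp
  qed
  hence split: "(\<Sum>v\<in>S1. (z v)\<^sup>2) + (\<Sum>v<n. (y v)\<^sup>2) \<le> 1" by (simp add: z)
  have S1_nonneg: "0 \<le> (\<Sum>v\<in>S1. (z v)\<^sup>2)" "0 \<le> (\<Sum>v<n. (y v)\<^sup>2)" by (simp_all add: sum_nonneg)
  have "2 * edge_sum F4 z \<le> d * (\<Sum>v<n. (y v)\<^sup>2) + 8 * \<epsilon> * d"
  proof -
    have "edge_sum F4 z = edge_sum F4 y"
      using G by (intro edge_sum_cong) (auto simp: y_def F4_def vertex_pairs_def)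
    also have "\<dots> \<le> edge_sum G y"
      unfolding edge_sum_def using fin y
      by (intro sum_mono2) (auto simp: F4_def intro: prod_nonneg)
    also have "2 * edge_sum G y \<le> d * (\<Sum>v<n. (y v)\<^sup>2) + 8 * \<epsilon> * d"
    proof -
      have "(\<Sum>v<n. (y v)\<^sup>2) \<le> 1" using split S1_nonneg by linarith
      hence "\<not> d * (\<Sum>v<n. (y v)\<^sup>2) + 8 * \<epsilon> * d \<le> 2 * edge_sum G y" using light y by blast
      thus ?thesis by simp
    qed
    finally show ?thesis by simp
  qed
  \<comment> \<open>The two masses add up to at most 1, so the combination is bounded by the larger
    coefficient.\<close>
  moreover have "sqrt \<Delta> * (\<Sum>v\<in>S1. (z v)\<^sup>2) + d * (\<Sum>v<n. (y v)\<^sup>2) \<le> max (sqrt \<Delta>) d"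
  proof -
    let ?m = "max (sqrt \<Delta>) d"
    have "sqrt \<Delta> * (\<Sum>v\<in>S1. (z v)\<^sup>2) + d * (\<Sum>v<n. (y v)\<^sup>2)
        \<le> ?m * (\<Sum>v\<in>S1. (z v)\<^sup>2) + ?m * (\<Sum>v<n. (y v)\<^sup>2)"
      using S1_nonneg by (intro add_mono mult_right_mono) auto
    also have "\<dots> \<le> ?m * 1"
      unfolding distrib_left[symmetric] using split d by (intro mult_left_mono) auto
    finally show ?thesis by simp
  qed
  ultimately show ?thesis using eig by (simp add: z)
qed

subsection \<open>The sparse regime\<close>

text \<open>The two limits are the working forms of the hypotheses: the first makes the choice of
  boundedly many vertices free on the scale \<open>d^2 ln d\<close>, the second makes every power of
  \<open>d\<close> smaller than \<open>n\<close>.\<close>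

locale sparse_regime =
  fixes p d :: "nat \<Rightarrow> real"
  assumes p: "\<And>n. n \<ge> 1 \<Longrightarrow> 0 < p n \<and> p n < 1"
    and d: "\<And>n. d n = real n * p n"
    and d_at_top: "filterlim d at_top sequentially"
    and ln_n_small: "(\<lambda>n. ln (real n) / ((d n)\<^sup>2 * ln (d n))) \<longlonglongrightarrow> 0"
    and ln_d_small: "(\<lambda>n. ln (d n) / ln (real n)) \<longlonglongrightarrow> 0"
begin

definition speed :: "nat \<Rightarrow> real" where "speed n = (d n)\<^sup>2 * ln (d n)"

text \<open>Demanding every \<open>C\<close> makes such events negligible against any lower bound
  \<open>exp (- C * speed n)\<close>, whatever its constant, and lets finite unions absorb their
  factors.\<close>

definition superexp_small :: "(nat \<Rightarrow> nat set set \<Rightarrow> bool) \<Rightarrow> bool" where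
  "superexp_small P \<longleftrightarrow> (\<forall>C>0. \<forall>\<^sub>F n in sequentially.
     measure_pmf.prob (gnp n (p n)) {G. P n G} \<le> exp (- C * speed n))"

lemma eventually_d: "eventually P at_top \<Longrightarrow> \<forall>\<^sub>F n in sequentially. P (d n)"
  using d_at_top by (simp add: filterlim_iff)

lemma d_large: "\<forall>\<^sub>F n in sequentially. c \<le> d n"
  by (rule eventually_d[OF eventually_ge_at_top])

lemma n_large: "\<forall>\<^sub>F n in sequentially. n \<ge> (N::nat)"
  by (rule eventually_ge_at_top)

lemma ln_n_le_speed: "c > 0 \<Longrightarrow> \<forall>\<^sub>F n in sequentially. c * ln (real n) \<le> speed n"
proof -
  assume c: "c > 0"
  have "\<forall>\<^sub>F n in sequentially. ln (real n) / ((d n)\<^sup>2 * ln (d n)) < 1 / c"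
    using ln_n_small c by (intro order_tendstoD) auto
  thus ?thesis using d_large[of 2]
  proof eventually_elim
    case (elim n)
    have "speed n > 0" using elim by (simp add: speed_def)
    thus ?case using elim c by (simp add: speed_def field_simps)
  qed
qed

lemma ln_d_le_ln_n: "c > 0 \<Longrightarrow> \<forall>\<^sub>F n in sequentially. c * ln (d n) \<le> ln (real n)"
proof -
  assume c: "c > 0"
  have "\<forall>\<^sub>F n in sequentially. ln (d n) / ln (real n) < 1 / c"
    using ln_d_small c by (intro order_tendstoD) auto
  thus ?thesis using n_large[of 2]
  proof eventually_elim
    case (elim n)
    have "ln (real n) > 0" using elim by simp
    thus ?case using elim c by (simp add: field_simps)
  qed
qed

lemma d_power_le_n: "\<forall>\<^sub>F n in sequentially. c * d n ^ k \<le> real n"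
proof -
  \<comment> \<open>One spare power of \<open>d\<close> absorbs the constant
    \<open>c\<close>.\<close>
  have "\<forall>\<^sub>F n in sequentially. real (Suc k) * ln (d n) \<le> ln (real n)"
    by (rule ln_d_le_ln_n) simp
  thus ?thesis using d_large[of "max 1 c"] n_large[of 1]
  proof eventually_elim
    case (elim n)
    have "c * d n ^ k \<le> d n * d n ^ k" using elim by (intro mult_right_mono) auto
    also have "\<dots> = exp (real (Suc k) * ln (d n))"
      using elim by (simp add: exp_of_nat_mult del: of_nat_Suc)
    also have "\<dots> \<le> exp (ln (real n))" using elim(1) by (simp only: exp_le_cancel_iff)
    also have "\<dots> = real n" using elim by simp
    finally show ?case .
  qed
qed

lemma speed_le_n: "\<forall>\<^sub>F n in sequentially. c * speed n \<le> real n"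
  using d_power_le_n[of "\<bar>c\<bar>" 3] d_large[of 1]
proof eventually_elim
  case (elim n)
  have "c * speed n \<le> \<bar>c\<bar> * speed n" using elim by (intro mult_right_mono) (auto simp: speed_def)
  also have "\<dots> \<le> \<bar>c\<bar> * ((d n)\<^sup>2 * d n)"
    unfolding speed_def using elim ln_le_minus_one[of "d n"] by (intro mult_left_mono) auto
  also have "\<dots> = \<bar>c\<bar> * d n ^ 3" by (simp add: power3_eq_cube power2_eq_square)
  finally show ?case using elim by linarith
qed

lemma speed_at_top: "filterlim speed at_top sequentially"
proof -
  have "filterlim (\<lambda>x::real. x\<^sup>2 * ln x) at_top at_top" by real_asymp
  from filterlim_compose[OF this d_at_top] show ?thesis by (simp add: speed_def[abs_def])
qed

lemma speed_large: "\<forall>\<^sub>F n in sequentially. c \<le> speed n"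
  using speed_at_top by (simp add: filterlim_at_top)

lemma p_bounds: "n \<ge> 1 \<Longrightarrow> 0 \<le> p n" "n \<ge> 1 \<Longrightarrow> p n \<le> 1"
  using p[of n] by auto

lemma superexp_small_disj:
  assumes "superexp_small P" "superexp_small Q"
  shows "superexp_small (\<lambda>n G. P n G \<or> Q n G)"
  unfolding superexp_small_def
proof (intro allI impI)
  fix C :: real assume C: "C > 0"
  \<comment> \<open>Passing to \<open>C + 1\<close> leaves a factor \<open>exp (speed n)\<close>, at
    least 2, for the two events.\<close>
  have "\<forall>\<^sub>F n in sequentially. measure_pmf.prob (gnp n (p n)) {G. P n G} \<le> exp (- (C + 1) * speed n)"
    "\<forall>\<^sub>F n in sequentially. measure_pmf.prob (gnp n (p n)) {G. Q n G} \<le> exp (- (C + 1) * speed n)"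
    by (rule assms[unfolded superexp_small_def, rule_format]; use C in simp)+
  thus "\<forall>\<^sub>F n in sequentially. measure_pmf.prob (gnp n (p n)) {G. P n G \<or> Q n G} \<le> exp (- C * speed n)"
    using speed_large[of 1]
  proof eventually_elim
    case (elim n)
    have "{G. P n G \<or> Q n G} = {G. P n G} \<union> {G. Q n G}" by auto
    hence "measure_pmf.prob (gnp n (p n)) {G. P n G \<or> Q n G} \<le>
        measure_pmf.prob (gnp n (p n)) {G. P n G} + measure_pmf.prob (gnp n (p n)) {G. Q n G}"
      by (simp add: measure_Un_le)
    also have "\<dots> \<le> 2 * exp (- (C + 1) * speed n)" using elim by simp
    also have "\<dots> \<le> exp (speed n) * exp (- (C + 1) * speed n)"
    proof (rule mult_right_mono)
      show "2 \<le> exp (speed n)" using elim(3) exp_ge_add_one_self[of "speed n"] by linarith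
    qed simp
    also have "\<dots> = exp (- C * speed n)" by (simp add: exp_add[symmetric] algebra_simps)
    finally show ?case .
  qed
qed

section \<open>Superexponentially unlikely structures\<close>

text \<open>This event is tied to one \<open>C\<close>: a bounded number of huge degrees has
  probability \<open>exp (- c L)\<close> for some finite \<open>c\<close>, so the admissible number
  \<open>h\<close> must grow with \<open>C\<close>.\<close>

lemma prob_many_huge_degrees:
  assumes \<eta>: "\<eta> > 0" and C: "C > 0"
  obtains h :: nat where "h \<ge> 1" "\<forall>\<^sub>F n in sequentially. measure_pmf.prob (gnp n (p n))
      {G. h \<le> card (high_degree n (\<eta> * (d n)\<^sup>2) G)} \<le> exp (- C * speed n)"
proof -
  \<comment> \<open>The edges give the exponent h \<eta> L / 4, choosing the vertices uses at most
    half of it, and the remaining h \<eta> L / 8 has to reach C L.\<close>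
  define h where "h = nat \<lceil>8 * C / \<eta>\<rceil> + 1"
  have h: "h \<ge> 1" "real h * \<eta> \<ge> 8 * C"
  proof -
    have "8 * C / \<eta> \<le> real h" unfolding h_def by linarith
    thus "real h * \<eta> \<ge> 8 * C" using \<eta> by (simp add: field_simps)
  qed (simp add: h_def)
  have e1: "\<forall>\<^sub>F x in at_top. 2 * exp 1 * x \<le> \<eta> * x\<^sup>2" "\<forall>\<^sub>F x in at_top. ln (2 * exp 1 / \<eta>) \<le> ln x / 2"
    using \<eta> by real_asymp+
  have e2: "\<forall>\<^sub>F n in sequentially. (16 / \<eta>) * ln (real n) \<le> speed n"
    using \<eta> by (intro ln_n_le_speed) auto
  have "\<forall>\<^sub>F n in sequentially. measure_pmf.prob (gnp n (p n))
      {G. h \<le> card (high_degree n (\<eta> * (d n)\<^sup>2) G)} \<le> exp (- C * speed n)"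
    using eventually_d[OF e1(1)] eventually_d[OF e1(2)] e2 d_large[of 2] n_large[of 3]
  proof eventually_elim
    case (elim n)
    let ?D = "\<eta> * (d n)\<^sup>2" and ?q = "2 * exp 1 * (n * p n) / (\<eta> * (d n)\<^sup>2)"
    have n: "n \<ge> 1" "real n \<ge> 3" and d0: "d n > 0" using elim by auto
    have q: "?q > 0" "ln ?q = ln (2 * exp 1 / \<eta>) - ln (d n)"
    proof -
      have q_eq: "?q = (2 * exp 1 / \<eta>) / d n"
        using d0 \<eta> by (simp add: d[symmetric] power2_eq_square)
      show "?q > 0" unfolding q_eq using d0 \<eta> by simp
      show "ln ?q = ln (2 * exp 1 / \<eta>) - ln (d n)"
        unfolding q_eq using d0 \<eta> by (subst ln_div) auto
    qed
    have "exp (1::real) \<le> real n" using exp_le n by linarith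
    hence ln_n: "1 \<le> ln (real n)" using n by (subst ln_ge_iff) auto
    have "measure_pmf.prob (gnp n (p n)) {G. h \<le> card (high_degree n ?D G)}
        \<le> (exp 1 * n / h) ^ h * ?q powr (h * ?D / 2)"
      using elim \<eta> d0 by (intro gnp_prob_many_high_degrees p_bounds n h) (auto simp: d[symmetric])
    also have "(exp 1 * n / h) ^ h \<le> (exp 1 * n / 1) ^ h"
      using h by (intro power_mono divide_left_mono) auto
    also have "(exp 1 * real n / 1) ^ h = exp (h * (1 + ln n))"
      using n by (simp add: exp_of_nat_mult exp_add)
    also have "?q powr (h * ?D / 2) = exp (h * ?D / 2 * ln ?q)"
      unfolding powr_def[of ?q] by (rule if_not_P) (use q in linarith)
    also have "exp (h * (1 + ln n)) * \<dots> = exp (h * (1 + ln n) + h * ?D / 2 * ln ?q)"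
      by (simp add: exp_add)
    also have "\<dots> \<le> exp (- C * speed n)"
    proof -
      have "ln ?q \<le> - ln (d n) / 2" unfolding q(2) using elim by linarith
      hence "h * ?D / 2 * ln ?q \<le> h * ?D / 2 * (- ln (d n) / 2)"
        using \<eta> by (intro mult_left_mono) auto
      also have "\<dots> = - (h * \<eta> * speed n) / 4" by (simp add: speed_def)
      finally have 1: "h * ?D / 2 * ln ?q \<le> - (h * \<eta> * speed n) / 4" .
      have "1 + ln n \<le> \<eta> * speed n / 8"
        using ln_n elim(3) \<eta> by (simp add: field_simps)
      hence "h * (1 + ln n) \<le> h * (\<eta> * speed n / 8)" by (intro mult_left_mono) auto
      hence 2: "h * (1 + ln n) \<le> h * \<eta> * speed n / 8" by simp
      have "8 * C * speed n \<le> h * \<eta> * speed n"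
        using h elim by (intro mult_right_mono) (auto simp: speed_def)
      hence "h * (1 + ln n) + h * ?D / 2 * ln ?q \<le> - C * speed n"
      proof -
        have "a + b \<le> - C * speed n" if "8 * C * speed n \<le> x" "b \<le> - x / 4" "a \<le> x / 8" for a b x
          using that by linarith
        thus ?thesis using \<open>8 * C * speed n \<le> h * \<eta> * speed n\<close> 1 2 by blast
      qed
      thus ?thesis by (simp only: exp_le_cancel_iff)
    qed
    finally show ?case by (simp add: mult_right_mono)
  qed
  with h that show ?thesis by blast
qed

text \<open>Degree \<open>d^(9/8)\<close> costs a vertex an exponent of order
  \<open>d^(9/8) ln d\<close>, far above the entropy \<open>ln (d^2)\<close> of choosing it with
  density 1 / d^2. So the probability is at most \<open>exp (- r)\<close>, with r about n / d^2 and
  hence far above the speed.\<close>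

lemma superexp_small_many_large_degrees:
  "superexp_small (\<lambda>n G. n / (2 * (d n)\<^sup>2) < card (high_degree n (d n powr (9/8)) G))"
  unfolding superexp_small_def
proof (intro allI impI)
  fix C :: real assume C: "C > 0"
  have e: "\<forall>\<^sub>F x::real in at_top. 2 * exp 1 * x \<le> x powr (9/8)"
    "\<forall>\<^sub>F x::real in at_top. ln (4 * exp 1 * x\<^sup>2) + x powr (9/8) / 2 * ln (2 * exp 1 * x / x powr (9/8)) \<le> -1"
    by real_asymp+
  show "\<forall>\<^sub>F n in sequentially. measure_pmf.prob (gnp n (p n))
      {G. n / (2 * (d n)\<^sup>2) < card (high_degree n (d n powr (9/8)) G)} \<le> exp (- C * speed n)"
    using eventually_d[OF e(1)] eventually_d[OF e(2)] d_power_le_n[of "4 * C" 5] d_power_le_n[of 4 2]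
      d_large[of 2] n_large[of 1]
  proof eventually_elim
    case (elim n)
    define r where "r = nat \<lceil>n / (2 * (d n)\<^sup>2)\<rceil>"
    let ?D = "d n powr (9/8)" and ?q = "2 * exp 1 * d n / d n powr (9/8)"
    have d0: "d n > 0" using elim by simp
    have "n / (2 * (d n)\<^sup>2) \<ge> 2" using elim d0 by (simp add: field_simps)
    hence r: "r \<ge> 1" "r \<ge> n / (2 * (d n)\<^sup>2)" unfolding r_def by linarith+
    have q: "?q > 0" using d0 by simp
    have "measure_pmf.prob (gnp n (p n)) {G. n / (2 * (d n)\<^sup>2) < card (high_degree n ?D G)}
        \<le> measure_pmf.prob (gnp n (p n)) {G. r \<le> card (high_degree n ?D G)}"
      unfolding r_def by (intro gnp_prob_mono) linarith
    also have "\<dots> \<le> (exp 1 * n / r) ^ r * ?q powr (r * ?D / 2)"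
      unfolding d[of n] by (rule gnp_prob_many_high_degrees)
        (use elim r p_bounds[of n] d0 in \<open>auto simp flip: d\<close>)
    also have "exp 1 * n / r \<le> 4 * exp 1 * (d n)\<^sup>2"
    proof -
      have "n \<le> 2 * (d n)\<^sup>2 * r" using r d0 by (simp add: field_simps)
      also have "\<dots> \<le> 4 * (d n)\<^sup>2 * r" by simp
      finally show ?thesis using r by (simp add: field_simps)
    qed
    hence "(exp 1 * n / r) ^ r \<le> (4 * exp 1 * (d n)\<^sup>2) ^ r" by (intro power_mono) auto
    also have "(4 * exp 1 * (d n)\<^sup>2) ^ r = exp (r * ln (4 * exp 1 * (d n)\<^sup>2))"
      using d0 by (simp add: exp_of_nat_mult)
    also have "?q powr (r * ?D / 2) = exp (r * ?D / 2 * ln ?q)"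
      unfolding powr_def[of ?q] by (rule if_not_P) (use q in linarith)
    also have "exp (r * ln (4 * exp 1 * (d n)\<^sup>2)) * \<dots> =
        exp (r * (ln (4 * exp 1 * (d n)\<^sup>2) + ?D / 2 * ln ?q))"
      by (simp add: exp_add distrib_left)
    also have "\<dots> \<le> exp (real r * (-1))"
      using elim(2) by (subst exp_le_cancel_iff, intro mult_left_mono) auto
    also have "\<dots> \<le> exp (- C * speed n)"
    proof -
      have "C * speed n \<le> C * d n ^ 3"
        unfolding speed_def power3_eq_cube power2_eq_square using C d0 ln_le_minus_one[of "d n"]
        by (intro mult_left_mono) auto
      also have "\<dots> \<le> n / (2 * (d n)\<^sup>2)"
      proof -
        have "C * d n ^ 3 * (2 * (d n)\<^sup>2) = 2 * C * d n ^ 5" by (simp add: eval_nat_numeral)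
        also have "\<dots> \<le> n" using elim(3) C d0 by (simp add: mult_nonneg_nonneg)
        finally show ?thesis using d0 by (simp add: field_simps)
      qed
      finally show ?thesis using r by simp
    qed
    finally show ?case by (simp add: mult_right_mono)
  qed
qed

text \<open>Each shared neighbour costs nearly a factor \<open>n\<close>, so \<beta> d^2 of them
  cost an exponent of order \<open>d^2 ln n\<close>, which dominates
  \<open>d^2 ln d\<close>.\<close>

lemma superexp_small_shared_neighbours:
  assumes h: "h \<ge> 1" and \<beta>: "\<beta> > 0"
  shows "superexp_small (\<lambda>n G. \<exists>H\<subseteq>{..<n}. card H \<le> h \<and>
      \<beta> * (d n)\<^sup>2 \<le> card (shared_neighbours n H G))"
  unfolding superexp_small_def
proof (intro allI impI)
  fix C :: real assume C: "C > 0"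
  have e: "\<forall>\<^sub>F x in at_top. 2 * real h * x \<le> x\<^sup>2" "\<forall>\<^sub>F x in at_top. 4 * real h \<le> \<beta> * x\<^sup>2"
      "\<forall>\<^sub>F x in at_top. 4 \<le> \<beta> * x\<^sup>2"
    using \<beta> by real_asymp+
  have e2: "\<forall>\<^sub>F n in sequentially. (16 + 4 * C / \<beta>) * ln (d n) \<le> ln (real n)"
    using \<beta> C by (intro ln_d_le_ln_n add_pos_pos) auto
  show "\<forall>\<^sub>F n in sequentially. measure_pmf.prob (gnp n (p n)) {G. \<exists>H\<subseteq>{..<n}. card H \<le> h \<and>
      \<beta> * (d n)\<^sup>2 \<le> card (shared_neighbours n H G)} \<le> exp (- C * speed n)"
    using eventually_d[OF e(1)] eventually_d[OF e(2)] eventually_d[OF e(3)] e2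
      d_large[of 2] n_large[of "h + 1"]
  proof eventually_elim
    case (elim n)
    define t where "t = nat \<lceil>\<beta> * (d n)\<^sup>2\<rceil>"
    have d0: "d n > 0" and n: "n \<ge> 1" using elim by auto
    have t: "real t \<ge> \<beta> * (d n)\<^sup>2" "t \<ge> 1" "real t \<ge> 4 * h" "real t \<ge> 4"
      using elim(2,3) unfolding t_def by linarith+
    have lnd: "ln (d n) \<ge> 0" "16 * ln (d n) \<le> ln n" "4 * C / \<beta> * ln (d n) \<le> ln n"
    proof -
      show "ln (d n) \<ge> 0" using elim by simp
      moreover from this have "4 * C / \<beta> * ln (d n) \<ge> 0" using C \<beta> by simp
      ultimately show "16 * ln (d n) \<le> ln n" "4 * C / \<beta> * ln (d n) \<le> ln n"
        using elim(4) by (simp_all only: distrib_right)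
    qed
    have "measure_pmf.prob (gnp n (p n)) {G. \<exists>H\<subseteq>{..<n}. card H \<le> h \<and>
        \<beta> * (d n)\<^sup>2 \<le> card (shared_neighbours n H G)} \<le>
      measure_pmf.prob (gnp n (p n)) {G. \<exists>H\<subseteq>{..<n}. card H \<le> h \<and> t \<le> card (shared_neighbours n H G)}"
    proof (rule gnp_prob_mono)
      fix G assume "\<exists>H\<subseteq>{..<n}. card H \<le> h \<and> \<beta> * (d n)\<^sup>2 \<le> card (shared_neighbours n H G)"
      then obtain H where "H \<subseteq> {..<n}" "card H \<le> h" "\<beta> * (d n)\<^sup>2 \<le> card (shared_neighbours n H G)"
        by blast
      moreover from this(3) have "t \<le> card (shared_neighbours n H G)" unfolding t_def by linarith
      ultimately show "\<exists>H\<subseteq>{..<n}. card H \<le> h \<and> t \<le> card (shared_neighbours n H G)" by blast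
    qed
    also have "\<dots> \<le> (real h + 1) * real n ^ (h + t) * (2 * real h * p n) ^ (2 * t)"
      by (rule gnp_prob_many_common_neighbours[OF p_bounds[OF n] n t(2)])
    also have "\<dots> \<le> real n * real n ^ (h + t) * ((d n)\<^sup>2 / n) ^ (2 * t)"
    proof (intro mult_mono power_mono)
      have "2 * real h * p n = 2 * real h * d n / n" using n by (simp add: d)
      also have "\<dots> \<le> (d n)\<^sup>2 / n" using elim(1) by (intro divide_right_mono) auto
      finally show "2 * real h * p n \<le> (d n)\<^sup>2 / n" .
    qed (use elim(6) n p_bounds[of n] in auto)
    also have "\<dots> = exp (ln n + (real h + t) * ln n + 2 * t * (2 * ln (d n) - ln n))"
    proof -
      have "real n = exp (ln n)" using n by simp
      moreover have "real n ^ (h + t) = exp ((real h + t) * ln n)"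
        using n exp_of_nat_mult[of "h + t" "ln n"] by simp
      moreover have "((d n)\<^sup>2 / n) ^ (2 * t) = exp (2 * t * (2 * ln (d n) - ln n))"
      proof -
        have "(d n)\<^sup>2 / n = exp (2 * ln (d n) - ln n)"
          using d0 n by (simp add: exp_diff exp_double)
        thus ?thesis using exp_of_nat_mult[of "2 * t" "2 * ln (d n) - ln n"] by simp
      qed
      ultimately show ?thesis by (simp add: exp_add)
    qed
    \<comment> \<open>Of the gain t ln n, a quarter each pays for the factor \<open>n\<close>, for
      \<open>n ^ h\<close>, and for the powers of \<open>d\<close>; one quarter remains.\<close>
    also have "\<dots> \<le> exp (- (t / 4) * ln n)"
    proof -
      have lnn: "ln n \<ge> 0" using n by simp
      have "4 * ln n \<le> t * ln n" "4 * h * ln n \<le> t * ln n" using t lnn by (intro mult_right_mono; simp)+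
      moreover have "t * (16 * ln (d n)) \<le> t * ln n" using lnd by (intro mult_left_mono) auto
      ultimately show ?thesis by (simp add: algebra_simps)
    qed
    also have "\<dots> \<le> exp (- C * speed n)"
    proof -
      have "C * speed n = \<beta> * (d n)\<^sup>2 / 4 * (4 * C / \<beta> * ln (d n))"
        using \<beta> by (simp add: speed_def)
      also have "\<dots> \<le> t / 4 * ln n"
        using t lnd \<beta> C by (intro mult_mono divide_right_mono) auto
      finally show ?thesis by simp
    qed
    finally show ?case .
  qed
qed

text \<open>Both terms of the first-moment bound are negligible: \<beta> d^2 edges at price a power
  of \<open>n\<close> exceed the speed since \<open>ln d\<close> is small against
  \<open>ln n\<close>, and the speed is at most \<open>d^3\<close>, hence below any multiple of
  \<open>sqrt n\<close>.\<close>

lemma superexp_small_dense_core: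
  assumes \<beta>: "\<beta> > 0"
    and \<sigma>K: "\<forall>\<^sub>F n in sequentially. \<sigma> n \<ge> 0 \<and> K n \<ge> 16 \<and> 15 * d n * sqrt (\<sigma> n) \<le> K n"
  shows "superexp_small (\<lambda>n G. has_dense_core G (\<sigma> n * n) (K n) (\<beta> * (d n)\<^sup>2))"
  unfolding superexp_small_def
proof (intro allI impI)
  fix C :: real assume C: "C > 0"
  \<comment> \<open>This makes the factor \<open>n ^ 3\<close> cost at most half of the exponent
    \<beta> d^2 ln n / 8.\<close>
  have e: "\<forall>\<^sub>F x in at_top. 48 \<le> \<beta> * x\<^sup>2" using \<beta> by real_asymp
  have e2: "\<forall>\<^sub>F n in sequentially. (16 * (C + 1) / \<beta>) * ln (d n) \<le> ln (real n)"
    using \<beta> C by (intro ln_d_le_ln_n) auto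
  have e3: "\<forall>\<^sub>F x::real in at_top. 3 * ln x \<le> 3 * sqrt x" by real_asymp
  have e3': "\<forall>\<^sub>F n in sequentially. 3 * ln (real n) \<le> 3 * sqrt (real n)"
    by (rule eventually_compose_filterlim[OF e3 filterlim_real_sequentially])
  show "\<forall>\<^sub>F n in sequentially. measure_pmf.prob (gnp n (p n))
      {G. has_dense_core G (\<sigma> n * n) (K n) (\<beta> * (d n)\<^sup>2)} \<le> exp (- C * speed n)"
    using \<sigma>K eventually_d[OF e] e2 e3' d_power_le_n[of "(C + 1)\<^sup>2" 6] speed_large[of 1]
      d_large[of 2] n_large[of 1]
  proof eventually_elim
    case (elim n)
    have d0: "d n > 0" and n: "n \<ge> 1" using elim by auto
    have "measure_pmf.prob (gnp n (p n)) {G. has_dense_core G (\<sigma> n * n) (K n) (\<beta> * (d n)\<^sup>2)}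
        \<le> real n ^ 3 * (real n powr (- (\<beta> * (d n)\<^sup>2) / 8) + exp (- 4 * sqrt n))"
      using elim \<beta> d0 by (intro gnp_prob_dense_core p_bounds n) (auto simp: d[symmetric])
    also have "\<dots> = exp (3 * ln n - \<beta> * (d n)\<^sup>2 / 8 * ln n) + exp (3 * ln n - 4 * sqrt n)"
    proof -
      have cube: "real n ^ 3 = exp (3 * ln n)" using n exp_of_nat_mult[of 3 "ln n"] by simp
      have powr: "real n powr (- (\<beta> * (d n)\<^sup>2) / 8) = exp (- (\<beta> * (d n)\<^sup>2 / 8 * ln n))"
        using n by (simp add: powr_def)
      show ?thesis unfolding cube powr by (simp add: distrib_left flip: exp_add)
    qed
    also have "exp (3 * ln n - \<beta> * (d n)\<^sup>2 / 8 * ln n) \<le> exp (- (C + 1) * speed n)"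
    proof -
      have "48 * ln n \<le> \<beta> * (d n)\<^sup>2 * ln n" using elim n by (intro mult_right_mono) auto
      moreover have "(C + 1) * speed n = \<beta> * (d n)\<^sup>2 / 16 * (16 * (C + 1) / \<beta> * ln (d n))"
        using \<beta> by (simp add: speed_def)
      moreover have "\<dots> \<le> \<beta> * (d n)\<^sup>2 / 16 * ln n"
        using elim(3) \<beta> by (intro mult_left_mono) auto
      ultimately have "3 * ln n - \<beta> * (d n)\<^sup>2 / 8 * ln n \<le> - ((C + 1) * speed n)" by simp
      thus ?thesis by (simp only: mult_minus_left exp_le_cancel_iff)
    qed
    also have "exp (3 * ln n - 4 * sqrt n) \<le> exp (- (C + 1) * speed n)"
    proof -
      have "speed n \<le> d n ^ 3"
        unfolding speed_def power3_eq_cube power2_eq_square using d0 ln_le_minus_one[of "d n"]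
        by (intro mult_left_mono) auto
      hence "(C + 1) * speed n \<le> (C + 1) * d n ^ 3" using C by (intro mult_left_mono) auto
      also have "\<dots> = sqrt (((C + 1) * d n ^ 3)\<^sup>2)" using C d0 by simp
      also have "\<dots> \<le> sqrt n"
        using elim(5) by (intro real_sqrt_le_mono) (simp add: power_mult_distrib flip: power_mult)
      finally have "3 * ln n - 4 * sqrt n \<le> - ((C + 1) * speed n)" using elim(4) by linarith
      thus ?thesis by (simp only: mult_minus_left exp_le_cancel_iff)
    qed
    also have "exp (- (C + 1) * speed n) + exp (- (C + 1) * speed n) \<le> exp (- C * speed n)"
    proof -
      have "2 \<le> exp (speed n)"
        using elim(6) exp_ge_add_one_self[of "speed n"] by linarith
      hence "2 * exp (- (C + 1) * speed n) \<le> exp (speed n) * exp (- (C + 1) * speed n)"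
        by (rule mult_right_mono) simp
      also have "\<dots> = exp (- C * speed n)" by (simp add: exp_add[symmetric] algebra_simps)
      finally show ?thesis by simp
    qed
    finally show ?case by simp
  qed
qed

text \<open>With \<open>B = d^(1/4)\<close> the Chernoff exponent is \<epsilon>^2 n d^(1/2) / 8,
  against net entropy of order \<open>n ln d\<close>. The result is at most
  \<open>exp (- n)\<close>, and \<open>n\<close> exceeds every multiple of the speed.\<close>

lemma superexp_small_delocalized:
  assumes \<epsilon>: "0 < \<epsilon>" "\<epsilon> \<le> 1"
  shows "superexp_small (\<lambda>n G. \<exists>y. (\<forall>v. 0 \<le> y v \<and> y v \<le> d n powr (1/4) / sqrt n) \<and>
      (\<Sum>v<n. (y v)\<^sup>2) \<le> 1 \<and> d n * (\<Sum>v<n. (y v)\<^sup>2) + 8 * \<epsilon> * d n \<le> 2 * edge_sum G y)"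
  unfolding superexp_small_def
proof (intro allI impI)
  fix C :: real assume C: "C > 0"
  have e: "\<forall>\<^sub>F x in at_top. ln (x powr (1/4) / \<epsilon> + 2) - \<epsilon>\<^sup>2 * x / (8 * (x powr (1/4))\<^sup>2) \<le> -1"
    using \<epsilon> by real_asymp
  show "\<forall>\<^sub>F n in sequentially. measure_pmf.prob (gnp n (p n))
      {G. \<exists>y. (\<forall>v. 0 \<le> y v \<and> y v \<le> d n powr (1/4) / sqrt n) \<and>
      (\<Sum>v<n. (y v)\<^sup>2) \<le> 1 \<and> d n * (\<Sum>v<n. (y v)\<^sup>2) + 8 * \<epsilon> * d n \<le> 2 * edge_sum G y}
      \<le> exp (- C * speed n)"
    using eventually_d[OF e] speed_le_n[of C] d_large[of 1] n_large[of 1]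
  proof eventually_elim
    case (elim n)
    let ?B = "d n powr (1/4)"
    have n: "n \<ge> 1" and B: "?B \<ge> 1" using elim by (auto intro: ge_one_powr_ge_zero)
    have "measure_pmf.prob (gnp n (p n))
      {G. \<exists>y. (\<forall>v. 0 \<le> y v \<and> y v \<le> ?B / sqrt n) \<and>
      (\<Sum>v<n. (y v)\<^sup>2) \<le> 1 \<and> d n * (\<Sum>v<n. (y v)\<^sup>2) + 8 * \<epsilon> * d n \<le> 2 * edge_sum G y}
      \<le> (?B / \<epsilon> + 2) ^ n * exp (- \<epsilon>\<^sup>2 * d n * n / (8 * ?B\<^sup>2))"
      using gnp_prob_delocalized_quadratic_form[OF p_bounds[OF n] n \<epsilon> B] unfolding d[symmetric] .
    also have "(?B / \<epsilon> + 2) ^ n = exp (n * ln (?B / \<epsilon> + 2))"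
    proof -
      have "?B / \<epsilon> + 2 > 0" using B \<epsilon> by (intro add_pos_pos divide_pos_pos) auto
      thus ?thesis by (simp add: exp_of_nat_mult)
    qed
    also have "exp (n * ln (?B / \<epsilon> + 2)) * exp (- \<epsilon>\<^sup>2 * d n * n / (8 * ?B\<^sup>2)) =
        exp (n * (ln (?B / \<epsilon> + 2) - \<epsilon>\<^sup>2 * d n / (8 * ?B\<^sup>2)))"
      by (simp add: exp_add[symmetric] algebra_simps)
    also have "\<dots> \<le> exp (real n * (-1))"
      using elim(1) by (subst exp_le_cancel_iff, intro mult_left_mono) auto
    also have "\<dots> \<le> exp (- C * speed n)" using elim(2) by simp
    finally show ?case .
  qed
qed

text \<open>The parameters are fixed in the order \<gamma>, \<eta>, \<open>h\<close>, \<beta>. Here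
  \<open>h\<close> depends on \<open>C\<close>, and \<beta> on \<open>h\<close>; this is legitimate
  because the remaining events are superexponentially small for each fixed \<beta>.\<close>

lemma superexp_small_eigenvalue_without_star:
  assumes \<delta>: "\<delta> > 0" and chi: "0 < chi" "chi < 1"
  shows "superexp_small (\<lambda>n G. (1 + \<delta>) * d n \<le> max_eigenvalue n G \<and>
    real (max_degree n G) < (1 + \<delta>)\<^sup>2 * (1 - chi) * (d n)\<^sup>2)"
  unfolding superexp_small_def
proof (intro allI impI)
  fix C :: real assume C: "C > 0"
  hence C1: "C + 1 > 0" by simp
  define s where "s = sqrt (1 - chi) * (1 + \<delta>)"
  \<comment> \<open>The room between the demanded eigenvalue and the main term max (sqrt \<Delta>)
    d, in units of \<open>d\<close>. The error terms below use at most 27/32 of it.\<close>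
  define \<gamma> where "\<gamma> = (1 + \<delta>) - max s 1"
  have "sqrt (1 - chi) < 1" "sqrt (1 - chi) > 0" using chi by auto
  hence s: "s > 0" "s < 1 + \<delta>" "s\<^sup>2 = (1 + \<delta>)\<^sup>2 * (1 - chi)"
    using \<delta> chi by (auto simp: s_def power_mult_distrib)
  have \<gamma>: "\<gamma> > 0" using s \<delta> by (simp add: \<gamma>_def)
  define \<epsilon> where "\<epsilon> = min 1 (\<gamma> / 64)"
  define \<eta> where "\<eta> = (\<gamma> / 64)\<^sup>2"
  have \<epsilon>: "0 < \<epsilon>" "\<epsilon> \<le> 1" "8 * \<epsilon> \<le> \<gamma> / 8" using \<gamma> by (auto simp: \<epsilon>_def)
  have \<eta>: "\<eta> > 0" "sqrt \<eta> = \<gamma> / 64" using \<gamma> by (auto simp: \<eta>_def)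
  obtain h :: nat where h: "h \<ge> 1" and huge: "\<forall>\<^sub>F n in sequentially. measure_pmf.prob (gnp n (p n))
      {G. h \<le> card (high_degree n (\<eta> * (d n)\<^sup>2) G)} \<le> exp (- (C + 1) * speed n)"
    by (rule prob_many_huge_degrees[OF \<eta>(1) C1])
  \<comment> \<open>Dividing by \<open>h\<close> keeps sqrt (h \<beta>) small as well, which is what
    the up to h \<beta> d^2 edges between huge and shared vertices require.\<close>
  define \<beta> where "\<beta> = (\<gamma> / 64)\<^sup>2 / h"
  have \<beta>: "\<beta> > 0" "sqrt (h * \<beta>) = \<gamma> / 64" "sqrt \<beta> \<le> \<gamma> / 64"
  proof -
    show \<beta>: "\<beta> > 0" "sqrt (h * \<beta>) = \<gamma> / 64" using \<gamma> h by (auto simp: \<beta>_def)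
    have "sqrt \<beta> \<le> sqrt (h * \<beta>)" using h \<beta>(1) by simp
    also have "\<dots> = \<gamma> / 64" by (rule \<beta>(2))
    finally show "sqrt \<beta> \<le> \<gamma> / 64" .
  qed
  define many where "many n G \<longleftrightarrow> n / (2 * (d n)\<^sup>2) < card (high_degree n (d n powr (9/8)) G)" for n G
  define shared where "shared n G \<longleftrightarrow> (\<exists>H\<subseteq>{..<n}. card H \<le> h \<and>
      \<beta> * (d n)\<^sup>2 \<le> card (shared_neighbours n H G))" for n G
  \<comment> \<open>Both cores obey K \<ge> 15 d sqrt \<sigma>: density 1 / d^2 asks for 15, rounded
    to the minimum 16, and density B^(-2) = d^(-1/2) asks for 15 d^(3/4).\<close>
  define core1 where "core1 n G \<longleftrightarrow> has_dense_core G (1 / (d n)\<^sup>2 * n) 16 (\<beta> * (d n)\<^sup>2)" for n G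
  define core2 where "core2 n G \<longleftrightarrow>
      has_dense_core G (d n powr (-1/2) * n) (15 * d n powr (3/4)) (\<beta> * (d n)\<^sup>2)" for n G
  define heavy where "heavy n G \<longleftrightarrow> (\<exists>y. (\<forall>v. 0 \<le> y v \<and> y v \<le> d n powr (1/4) / sqrt n) \<and>
      (\<Sum>v<n. (y v)\<^sup>2) \<le> 1 \<and> d n * (\<Sum>v<n. (y v)\<^sup>2) + 8 * \<epsilon> * d n \<le> 2 * edge_sum G y)" for n G
  have "superexp_small core1"
    unfolding core1_def[abs_def]
  proof (rule superexp_small_dense_core[OF \<beta>(1)])
    show "\<forall>\<^sub>F n in sequentially. 0 \<le> 1 / (d n)\<^sup>2 \<and> (16::real) \<le> 16 \<and> 15 * d n * sqrt (1 / (d n)\<^sup>2) \<le> 16"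
      using d_large[of 1] by eventually_elim (simp add: real_sqrt_divide)
  qed
  moreover have "superexp_small core2"
    unfolding core2_def[abs_def]
  proof (rule superexp_small_dense_core[OF \<beta>(1)])
    have e: "\<forall>\<^sub>F x::real in at_top. 0 \<le> x powr (-1/2) \<and> 16 \<le> 15 * x powr (3/4) \<and>
        15 * x * sqrt (x powr (-1/2)) \<le> 15 * x powr (3/4)"
    proof -
      have "\<forall>\<^sub>F x::real in at_top. 16 \<le> 15 * x powr (3/4)" by real_asymp
      thus ?thesis using eventually_gt_at_top[of 0]
      proof eventually_elim
        case (elim x)
        have "x * sqrt (x powr (-1/2)) = x powr 1 * x powr (-1/4)"
          using elim by (simp add: powr_half_sqrt[symmetric] powr_powr)
        also have "\<dots> = x powr (3/4)" by (simp only: powr_add[symmetric]) simp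
        finally show ?case using elim by simp
      qed
    qed
    show "\<forall>\<^sub>F n in sequentially. 0 \<le> d n powr (-1/2) \<and> 16 \<le> 15 * d n powr (3/4) \<and>
        15 * d n * sqrt (d n powr (-1/2)) \<le> 15 * d n powr (3/4)"
      by (rule eventually_d[OF e])
  qed
  moreover have "superexp_small many"
    unfolding many_def[abs_def] by (rule superexp_small_many_large_degrees)
  moreover have "superexp_small shared"
    unfolding shared_def[abs_def] by (rule superexp_small_shared_neighbours[OF h \<beta>(1)])
  moreover have "superexp_small heavy"
    unfolding heavy_def[abs_def] by (rule superexp_small_delocalized[OF \<epsilon>(1,2)])
  ultimately have "superexp_small (\<lambda>n G. core1 n G \<or> core2 n G \<or> many n G \<or> shared n G \<or> heavy n G)"
    by (intro superexp_small_disj)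
  from this[unfolded superexp_small_def, rule_format, OF C1] have rest: "\<forall>\<^sub>F n in sequentially. measure_pmf.prob (gnp n (p n))
      {G. core1 n G \<or> core2 n G \<or> many n G \<or> shared n G \<or> heavy n G} \<le> exp (- (C + 1) * speed n)"
    .
  \<comment> \<open>The exponents 3/4 and 9/8 add up to 15/8, less than 2, so the square root is of
    order \<open>d^(15/16)\<close>.\<close>
  have e: "\<forall>\<^sub>F x in at_top. x powr (9/8) \<le> \<eta> * x\<^sup>2"
    "\<forall>\<^sub>F x in at_top. 2 * real h + 2 * sqrt (15 * x powr (3/4) * x powr (9/8)) \<le> \<gamma> / 2 * x"
    using \<eta>(1) \<gamma> by real_asymp+
  show "\<forall>\<^sub>F n in sequentially. measure_pmf.prob (gnp n (p n)) {G. (1 + \<delta>) * d n \<le> max_eigenvalue n G \<and>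
      real (max_degree n G) < (1 + \<delta>)\<^sup>2 * (1 - chi) * (d n)\<^sup>2} \<le> exp (- C * speed n)"
    using huge rest eventually_d[OF e(1)] eventually_d[OF e(2)]
      d_power_le_n[of "2 * (h * ((1 + \<delta>)\<^sup>2 * (1 - chi)))" 4] speed_large[of 1] d_large[of 1] n_large[of 1]
  proof eventually_elim
    case (elim n)
    have d0: "d n > 0" and n: "n \<ge> 1" using elim by auto
    let ?P = "\<lambda>G. (1 + \<delta>) * d n \<le> max_eigenvalue n G \<and>
      real (max_degree n G) < (1 + \<delta>)\<^sup>2 * (1 - chi) * (d n)\<^sup>2"
    let ?E = "\<lambda>G. h \<le> card (high_degree n (\<eta> * (d n)\<^sup>2) G)"
    let ?R = "\<lambda>G. core1 n G \<or> core2 n G \<or> many n G \<or> shared n G \<or> heavy n G"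
    let ?prob = "measure_pmf.prob (gnp n (p n))"
    have "?prob {G. ?P G} \<le> ?prob {G. ?E G \<or> ?R G}"
    proof (rule gnp_prob_mono, rule ccontr)
      fix G assume G: "G \<subseteq> vertex_pairs n" and P: "?P G" and not: "\<not> (?E G \<or> ?R G)"
      define \<Delta> where "\<Delta> = (s * d n)\<^sup>2"
      have \<Delta>_eq: "\<Delta> = (1 + \<delta>)\<^sup>2 * (1 - chi) * (d n)\<^sup>2"
        unfolding \<Delta>_def power_mult_distrib s(3) ..
      let ?H = "high_degree n (\<eta> * (d n)\<^sup>2) G"
      have card_H: "card ?H \<le> h" using not by simp
      have "max_eigenvalue n G \<le> max (sqrt \<Delta>) (d n) + 2 * sqrt (h * (h + \<beta> * (d n)\<^sup>2))
          + 2 * (sqrt (16 * (\<eta> * (d n)\<^sup>2)) + sqrt (\<beta> * (d n)\<^sup>2))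
          + 2 * (sqrt (15 * d n powr (3/4) * d n powr (9/8)) + sqrt (\<beta> * (d n)\<^sup>2)) + 8 * \<epsilon> * d n"
      proof (rule max_eigenvalue_le_of_structure[OF G n d0])
        show "\<Delta> > 0" using s d0 by (simp add: \<Delta>_def)
        show "deg G v \<le> \<Delta>" if "v < n" for v
          using deg_le_max_degree[OF G that] P unfolding \<Delta>_eq by linarith
        show "0 < d n powr (9/8)" using d0 by simp
        show "d n powr (9/8) \<le> \<eta> * (d n)\<^sup>2" by (rule elim(3))
        show "card ?H \<le> real h" using card_H by simp
        have "?H \<subseteq> {..<n}" by (auto simp: high_degree_def)
        thus "card (shared_neighbours n ?H G) \<le> \<beta> * (d n)\<^sup>2"
          using not card_H unfolding shared_def by (meson le_cases)
        \<comment> \<open>Half of the allowed n / d^2 vertices are reserved for the neighbours of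
          the huge vertices, the other half for the degrees above \<open>d^(9/8)\<close>.\<close>
        have "h * \<Delta> \<le> n / (2 * (d n)\<^sup>2)"
        proof -
          have "h * \<Delta> * (2 * (d n)\<^sup>2) = 2 * (h * ((1 + \<delta>)\<^sup>2 * (1 - chi))) * d n ^ 4"
            unfolding \<Delta>_eq by (simp add: eval_nat_numeral)
          also have "\<dots> \<le> n" by (rule elim(5))
          finally show ?thesis using d0 by (simp add: field_simps)
        qed
        moreover have "card (high_degree n (d n powr (9/8)) G) \<le> n / (2 * (d n)\<^sup>2)"
          using not unfolding many_def by linarith
        moreover have "n / (2 * (d n)\<^sup>2) + n / (2 * (d n)\<^sup>2) = 1 / (d n)\<^sup>2 * n"
          using d0 by (simp add: field_simps)
        ultimately show "card (high_degree n (d n powr (9/8)) G) + h * \<Delta> \<le> 1 / (d n)\<^sup>2 * n" by linarith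
        show "\<not> has_dense_core G (1 / (d n)\<^sup>2 * n) 16 (\<beta> * (d n)\<^sup>2)"
          using not by (simp add: core1_def)
        show "\<not> has_dense_core G (d n powr (-1/2) * n) (15 * d n powr (3/4)) (\<beta> * (d n)\<^sup>2)"
          using not by (simp add: core2_def)
        show "0 < 15 * d n powr (3/4)" "0 < d n powr (1/4)" using d0 by auto
        show "1 \<le> d n powr (-1/2) * (d n powr (1/4))\<^sup>2"
          using d0 by (simp add: power2_eq_square flip: powr_add)
        show "\<not> (\<exists>y. (\<forall>v. 0 \<le> y v \<and> y v \<le> d n powr (1/4) / sqrt n) \<and> (\<Sum>v<n. (y v)\<^sup>2) \<le> 1 \<and>
            d n * (\<Sum>v<n. (y v)\<^sup>2) + 8 * \<epsilon> * d n \<le> 2 * edge_sum G y)"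
          using not by (simp add: heavy_def)
      qed auto
      also have "max (sqrt \<Delta>) (d n) = (1 + \<delta> - \<gamma>) * d n"
        using s d0 by (simp add: \<Delta>_def \<gamma>_def max_mult_distrib_right)
      also have "sqrt (h * (h + \<beta> * (d n)\<^sup>2)) \<le> h + \<gamma> / 64 * d n"
      proof -
        have "sqrt (h * (h + \<beta> * (d n)\<^sup>2)) = sqrt (h\<^sup>2 + h * \<beta> * (d n)\<^sup>2)"
          by (simp add: power2_eq_square algebra_simps)
        also have "\<dots> \<le> sqrt (h\<^sup>2) + sqrt (h * \<beta> * (d n)\<^sup>2)"
          using \<beta> by (intro sqrt_add_le_add_sqrt) auto
        also have "\<dots> = h + \<gamma> / 64 * d n"
          using \<beta>(2) d0 by (simp add: real_sqrt_mult)
        finally show ?thesis .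
      qed
      also have "sqrt (16 * (\<eta> * (d n)\<^sup>2)) = \<gamma> / 16 * d n"
      proof -
        have "(16::real) = 4\<^sup>2" by simp
        hence "sqrt (16::real) = 4" by (metis real_sqrt_abs abs_numeral)
        thus ?thesis using \<eta>(2) d0 by (simp add: real_sqrt_mult)
      qed
      finally have "max_eigenvalue n G \<le> (1 + \<delta> - \<gamma>) * d n + 2 * (h + \<gamma> / 64 * d n)
          + 2 * (\<gamma> / 16 * d n + sqrt (\<beta> * (d n)\<^sup>2))
          + 2 * (sqrt (15 * d n powr (3/4) * d n powr (9/8)) + sqrt (\<beta> * (d n)\<^sup>2)) + 8 * \<epsilon> * d n"
        by simp
      moreover have "sqrt (\<beta> * (d n)\<^sup>2) \<le> \<gamma> / 64 * d n"
        using \<beta>(3) d0 by (simp add: real_sqrt_mult mult_right_mono)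
      moreover have "8 * \<epsilon> * d n \<le> \<gamma> / 8 * d n"
        using \<epsilon>(3) d0 by (intro mult_right_mono) auto
      moreover have "(1 + \<delta>) * d n \<le> max_eigenvalue n G" using P by blast
      moreover have "\<gamma> * d n > 0" using \<gamma> d0 by simp
      moreover have "2 * h + 2 * sqrt (15 * d n powr (3/4) * d n powr (9/8)) \<le> \<gamma> / 2 * d n"
        using elim(4) by simp
      ultimately show False by (simp add: algebra_simps)
    qed
    also have "{G. ?E G \<or> ?R G} = {G. ?E G} \<union> {G. ?R G}" by auto
    also have "?prob \<dots> \<le> ?prob {G. ?E G} + ?prob {G. ?R G}" by (rule measure_Un_le) auto
    also have "\<dots> \<le> 2 * exp (- (C + 1) * speed n)" using elim(1,2) by linarith
    also have "\<dots> \<le> exp (speed n) * exp (- (C + 1) * speed n)"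
    proof (rule mult_right_mono)
      show "2 \<le> exp (speed n)" using elim(6) exp_ge_add_one_self[of "speed n"] by linarith
    qed simp
    also have "\<dots> = exp (- C * speed n)" by (simp add: exp_add[symmetric] algebra_simps)
    finally show ?case .
  qed
qed

section \<open>Lower bound for the upper tail and the conditional probability\<close>

text \<open>It suffices that vertex 0 alone has degree about (1 + \<delta>)^2 d^2. The constant
  \<open>C\<close> need not be sharp, since the competing event beats every constant.\<close>

lemma eigenvalue_upper_tail_ge:
  assumes \<delta>: "\<delta> > 0"
  obtains C where "C > 0" "\<forall>\<^sub>F n in sequentially.
    exp (- C * speed n) \<le> measure_pmf.prob (gnp n (p n)) {G. (1 + \<delta>) * d n \<le> max_eigenvalue n G}"
proof -
  define A where "A = (1 + \<delta>)\<^sup>2"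
  define C where "C = 4 * A + 4"
  have A: "A \<ge> 1" using \<delta> by (simp add: A_def)
  have e: "\<forall>\<^sub>F x in at_top. 4 * A * x\<^sup>2 \<le> x ^ 3" by real_asymp
  have e': "\<forall>\<^sub>F x::real in at_top. 2 * x \<le> x\<^sup>2 * ln x" by real_asymp
  have "\<forall>\<^sub>F n in sequentially.
    exp (- C * speed n) \<le> measure_pmf.prob (gnp n (p n)) {G. (1 + \<delta>) * d n \<le> max_eigenvalue n G}"
    using eventually_d[OF e] eventually_d[OF e'] d_power_le_n[of "4 * A" 2] d_power_le_n[of 2 1]
      d_large[of 2] n_large[of 2]
  proof eventually_elim
    case (elim n)
    define k where "k = nat \<lceil>A * (d n)\<^sup>2\<rceil>"
    have d0: "d n \<ge> 2" and n: "n \<ge> 2" "real n \<ge> 2" using elim by auto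
    have "2\<^sup>2 \<le> (d n)\<^sup>2" using d0 by (intro power_mono) auto
    hence Ad: "A * (d n)\<^sup>2 \<ge> 4" using A mult_mono[of 1 A 4 "(d n)\<^sup>2"] by simp
    have k: "real k \<ge> A * (d n)\<^sup>2" "real k \<le> 2 * A * (d n)\<^sup>2" "k \<ge> 1"
      using Ad unfolding k_def by linarith+
    have kn: "k \<le> n - 1"
    proof -
      have "real k + 1 \<le> 4 * A * (d n)\<^sup>2" using k(2) Ad by linarith
      also have "\<dots> \<le> n" by (rule elim(3))
      finally show ?thesis by linarith
    qed
    have pn: "0 \<le> p n" "p n \<le> 1 / 2"
    proof -
      show "0 \<le> p n" using p_bounds[of n] n by simp
      have "2 * d n \<le> n" using elim(4) by simp
      thus "p n \<le> 1 / 2" using n by (simp add: d field_simps)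
    qed
    have lnd: "ln (d n) \<ge> 0" using d0 by simp
    have "exp (- C * speed n) \<le> exp (- 2 * k * ln (d n)) * exp (- 2 * d n)"
    proof -
      have "2 * k * ln (d n) \<le> 2 * (2 * A * (d n)\<^sup>2) * ln (d n)"
        using k lnd by (intro mult_right_mono mult_left_mono) auto
      also have "\<dots> = 4 * A * speed n" by (simp add: speed_def)
      finally have "2 * k * ln (d n) + 2 * d n \<le> 4 * A * speed n + speed n"
        using elim(2)[folded speed_def] by linarith
      also have "\<dots> \<le> C * speed n"
        using lnd by (simp add: C_def speed_def distrib_right)
      finally show ?thesis by (simp flip: exp_add)
    qed
    also have "\<dots> \<le> ((real n - 1) / k * p n) ^ k * (1 - p n) ^ n"
    proof (intro mult_mono)
      \<comment> \<open>The factor per edge is of order 1 / d. Estimating it below by 1 / d^2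
        swallows all constants and only doubles the exponent.\<close>
      have "exp (- 2 * ln (d n)) = 1 / (d n)\<^sup>2"
        using d0 by (simp add: exp_minus exp_double inverse_eq_divide)
      also have "\<dots> \<le> d n / (4 * A * (d n)\<^sup>2)"
      proof -
        have "4 * A * (d n)\<^sup>2 \<le> d n * (d n)\<^sup>2" using elim(1) by (simp add: power3_eq_cube power2_eq_square mult_ac)
        thus ?thesis using d0 A by (simp add: field_simps)
      qed
      also have "\<dots> \<le> d n / (2 * k)"
        using k d0 A by (intro divide_left_mono mult_pos_pos) auto
      also have "\<dots> \<le> (real n - 1) / k * p n"
      proof -
        have "p n \<le> real n * p n / 2" using n pn mult_right_mono[of 2 "real n" "p n"] by simp
        hence "d n / 2 \<le> (real n - 1) * p n" by (simp add: d algebra_simps)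
        thus ?thesis using k by (simp add: field_simps)
      qed
      finally have "exp (- 2 * ln (d n)) ^ k \<le> ((real n - 1) / k * p n) ^ k"
        by (intro power_mono) auto
      thus "exp (- 2 * k * ln (d n)) \<le> ((real n - 1) / k * p n) ^ k"
        by (simp add: mult_ac flip: exp_of_nat_mult)
      have "exp (- 2 * p n) \<le> 1 - p n"
      proof -
        have "- (2 * p n) \<le> - p n - 2 * (p n)\<^sup>2"
          using pn mult_left_mono[of "p n" "1/2" "p n"] by (simp add: power2_eq_square)
        also have "\<dots> \<le> ln (1 - p n)" using pn by (intro ln_one_minus_pos_lower_bound) auto
        finally have "exp (- 2 * p n) \<le> exp (ln (1 - p n))" by simp
        thus ?thesis using pn by simp
      qed
      hence "exp (- 2 * p n) ^ n \<le> (1 - p n) ^ n" by (intro power_mono) auto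
      thus "exp (- 2 * d n) \<le> (1 - p n) ^ n"
        by (simp add: d mult_ac flip: exp_of_nat_mult)
    qed (use pn n in auto)
    also have "\<dots> \<le> measure_pmf.prob (gnp n (p n)) {G. k \<le> deg G 0}"
      using pn n k(3) kn by (intro gnp_prob_high_degree_ge) auto
    also have "\<dots> \<le> measure_pmf.prob (gnp n (p n)) {G. (1 + \<delta>) * d n \<le> max_eigenvalue n G}"
    proof (rule gnp_prob_mono)
      fix G assume G: "G \<subseteq> vertex_pairs n" and deg: "k \<le> deg G 0"
      have "((1 + \<delta>) * d n)\<^sup>2 \<le> deg G 0"
        using k(1) deg unfolding A_def power_mult_distrib by linarith
      hence "(1 + \<delta>) * d n \<le> sqrt (deg G 0)" by (rule real_le_rsqrt)
      also have "\<dots> \<le> max_eigenvalue n G"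
        using n by (intro sqrt_max_degree_le_max_eigenvalue[OF G]) auto
      finally show "(1 + \<delta>) * d n \<le> max_eigenvalue n G" .
    qed
    finally show ?case .
  qed
  moreover have "C > 0" using A by (simp add: C_def)
  ultimately show ?thesis using that by blast
qed

text \<open>The constant \<open>C\<close> of the lower bound is fixed first; the event without a
  large degree is then bounded with \<open>C + 1\<close>, so its share of the conditioning event is
  at most \<open>exp (- speed n)\<close>.\<close>

lemma cond_prob_large_degree:
  assumes \<delta>: "\<delta> > 0" and chi: "0 < chi" "chi < 1"
  shows "(\<lambda>n. \<P>(G in measure_pmf (gnp n (p n)).
             real (max_degree n G) \<ge> (1 + \<delta>)\<^sup>2 * (1 - chi) * (d n)\<^sup>2
             \<bar> max_eigenvalue n G \<ge> (1 + \<delta>) * d n)) \<longlonglongrightarrow> 1"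
proof (rule tendsto_sandwich)
  let ?prob = "\<lambda>n. measure_pmf.prob (gnp n (p n))"
  let ?E = "\<lambda>n G. (1 + \<delta>) * d n \<le> max_eigenvalue n G"
  let ?D = "\<lambda>n G. (1 + \<delta>)\<^sup>2 * (1 - chi) * (d n)\<^sup>2 \<le> real (max_degree n G)"
  let ?cond = "\<lambda>n. \<P>(G in measure_pmf (gnp n (p n)). ?D n G \<bar> ?E n G)"
  obtain C where C: "C > 0" and lower: "\<forall>\<^sub>F n in sequentially. exp (- C * speed n) \<le> ?prob n {G. ?E n G}"
    using eigenvalue_upper_tail_ge[OF \<delta>] .
  have "\<forall>\<^sub>F n in sequentially. ?prob n {G. ?E n G \<and> real (max_degree n G) <
      (1 + \<delta>)\<^sup>2 * (1 - chi) * (d n)\<^sup>2} \<le> exp (- (C + 1) * speed n)"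
    by (rule superexp_small_eigenvalue_without_star[OF \<delta> chi, unfolded superexp_small_def, rule_format])
      (use C in simp)
  with lower show "\<forall>\<^sub>F n in sequentially. 1 - exp (- speed n) \<le> ?cond n"
  proof eventually_elim
    case (elim n)
    let ?bad = "{G. ?E n G \<and> real (max_degree n G) < (1 + \<delta>)\<^sup>2 * (1 - chi) * (d n)\<^sup>2}"
    have pos: "?prob n {G. ?E n G} > 0" using elim(1) by (rule less_le_trans[OF exp_gt_zero])
    have "{G. ?E n G} = {G. ?D n G \<and> ?E n G} \<union> ?bad" by auto
    hence "?prob n {G. ?E n G} = ?prob n ({G. ?D n G \<and> ?E n G} \<union> ?bad)" by simp
    also have "\<dots> = ?prob n {G. ?D n G \<and> ?E n G} + ?prob n ?bad"
      by (rule measure_pmf.finite_measure_Union) auto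
    finally have eq: "?prob n {G. ?D n G \<and> ?E n G} = ?prob n {G. ?E n G} - ?prob n ?bad" by simp
    have "?prob n ?bad \<le> exp (- (C + 1) * speed n)" by (rule elim(2))
    also have "\<dots> = exp (- speed n) * exp (- C * speed n)"
      by (simp add: exp_add[symmetric] algebra_simps)
    also have "\<dots> \<le> exp (- speed n) * ?prob n {G. ?E n G}"
      using elim(1) by (intro mult_left_mono) auto
    finally have "(1 - exp (- speed n)) * ?prob n {G. ?E n G} \<le> ?prob n {G. ?D n G \<and> ?E n G}"
      unfolding eq by (simp add: algebra_simps)
    hence "1 - exp (- speed n) \<le> ?prob n {G. ?D n G \<and> ?E n G} / ?prob n {G. ?E n G}"
      using pos by (simp add: le_divide_eq)
    also have "\<dots> = ?cond n" by (simp add: cond_prob_def)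
    finally show ?case .
  qed
  show "\<forall>\<^sub>F n in sequentially. ?cond n \<le> 1"
  proof (intro always_eventually allI)
    fix n
    have "?prob n {G. ?D n G \<and> ?E n G} \<le> ?prob n {G. ?E n G}"
      by (intro measure_pmf.finite_measure_mono) auto
    \<comment> \<open>This includes a conditioning event of probability 0, where the quotient is 0
      by convention.\<close>
    thus "?cond n \<le> 1"
      by (auto simp: cond_prob_def divide_le_eq_1 less_le)
  qed
  have "filterlim (\<lambda>x::real. 1 - exp (- x)) (nhds 1) at_top" by real_asymp
  from filterlim_compose[OF this speed_at_top] show "(\<lambda>n. 1 - exp (- speed n)) \<longlonglongrightarrow> 1" .
qed simp

end

text \<open>The lower bound on \<open>d\<close> is used twice: it gives
  \<open>ln d \<ge> ln (ln n) / 4\<close>, and substituting this turns the first limit into four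
  times the square of the ratio that tends to 0.\<close>

lemma sparse_regimeI:
  fixes p d :: "nat \<Rightarrow> real"
  assumes p: "\<And>n. n \<ge> 1 \<Longrightarrow> 0 < p n \<and> p n < 1"
    and d: "\<And>n. d n = real n * p n"
    and d_lower: "(\<lambda>n. sqrt (ln (real n) / ln (ln (real n)))) \<lless> d"
    and d_upper: "(\<lambda>n. ln (d n)) \<lless> (\<lambda>n. ln (1 / p n))"
  shows "sparse_regime p d"
proof
  let ?s = "\<lambda>n. sqrt (ln (real n) / ln (ln (real n)))"
  have d_pos: "d n > 0" if "n \<ge> 1" for n using p[OF that] that by (simp add: d)
  have s_le: "\<forall>\<^sub>F n in sequentially. c * ?s n \<le> d n" if c: "c > 0" for c
  proof -
    have "\<forall>\<^sub>F n in sequentially. ?s n / d n < 1 / c"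
      using d_lower c unfolding much_less_def by (intro order_tendstoD) auto
    thus ?thesis using eventually_ge_at_top[of "1::nat"]
    proof eventually_elim
      case (elim n)
      thus ?case using c d_pos[of n] by (simp add: field_simps)
    qed
  qed
  have s_le_d: "\<forall>\<^sub>F n in sequentially. ?s n \<le> d n" using s_le[of 1] by simp
  have "filterlim ?s at_top sequentially" by real_asymp
  thus d_top: "filterlim d at_top sequentially"
    by (rule filterlim_at_top_mono) (rule s_le_d)
  have d_ge: "\<forall>\<^sub>F n in sequentially. c \<le> d n" for c
    using d_top by (simp add: filterlim_at_top)
  show "(\<lambda>n. ln (real n) / ((d n)\<^sup>2 * ln (d n))) \<longlonglongrightarrow> 0"
  proof (rule tendsto_sandwich)
    \<comment> \<open>The logarithm of \<open>?s n\<close> is half of ln (ln n) minus a lower-order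
      triple logarithm, so a quarter is a safe bound.\<close>
    have "\<forall>\<^sub>F n in sequentially. ln (ln (real n)) > 0" "\<forall>\<^sub>F n in sequentially. ln (real n) > 0"
      "\<forall>\<^sub>F n in sequentially. ln (ln (real n)) / 4 \<le> ln (?s n)"
      by real_asymp+
    note ev = this s_le_d d_ge[of 2] eventually_ge_at_top[of "1::nat"]
    show "\<forall>\<^sub>F n in sequentially. 0 \<le> ln (real n) / ((d n)\<^sup>2 * ln (d n))"
      using ev(2) d_ge[of 2] by eventually_elim auto
    show "\<forall>\<^sub>F n in sequentially. ln (real n) / ((d n)\<^sup>2 * ln (d n)) \<le> 4 * (?s n / d n)\<^sup>2"
      using ev
    proof eventually_elim
      case (elim n)
      have s: "?s n > 0" using elim by simp
      have "ln (?s n) \<le> ln (d n)" using elim(4,5) s by (subst ln_le_cancel_iff) auto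
      hence ln_d: "ln (ln (real n)) / 4 \<le> ln (d n)" using elim(3) by linarith
      have "ln (real n) / ((d n)\<^sup>2 * ln (d n)) \<le> ln (real n) / ((d n)\<^sup>2 * (ln (ln (real n)) / 4))"
        using elim ln_d by (intro divide_left_mono mult_left_mono mult_pos_pos) auto
      also have "\<dots> = 4 * (?s n / d n)\<^sup>2"
        using elim by (simp add: power_divide mult_ac)
      finally show ?case .
    qed
    have "(\<lambda>n. ?s n / d n) \<longlonglongrightarrow> 0" using d_lower by (simp add: much_less_def)
    hence "(\<lambda>n. 4 * (?s n / d n)\<^sup>2) \<longlonglongrightarrow> 4 * 0\<^sup>2" by (intro tendsto_intros)
    thus "(\<lambda>n. 4 * (?s n / d n)\<^sup>2) \<longlonglongrightarrow> 0" by simp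
  qed simp
  show "(\<lambda>n. ln (d n) / ln (real n)) \<longlonglongrightarrow> 0"
  proof (rule tendsto_sandwich)
    have ln_eq: "ln (1 / p n) = ln (real n) - ln (d n)" if "n \<ge> 1" for n
      using p[OF that] that by (simp add: d ln_div ln_mult)
    show "\<forall>\<^sub>F n in sequentially. 0 \<le> ln (d n) / ln (real n)"
      using d_ge[of 1] eventually_ge_at_top[of "1::nat"] by eventually_elim auto
    show "\<forall>\<^sub>F n in sequentially. ln (d n) / ln (real n) \<le> ln (d n) / ln (1 / p n)"
      using d_ge[of 2] eventually_ge_at_top[of "2::nat"]
    proof eventually_elim
      case (elim n)
      \<comment> \<open>The denominators compare because ln (1 / p) = ln n - ln d with d \<ge>
        1.\<close>
      have "ln (1 / p n) > 0" using p[of n] elim by simp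
      moreover have "ln (1 / p n) \<le> ln (real n)" using ln_eq[of n] elim by simp
      ultimately show ?case using elim by (intro divide_left_mono) auto
    qed
    show "(\<lambda>n. ln (d n) / ln (1 / p n)) \<longlonglongrightarrow> 0" using d_upper by (simp add: much_less_def)
  qed simp
qed (use p d in auto)

theorem corollary1p3:
  fixes p d :: "nat \<Rightarrow> real" and \<delta> chi :: real
  assumes p: "\<And>n. n \<ge> 1 \<Longrightarrow> 0 < p n \<and> p n < 1"
    and d: "\<And>n. d n = real n * p n"
    and d_lower: "(\<lambda>n. sqrt (ln (real n) / ln (ln (real n)))) \<lless> d"
    and d_upper: "(\<lambda>n. ln (d n)) \<lless> (\<lambda>n. ln (1 / p n))"
    and \<delta>: "\<delta> > 0"
    and chi: "0 < chi" "chi < 1"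
  shows "(\<lambda>n. \<P>(G in measure_pmf (gnp n (p n)).
             real (max_degree n G) \<ge> (1 + \<delta>)\<^sup>2 * (1 - chi) * (d n)\<^sup>2
             \<bar> max_eigenvalue n G \<ge> (1 + \<delta>) * d n)) \<longlonglongrightarrow> 1"
proof -
  interpret sparse_regime p d
    by (rule sparse_regimeI[OF p d d_lower d_upper])
  show ?thesis by (rule cond_prob_large_degree[OF \<delta> chi])
qed

end
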